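(* A program $P$ is robust against Power if and only if there is no Power computation of $P$ in normal form of degree $|P|+3$ whose trace has a cyclic happens-before relation $hb=po\cup co\cup src\cup cf$.
   Context: Programs. Fix a finite set $D$ of values, which also serve as addresses, with $0\in D$, and a finite set $\mathit{Reg}$ of registers taking values in $D$. Expressions are built from constants in $D$, registers, and functions over $D\cup\{\bot\}$ that return $\bot$ iff some argument is $\bot$. Commands are: loads $r\leftarrow \mathrm{mem}[e]$, stores $\mathrm{mem}[e]\leftarrow e'$, local assignments $r\leftarrow e$, and conditionals $\mathrm{assume}(e)$. A thread is a finite automaton whose transitions (called instructions) are labeled by commands; all control states are final. A program $P=T_1\cdots T_n$ is a finite sequence of threads; thread $T_t$ has id $t\in\{1,\dots,|P|\}$ ($|P|$ = number of threads). Power semantics. A state consists of, for each thread $t$, a runtime state $(F,C,L)$, where $F$ is the sequence of fetched instructions, $C\subseteq\{1..|F|\}$ the set of committed indices, and $L$ maps each index to $\bot$ or to the store the load there has read (an initial store $\mathrm{init}_a$ of value $0$ to address $a$, or a pair $(t',i')$ denoting the $i'$-th fetched instruction of thread $t'$); and a storage state $(co,prop)$, where $co$ assigns rational coherence keys to committed stores (initial stores have key $0$) and $prop(t,a)$ is the last store to address $a$ propagated to thread $t$ (initially $\mathrm{init}_a$). For the $i$-th fetched instruction of thread $t$, the value of a register $r$ is determined by the latest earlier fetched assignment or load to $r$ ($0$ if none; for a load: $\bot$ if it has read nothing yet, $0$ if it read an initial store, otherwise the value written by the store it read); expressions are evaluated accordingly; $\mathrm{addr}(t,i)$ and $\mathrm{val}(t,i)$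 are the evaluated address and value arguments ($\top$ if none). Address/data dependencies of an instruction are the earlier instructions its address/value expression depends on via registers; control dependencies are all earlier fetched assume instructions. Transitions (labeled by events) are: (fetch) append to $F$ an instruction of $T_t$ whose source state is the target of the last fetched instruction (or the initial state), event $(\mathrm{fetch},t,\text{instr})$; (load from memory) for a fetched load $i$ with $L[i]=\bot$ and address $a\neq\bot$, set $L[i]:=prop(t,a)$, event $(\mathrm{load},t,i,a)$; (early read) for such a load, if the greatest $i'<i$ such that instruction $i'$ is a store with address in $\{a,\bot\}$ has address $a$, known value, and is not committed, set $L[i]:=(t,i')$, same event; (commit of a non-store) for uncommitted $i$ whose address, data and control dependencies are committed, with address and value $\neq\bot$, all earlier instructions with address $a$ or $\bot$ committed if the instruction has address $a$, $L[i]\neq\bot$ for loads, and value $\neq0$ for assumes: add $i$ to $C$, event $(\mathrm{commit},t,i)$; (commit of a store) same preconditions, choose a key $k$ not used by any other store, set $co(t,i):=k$, event $(\mathrm{commit},t,i,k,a)$, immediately followed by propagation of this store to thread $t$; (propagate) for a committed store $(t',i')$ to address $a$ with $co(prop(t,a))<co(t',i')$, set $prop(t,a):=(t',i')$, event $(\mathrm{prop},t,t',i',a)$. Final states: all fetched instructions committed; for loads $i'<i$ of the same thread and address, $co(L[i'])\le co(L[i])$; for a store $i'$ and later load $i$ of the same thread and address, $co(t,i')\le co(L[i])$. Power computations $C_{\mathrm{Power}}(P)$ are the event sequences from the initial state to a final state; SC computations $C_{\mathrm{SC}}(P)\subseteq C_{\mathrm{Power}}(P)$ are those in which each instruction is executed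 atomically and stores are immediately propagated to all threads. Traces and robustness. The trace of a computation is the graph whose nodes are the fetched instructions (with thread id and index) plus initial stores, with relations: program order $po$ (consecutive fetched instructions of a thread), coherence order $co$ (stores to the same address ordered by key; $\mathrm{init}_a$ before all stores to $a$), source order $src$ (store $\to$ load that read it), conflict order $cf=\{(x,y)\mid \exists z: z\,src\,x,\ z\,co\,y\}$. $P$ is robust iff every trace of a Power computation of $P$ is the trace of some SC computation of $P$. Normal form. An event is related to instruction $(t,i)$ if it is the fetch of the $i$-th instruction of thread $t$, or a load/commit event of $(t,i)$, or a propagate event $(\mathrm{prop},t'',t,i,a)$ of store $(t,i)$. A computation $\tau$ is in normal form of degree $n$ if $\tau=\tau_1\cdots\tau_n$ such that (A) all fetch events lie in $\tau_1$, and (B) whenever $e_j,e_j'$ are events related to instruction $(t_j,i_j)$ for $j=1,2$, with $e_1,e_2\in\tau_s$ and $e_1',e_2'\in\tau_{s'}$, then $e_1$ precedes $e_2$ in $\tau_s$ iff $e_1'$ precedes $e_2'$ in $\tau_{s'}$.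
   Formalization: Condition (B) of normal form is required only for events related to two distinct instructions; read literally, it fails whenever a store's commit and its immediate propagation lie in one part, and the equivalence is then false. *)

theory Defs
  imports Complex_Main
begin

text \<open>Values/addresses: a finite type 'd with 0. Registers: a finite type 'r.
  Expressions: constants, registers, and (strict) functions: App f es evaluates to
  bottom iff some argument evaluates to bottom, and otherwise applies f.\<close>

datatype ('d, 'r) expr =
    Const 'd
  | Reg 'r
  | App "'d list \<Rightarrow> 'd" "('d, 'r) expr list"

fun eval :: "('r \<Rightarrow> 'd option) \<Rightarrow> ('d, 'r) expr \<Rightarrow> 'd option" where
  "eval \<rho> (Const d) = Some d"
| "eval \<rho> (Reg r) = \<rho> r"
| "eval \<rho> (App f es) =
     (if (\<exists>e \<in> set es. eval \<rho> e = None) then None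
      else Some (f (map (\<lambda>e. the (eval \<rho> e)) es)))"

fun regs :: "('d, 'r) expr \<Rightarrow> 'r set" where
  "regs (Const d) = {}"
| "regs (Reg r) = {r}"
| "regs (App f es) = (\<Union>e \<in> set es. regs e)"

datatype ('d, 'r) cmd =
    CLoad 'r "('d, 'r) expr"
  | CStore "('d, 'r) expr" "('d, 'r) expr"  (* mem[e] <- e' *)
  | CAssign 'r "('d, 'r) expr"
  | CAssume "('d, 'r) expr"

fun is_load :: "('d, 'r) cmd \<Rightarrow> bool" where
  "is_load (CLoad _ _) = True" | "is_load _ = False"
fun is_store :: "('d, 'r) cmd \<Rightarrow> bool" where
  "is_store (CStore _ _) = True" | "is_store _ = False"
fun is_assume :: "('d, 'r) cmd \<Rightarrow> bool" where
  "is_assume (CAssume _) = True" | "is_assume _ = False"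

fun writes :: "('d, 'r) cmd \<Rightarrow> 'r \<Rightarrow> bool" where
  "writes (CLoad r _) r' = (r = r')"
| "writes (CAssign r _) r' = (r = r')"
| "writes _ _ = False"

fun addr_expr :: "('d, 'r) cmd \<Rightarrow> ('d, 'r) expr option" where
  "addr_expr (CLoad _ e) = Some e"
| "addr_expr (CStore e _) = Some e"
| "addr_expr _ = None"

fun val_expr :: "('d, 'r) cmd \<Rightarrow> ('d, 'r) expr option" where
  "val_expr (CStore _ e) = Some e"
| "val_expr (CAssign _ e) = Some e"
| "val_expr (CAssume e) = Some e"
| "val_expr (CLoad _ _) = None"

text \<open>An instruction is a transition (source state, command, target state).
  A thread is a finite automaton: an initial control state and a (finite) set of
  transitions; all control states are final. A program is a list of threads;
  thread ids are the list indices 0..<length P (0-based).\<close>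

type_synonym ('q, 'd, 'r) instr = "'q \<times> ('d, 'r) cmd \<times> 'q"
type_synonym ('q, 'd, 'r) thread = "'q \<times> ('q, 'd, 'r) instr set"
type_synonym ('q, 'd, 'r) program = "('q, 'd, 'r) thread list"

text \<open>Stores: the initial store to address a, or (t, i), the i-th (0-based)
  fetched instruction of thread t.\<close>
datatype 'd sid = Init 'd | St nat nat

record ('q, 'd, 'r) pstate =
  Fs :: "nat \<Rightarrow> ('q, 'd, 'r) instr list"     (* fetched instructions *)
  Cs :: "nat \<Rightarrow> nat set"                    (* committed indices *)
  Ls :: "nat \<Rightarrow> nat \<Rightarrow> 'd sid option"       (* store read by a load *)
  co :: "nat \<times> nat \<Rightarrow> rat option"           (* coherence keys of committed stores *)
  prp :: "nat \<Rightarrow> 'd \<Rightarrow> 'd sid"              (* last store propagated to thread/address *)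

definition init_state :: "('q, 'd, 'r) pstate" where
  "init_state = \<lparr> Fs = (\<lambda>t. []), Cs = (\<lambda>t. {}), Ls = (\<lambda>t i. None),
                  co = (\<lambda>x. None), prp = (\<lambda>t a. Init a) \<rparr>"

definition cmd_of :: "('q, 'd, 'r) pstate \<Rightarrow> nat \<Rightarrow> nat \<Rightarrow> ('d, 'r) cmd" where
  "cmd_of s t i = fst (snd (Fs s t ! i))"

fun cokey :: "('q, 'd, 'r) pstate \<Rightarrow> 'd sid \<Rightarrow> rat" where
  "cokey s (Init a) = 0"
| "cokey s (St t i) = the (co s (t, i))"

definition last_writer :: "('q, 'd, 'r) pstate \<Rightarrow> nat \<Rightarrow> nat \<Rightarrow> 'r \<Rightarrow> nat option" where
  "last_writer s t i r =
     (if \<exists>j < i. writes (cmd_of s t j) r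
      then Some (GREATEST j. j < i \<and> writes (cmd_of s t j) r) else None)"

text \<open>Register values (None = bottom). Since in reachable states the register
  dependencies are acyclic, evaluation with a fuel bounded by the number of fetched
  instructions (plus 2) yields exactly the value described in the paper.\<close>
fun rv :: "nat \<Rightarrow> ('q, 'd::zero, 'r) pstate \<Rightarrow> nat \<Rightarrow> nat \<Rightarrow> 'r \<Rightarrow> 'd option" where
  "rv 0 s t i r = None"
| "rv (Suc n) s t i r =
     (case last_writer s t i r of
        None \<Rightarrow> Some 0
      | Some j \<Rightarrow>
          (case cmd_of s t j of
             CAssign _ e \<Rightarrow> eval (rv n s t j) e
           | CLoad _ _ \<Rightarrow>
               (case Ls s t j of
                  None \<Rightarrow> None
                | Some (Init a) \<Rightarrow> Some 0
                | Some (St t' i') \<Rightarrow>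
                    (case cmd_of s t' i' of
                       CStore _ e' \<Rightarrow> eval (rv n s t' i') e'
                     | _ \<Rightarrow> None))
           | _ \<Rightarrow> None))"

definition fuel :: "('q, 'd::zero, 'r) program \<Rightarrow> ('q, 'd::zero, 'r) pstate \<Rightarrow> nat" where
  "fuel P s = Suc (Suc (\<Sum>t < length P. length (Fs s t)))"

definition ev_expr :: "('q, 'd::zero, 'r) program \<Rightarrow> ('q, 'd::zero, 'r) pstate \<Rightarrow> nat \<Rightarrow> nat
                        \<Rightarrow> ('d, 'r) expr \<Rightarrow> 'd option" where
  "ev_expr P s t i e = eval (rv (fuel P s) s t i) e"

text \<open>addr / val: None = top (no such argument), Some None = bottom.\<close>
definition addr :: "('q, 'd::zero, 'r) program \<Rightarrow> ('q, 'd::zero, 'r) pstate \<Rightarrow> nat \<Rightarrow> nat \<Rightarrow> 'd option option" where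
  "addr P s t i = map_option (ev_expr P s t i) (addr_expr (cmd_of s t i))"

definition val :: "('q, 'd::zero, 'r) program \<Rightarrow> ('q, 'd::zero, 'r) pstate \<Rightarrow> nat \<Rightarrow> nat \<Rightarrow> 'd option option" where
  "val P s t i = map_option (ev_expr P s t i) (val_expr (cmd_of s t i))"

definition deps_of :: "('q, 'd::zero, 'r) pstate \<Rightarrow> nat \<Rightarrow> nat \<Rightarrow> ('d, 'r) expr option \<Rightarrow> nat set" where
  "deps_of s t i eo = (case eo of None \<Rightarrow> {}
      | Some e \<Rightarrow> {j. \<exists>r \<in> regs e. last_writer s t i r = Some j})"

definition addr_deps :: "('q, 'd::zero, 'r) pstate \<Rightarrow> nat \<Rightarrow> nat \<Rightarrow> nat set" where
  "addr_deps s t i = deps_of s t i (addr_expr (cmd_of s t i))"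

definition data_deps :: "('q, 'd::zero, 'r) pstate \<Rightarrow> nat \<Rightarrow> nat \<Rightarrow> nat set" where
  "data_deps s t i = deps_of s t i (val_expr (cmd_of s t i))"

definition ctrl_deps :: "('q, 'd::zero, 'r) pstate \<Rightarrow> nat \<Rightarrow> nat \<Rightarrow> nat set" where
  "ctrl_deps s t i = {j. j < i \<and> is_assume (cmd_of s t j)}"

definition cur_q :: "('q, 'd::zero, 'r) program \<Rightarrow> ('q, 'd::zero, 'r) pstate \<Rightarrow> nat \<Rightarrow> 'q" where
  "cur_q P s t = (if Fs s t = [] then fst (P ! t) else snd (snd (last (Fs s t))))"

definition commit_ok :: "('q, 'd::zero, 'r) program \<Rightarrow> ('q, 'd::zero, 'r) pstate \<Rightarrow> nat \<Rightarrow> nat \<Rightarrow> bool" where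
  "commit_ok P s t i \<longleftrightarrow>
     t < length P \<and> i < length (Fs s t) \<and> i \<notin> Cs s t \<and>
     addr_deps s t i \<union> data_deps s t i \<union> ctrl_deps s t i \<subseteq> Cs s t \<and>
     addr P s t i \<noteq> Some None \<and> val P s t i \<noteq> Some None \<and>
     (\<forall>a. addr P s t i = Some (Some a) \<longrightarrow>
        (\<forall>j < i. addr P s t j \<in> {Some (Some a), Some None} \<longrightarrow> j \<in> Cs s t)) \<and>
     (is_load (cmd_of s t i) \<longrightarrow> Ls s t i \<noteq> None) \<and>
     (is_assume (cmd_of s t i) \<longrightarrow> (\<exists>v. val P s t i = Some (Some v) \<and> v \<noteq> 0))"

datatype ('q, 'd, 'r) event =
    EFetch nat "('q, 'd, 'r) instr"
  | ELoad nat nat 'd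
  | ECommit nat nat
  | ECommitSt nat nat rat 'd
  | EProp nat nat nat 'd

text \<open>One transition. The commit of a store is immediately followed by the
  propagation of that store to its own thread; this is modelled as one transition
  emitting the two events.\<close>
inductive step :: "('q, 'd::zero, 'r) program \<Rightarrow> ('q, 'd::zero, 'r) pstate \<Rightarrow> ('q, 'd, 'r) event list
                   \<Rightarrow> ('q, 'd::zero, 'r) pstate \<Rightarrow> bool" for P where
  fetch: "\<lbrakk> t < length P; (q, c, q') \<in> snd (P ! t); q = cur_q P s t \<rbrakk> \<Longrightarrow>
     step P s [EFetch t (q, c, q')] (s\<lparr> Fs := (Fs s)(t := Fs s t @ [(q, c, q')]) \<rparr>)"
| load_mem: "\<lbrakk> t < length P; i < length (Fs s t); is_load (cmd_of s t i); Ls s t i = None;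
     addr P s t i = Some (Some a) \<rbrakk> \<Longrightarrow>
     step P s [ELoad t i a] (s\<lparr> Ls := (Ls s)(t := (Ls s t)(i := Some (prp s t a))) \<rparr>)"
| early_read: "\<lbrakk> t < length P; i < length (Fs s t); is_load (cmd_of s t i); Ls s t i = None;
     addr P s t i = Some (Some a);
     \<exists>j < i. is_store (cmd_of s t j) \<and> addr P s t j \<in> {Some (Some a), Some None};
     i' = (GREATEST j. j < i \<and> is_store (cmd_of s t j) \<and> addr P s t j \<in> {Some (Some a), Some None});
     addr P s t i' = Some (Some a); val P s t i' \<noteq> Some None; i' \<notin> Cs s t \<rbrakk> \<Longrightarrow>
     step P s [ELoad t i a] (s\<lparr> Ls := (Ls s)(t := (Ls s t)(i := Some (St t i'))) \<rparr>)"
| commit: "\<lbrakk> commit_ok P s t i; \<not> is_store (cmd_of s t i) \<rbrakk> \<Longrightarrow>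
     step P s [ECommit t i] (s\<lparr> Cs := (Cs s)(t := insert i (Cs s t)) \<rparr>)"
| commit_store: "\<lbrakk> commit_ok P s t i; is_store (cmd_of s t i); addr P s t i = Some (Some a);
     k \<noteq> 0; \<forall>x. co s x \<noteq> Some k; cokey s (prp s t a) < k \<rbrakk> \<Longrightarrow>
     step P s [ECommitSt t i k a, EProp t t i a]
       (s\<lparr> Cs := (Cs s)(t := insert i (Cs s t)), co := (co s)((t, i) := Some k),
           prp := (prp s)(t := (prp s t)(a := St t i)) \<rparr>)"
| propagate: "\<lbrakk> t < length P; t' < length P; i' < length (Fs s t'); i' \<in> Cs s t';
     is_store (cmd_of s t' i'); addr P s t' i' = Some (Some a); co s (t', i') = Some k;
     cokey s (prp s t a) < k \<rbrakk> \<Longrightarrow>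
     step P s [EProp t t' i' a] (s\<lparr> prp := (prp s)(t := (prp s t)(a := St t' i')) \<rparr>)"

inductive steps :: "('q, 'd::zero, 'r) program \<Rightarrow> ('q, 'd::zero, 'r) pstate \<Rightarrow> ('q, 'd, 'r) event list
                   \<Rightarrow> ('q, 'd::zero, 'r) pstate \<Rightarrow> bool" for P where
  refl: "steps P s [] s"
| step: "\<lbrakk> step P s e s'; steps P s' es s'' \<rbrakk> \<Longrightarrow> steps P s (e @ es) s''"

definition final :: "('q, 'd::zero, 'r) program \<Rightarrow> ('q, 'd::zero, 'r) pstate \<Rightarrow> bool" where
  "final P s \<longleftrightarrow>
     (\<forall>t < length P. Cs s t = {..< length (Fs s t)}) \<and>
     (\<forall>t < length P. \<forall>i' i a. i' < i \<and> i < length (Fs s t) \<and>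
        is_load (cmd_of s t i') \<and> is_load (cmd_of s t i) \<and>
        addr P s t i' = Some (Some a) \<and> addr P s t i = Some (Some a) \<longrightarrow>
        cokey s (the (Ls s t i')) \<le> cokey s (the (Ls s t i))) \<and>
     (\<forall>t < length P. \<forall>i' i a. i' < i \<and> i < length (Fs s t) \<and>
        is_store (cmd_of s t i') \<and> is_load (cmd_of s t i) \<and>
        addr P s t i' = Some (Some a) \<and> addr P s t i = Some (Some a) \<longrightarrow>
        cokey s (St t i') \<le> cokey s (the (Ls s t i)))"

text \<open>A Power computation: an event sequence es leading from the initial state to
  the final state s (the pair (es, s) is the computation; s determines its trace).\<close>
definition power_comp :: "('q, 'd::zero, 'r) program \<Rightarrow> ('q, 'd, 'r) event list
                          \<Rightarrow> ('q, 'd::zero, 'r) pstate \<Rightarrow> bool" where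
  "power_comp P es s \<longleftrightarrow> steps P init_state es s \<and> final P s"

fun is_fetch_of :: "nat \<Rightarrow> ('q, 'd, 'r) event \<Rightarrow> bool" where
  "is_fetch_of t (EFetch t' _) = (t = t')" | "is_fetch_of t _ = False"

fun is_fetch :: "('q, 'd, 'r) event \<Rightarrow> bool" where
  "is_fetch (EFetch _ _) = True" | "is_fetch _ = False"

definition rel_instr :: "('q, 'd, 'r) event list \<Rightarrow> nat \<Rightarrow> nat \<times> nat" where
  "rel_instr es p = (case es ! p of
      EFetch t _ \<Rightarrow> (t, length (filter (is_fetch_of t) (take p es)))
    | ELoad t i _ \<Rightarrow> (t, i)
    | ECommit t i \<Rightarrow> (t, i)
    | ECommitSt t i _ _ \<Rightarrow> (t, i)
    | EProp _ t i _ \<Rightarrow> (t, i))"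

definition is_committed_store :: "('q, 'd::zero, 'r) program \<Rightarrow> ('q, 'd::zero, 'r) pstate \<Rightarrow> nat \<Rightarrow> nat \<Rightarrow> bool" where
  "is_committed_store P s t i \<longleftrightarrow> t < length P \<and> i < length (Fs s t) \<and> i \<in> Cs s t \<and>
     is_store (cmd_of s t i)"

text \<open>SC computations: Power computations in which every instruction is executed
  atomically (all events related to an instruction are contiguous) and every store
  is immediately propagated to all threads.\<close>
definition sc_comp :: "('q, 'd::zero, 'r) program \<Rightarrow> ('q, 'd, 'r) event list
                       \<Rightarrow> ('q, 'd::zero, 'r) pstate \<Rightarrow> bool" where
  "sc_comp P es s \<longleftrightarrow> power_comp P es s \<and>
     (\<forall>p q r. p < q \<and> q < r \<and> r < length es \<and> rel_instr es p = rel_instr es r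
        \<longrightarrow> rel_instr es q = rel_instr es p) \<and>
     (\<forall>t i a. is_committed_store P s t i \<and> addr P s t i = Some (Some a) \<longrightarrow>
        (\<forall>t' < length P. EProp t' t i a \<in> set es))"

datatype ('q, 'd, 'r) node = INIT 'd | INS nat nat "('q, 'd, 'r) instr"

record ('q, 'd, 'r) trace =
  tnodes :: "('q, 'd, 'r) node set"
  tpo :: "('q, 'd, 'r) node rel"
  tco :: "('q, 'd, 'r) node rel"
  tsrc :: "('q, 'd, 'r) node rel"
  tcf :: "('q, 'd, 'r) node rel"

definition nd :: "('q, 'd::zero, 'r) pstate \<Rightarrow> nat \<Rightarrow> nat \<Rightarrow> ('q, 'd, 'r) node" where
  "nd s t i = INS t i (Fs s t ! i)"

fun sid_node :: "('q, 'd::zero, 'r) pstate \<Rightarrow> 'd sid \<Rightarrow> ('q, 'd, 'r) node" where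
  "sid_node s (Init a) = INIT a"
| "sid_node s (St t i) = nd s t i"

definition store_at :: "('q, 'd::zero, 'r) program \<Rightarrow> ('q, 'd::zero, 'r) pstate \<Rightarrow> nat \<Rightarrow> nat \<Rightarrow> 'd \<Rightarrow> bool" where
  "store_at P s t i a \<longleftrightarrow> t < length P \<and> i < length (Fs s t) \<and> is_store (cmd_of s t i) \<and>
     addr P s t i = Some (Some a)"

definition trace_of :: "('q, 'd::zero, 'r) program \<Rightarrow> ('q, 'd::zero, 'r) pstate \<Rightarrow> ('q, 'd, 'r) trace" where
  "trace_of P s =
    (let po = {(nd s t i, nd s t (Suc i)) | t i. t < length P \<and> Suc i < length (Fs s t)};
         cor = {(INIT a, nd s t i) | a t i. store_at P s t i a} \<union>
               {(nd s t i, nd s t' i') | t i t' i' a. store_at P s t i a \<and> store_at P s t' i' a \<and>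
                   cokey s (St t i) < cokey s (St t' i')};
         src = {(sid_node s z, nd s t i) | z t i. t < length P \<and> i < length (Fs s t) \<and>
                   is_load (cmd_of s t i) \<and> Ls s t i = Some z};
         cf = {(x, y). \<exists>z. (z, x) \<in> src \<and> (z, y) \<in> cor}
     in \<lparr> tnodes = range INIT \<union> {nd s t i | t i. t < length P \<and> i < length (Fs s t)},
          tpo = po, tco = cor, tsrc = src, tcf = cf \<rparr>)"

definition hb :: "('q, 'd, 'r) trace \<Rightarrow> ('q, 'd, 'r) node rel" where
  "hb tr = tpo tr \<union> tco tr \<union> tsrc tr \<union> tcf tr"

definition cyclic_hb :: "('q, 'd, 'r) trace \<Rightarrow> bool" where
  "cyclic_hb tr \<longleftrightarrow> (\<exists>x. (x, x) \<in> (hb tr)\<^sup>+)"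

definition robust :: "('q, 'd::zero, 'r) program \<Rightarrow> bool" where
  "robust P \<longleftrightarrow> (\<forall>es s. power_comp P es s \<longrightarrow>
      (\<exists>es' s'. sc_comp P es' s' \<and> trace_of P s' = trace_of P s))"

text \<open>es = tau_1 ... tau_n with segment k (0-based) = positions b k ..< b (Suc k).
  Condition (B) is imposed for events related to two distinct instructions.\<close>
definition normal_form :: "('q, 'd, 'r) event list \<Rightarrow> nat \<Rightarrow> bool" where
  "normal_form es n \<longleftrightarrow> (\<exists>b :: nat \<Rightarrow> nat.
     b 0 = 0 \<and> b n = length es \<and> (\<forall>k < n. b k \<le> b (Suc k)) \<and>
     (\<forall>p < length es. is_fetch (es ! p) \<longrightarrow> p < b 1) \<and>
     (\<forall>k < n. \<forall>k' < n. \<forall>p1 p2 q1 q2.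
        p1 \<in> {b k ..< b (Suc k)} \<and> p2 \<in> {b k ..< b (Suc k)} \<and>
        q1 \<in> {b k' ..< b (Suc k')} \<and> q2 \<in> {b k' ..< b (Suc k')} \<and>
        rel_instr es p1 = rel_instr es q1 \<and> rel_instr es p2 = rel_instr es q2 \<and>
        rel_instr es p1 \<noteq> rel_instr es p2 \<longrightarrow> (p1 < p2 \<longleftrightarrow> q1 < q2)))"

end

(* Happens-before is acyclic exactly for the traces of SC computations, so robustness means that no
   Power computation has a cyclic trace.  Take a cyclic computation with as few instructions as
   possible and delete a suitable po-last instruction x.  The rest can be completed to a computation
   whose happens-before relation contains the original one restricted to the instructions other than
   x; by minimality it is acyclic and has a linear extension.  The events of x other than its fetch
   (at most |P| + 1 of them, the commit of a store being merged with the propagation to its own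
   thread) cut the original computation into at most |P| + 2 segments.  Fetching everything first and
   sorting every segment by the linear extension, with x placed last, leaves the trace unchanged. *)
theory Submission
  imports Defs
begin

section \<open>Evaluation of registers\<close>

text \<open>Happens-before speaks of addresses and keys, not of values; this is what makes deletion
  possible. If x is a store, its readers have to be redirected to another store, so register values
  may change. That is harmless only if no address and no assumed condition of the other instructions
  depends on such a value. A po-last instruction other than a store is read by nobody. If every
  nonempty thread ends with a store, the one of these committed last qualifies: a store commits only
  when all earlier addresses and assumes of its thread are settled. Reordering is awkward on states,
  which change with the schedule. A run is therefore described by its final state and the set of
  actions performed so far: what a register, an address or a propagated store is at some moment can
  be read off these two. An action then stays enabled in another schedule as soon as what has moved
  across it respects happens-before. The fetches form one more segment in front of the |P| + 2
  others; hence |P| + 3.\<close>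

lemma eval_None_iff: "eval \<rho> e = None \<longleftrightarrow> (\<exists>r\<in>regs e. \<rho> r = None)"
  by (induction e) auto

lemma eval_cong: "(\<And>r. r \<in> regs e \<Longrightarrow> \<rho> r = \<rho>' r) \<Longrightarrow> eval \<rho> e = eval \<rho>' e"
proof (induction e)
  case (App f es)
  have "eval \<rho> x = eval \<rho>' x" if "x \<in> set es" for x
    using App that by auto
  then show ?case by (auto cong: map_cong)
qed auto

lemma eval_mono:
  assumes "eval \<rho> e = Some v" "\<And>r w. r \<in> regs e \<Longrightarrow> \<rho> r = Some w \<Longrightarrow> \<rho>' r = Some w"
  shows "eval \<rho>' e = Some v"
proof -
  have "\<rho> r = \<rho>' r" if "r \<in> regs e" for r
    using assms that eval_None_iff[of \<rho> e] by (metis option.exhaust option.distinct(1))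
  then show ?thesis using eval_cong[of e \<rho> \<rho>'] assms(1) by simp
qed

lemma last_writer_Some:
  assumes "last_writer s t i r = Some j"
  shows "j < i" "writes (cmd_of s t j) r"
proof -
  have ex: "\<exists>j < i. writes (cmd_of s t j) r" and j: "j = (GREATEST j. j < i \<and> writes (cmd_of s t j) r)"
    using assms by (auto simp: last_writer_def split: if_splits)
  from ex have "j < i \<and> writes (cmd_of s t j) r"
    unfolding j by (rule GreatestI_ex_nat[where b = i]) auto
  then show "j < i" "writes (cmd_of s t j) r" by auto
qed

lemma last_writer_cong:
  assumes "\<And>j. j < i \<Longrightarrow> cmd_of s t j = cmd_of s' t j"
  shows "last_writer s t i r = last_writer s' t i r"
proof -
  have "(\<lambda>j. j < i \<and> writes (cmd_of s t j) r) = (\<lambda>j. j < i \<and> writes (cmd_of s' t j) r)"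
    using assms by auto
  then show ?thesis unfolding last_writer_def by metis
qed

text \<open>The body of \<open>rv\<close> with the recursive calls replaced by a parameter
  \<open>R\<close>. Evaluation with fuel is thus the iteration of one monotone functional, and
  \<open>RV\<close> will be a fixed point of it.\<close>

definition reg_step :: "('q, 'd::zero, 'r) pstate \<Rightarrow> (nat \<Rightarrow> nat \<Rightarrow> 'r \<Rightarrow> 'd option) \<Rightarrow> nat \<Rightarrow> nat \<Rightarrow> 'r \<Rightarrow> 'd option" where
  "reg_step s R t i r =
     (case last_writer s t i r of
        None \<Rightarrow> Some 0
      | Some j \<Rightarrow>
          (case cmd_of s t j of
             CAssign _ e \<Rightarrow> eval (R t j) e
           | CLoad _ _ \<Rightarrow>
               (case Ls s t j of
                  None \<Rightarrow> None
                | Some (Init a) \<Rightarrow> Some 0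
                | Some (St t' i') \<Rightarrow>
                    (case cmd_of s t' i' of
                       CStore _ e' \<Rightarrow> eval (R t' i') e'
                     | _ \<Rightarrow> None))
           | _ \<Rightarrow> None))"

lemma rv_Suc: "rv (Suc n) s t i r = reg_step s (rv n s) t i r"
  by (simp add: reg_step_def)

declare rv.simps(2)[simp del]

lemma reg_step_mono:
  assumes "reg_step s R t i r = Some v"
    and "\<And>t i r v. R t i r = Some v \<Longrightarrow> R' t i r = Some v"
  shows "reg_step s R' t i r = Some v"
  using assms(1) unfolding reg_step_def
  by (auto split: option.splits cmd.splits sid.splits dest: last_writer_Some intro: eval_mono[OF _ assms(2)])

lemma rv_mono_Suc: "rv n s t i r = Some v \<Longrightarrow> rv (Suc n) s t i r = Some v"
proof (induction n arbitrary: t i r v)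
  case (Suc n)
  then show ?case using reg_step_mono[of s "rv n s" t i r v "rv (Suc n) s"] by (metis rv_Suc)
qed simp

lemma rv_mono: "n \<le> m \<Longrightarrow> rv n s t i r = Some v \<Longrightarrow> rv m s t i r = Some v"
  by (induction m rule: dec_induct) (auto intro: rv_mono_Suc)

definition inrange :: "('q, 'd::zero, 'r) program \<Rightarrow> ('q, 'd, 'r) pstate \<Rightarrow> (nat \<times> nat) set" where
  "inrange P s = {(t, i). t < length P \<and> i < length (Fs s t)}"

definition reads_inrange :: "('q, 'd::zero, 'r) program \<Rightarrow> ('q, 'd, 'r) pstate \<Rightarrow> bool" where
  "reads_inrange P s \<longleftrightarrow> (\<forall>t i t' i'. Ls s t i = Some (St t' i') \<longrightarrow> (t', i') \<in> inrange P s)"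

lemma inrange_Sigma: "inrange P s = (SIGMA t:{..<length P}. {..<length (Fs s t)})"
  by (auto simp: inrange_def)

lemma finite_inrange [simp]: "finite (inrange P s)"
  by (simp add: inrange_Sigma)

lemma card_inrange: "card (inrange P s) = (\<Sum>t < length P. length (Fs s t))"
  by (simp add: inrange_Sigma)

lemma fuel_eq: "fuel P s = Suc (Suc (card (inrange P s)))"
  by (simp add: fuel_def card_inrange)

text \<open>Measures the progress of evaluation with fuel \<open>n\<close>. Only value expressions
  are recorded, because \<open>reg_step\<close> recurs only into those of assignments and of stores
  that were read.\<close>

definition val_known :: "('q, 'd::zero, 'r) program \<Rightarrow> ('q, 'd, 'r) pstate \<Rightarrow> nat \<Rightarrow> (nat \<times> nat) set" where
  "val_known P s n = {(t, i) \<in> inrange P s. \<forall>e. val_expr (cmd_of s t i) = Some e \<longrightarrow> eval (rv n s t i) e \<noteq> None}"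

lemma val_known_mono:
  assumes "n \<le> m"
  shows "val_known P s n \<subseteq> val_known P s m"
proof -
  have "eval (rv m s t i) e \<noteq> None" if "eval (rv n s t i) e \<noteq> None" for t i e
    using that eval_mono[of "rv n s t i" e _ "rv m s t i"] rv_mono[OF assms, of s t i] by blast
  then show ?thesis unfolding val_known_def by blast
qed

text \<open>A register gains a value between fuel n + 1 and n + 2 only if the value expression it
  refers to did so between n and n + 1. That expression belongs to a fetched assignment of the same
  thread or, by \<open>reads_inrange\<close>, to a fetched store, so \<open>val_known\<close>
  records it.\<close>

lemma rv_stable_step:
  assumes "reads_inrange P s" "val_known P s n = val_known P s (Suc n)"
    and "t < length P" "i \<le> length (Fs s t)"
  shows "rv (Suc (Suc n)) s t i r = rv (Suc n) s t i r"
proof (cases "rv (Suc (Suc n)) s t i r")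
  case None
  then show ?thesis using rv_mono_Suc[of "Suc n" s t i r] by (metis option.exhaust)
next
  case (Some v)
  have key: "eval (rv n s t' i') e \<noteq> None" if "(t', i') \<in> inrange P s" "val_expr (cmd_of s t' i') = Some e"
    "eval (rv (Suc n) s t' i') e \<noteq> None" for t' i' e
  proof -
    have "(t', i') \<in> val_known P s (Suc n)" using that by (simp add: val_known_def)
    then have "(t', i') \<in> val_known P s n" using assms(2) by simp
    then show ?thesis using that(2) by (simp add: val_known_def)
  qed
  have "rv (Suc n) s t i r \<noteq> None"
  proof (cases "last_writer s t i r")
    case None then show ?thesis by (simp add: rv_Suc reg_step_def)
  next
    case (Some j)
    have j: "j < length (Fs s t)" using last_writer_Some[OF Some] assms(4) by simp
    note S = \<open>rv (Suc (Suc n)) s t i r = Some v\<close>[unfolded rv_Suc[of "Suc n"] reg_step_def Some option.case]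
    show ?thesis
    proof (cases "cmd_of s t j")
      case (CAssign r' e)
      then show ?thesis using S key[of t j e] j assms(3) Some
        by (auto simp: rv_Suc[of n] reg_step_def inrange_def)
    next
      case (CLoad r' e)
      then show ?thesis using S key assms(1) Some unfolding reads_inrange_def
        by (fastforce simp: rv_Suc[of n] reg_step_def split: option.splits sid.splits cmd.splits)
    qed (use S in auto)
  qed
  then show ?thesis using Some rv_mono_Suc[of "Suc n" s t i r] by auto
qed

lemma val_known_stable:
  assumes "reads_inrange P s" "val_known P s n = val_known P s (Suc n)"
  shows "val_known P s (Suc n) = val_known P s (Suc (Suc n))"
proof -
  have "rv (Suc (Suc n)) s t i = rv (Suc n) s t i" if "t < length P" "i < length (Fs s t)" for t i
    using rv_stable_step[OF assms, of t i] that by (auto simp: fun_eq_iff)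
  then show ?thesis unfolding val_known_def inrange_def by auto
qed

text \<open>Pigeonhole: equality of two consecutive sets persists, so a change at step
  \<open>n\<close> means strict growth at all steps up to there, and
  \<open>val_known P s (Suc n)\<close> would have at least n + 1 elements inside a set of at most
  n.\<close>

lemma val_known_fix:
  assumes "reads_inrange P s" "n \<ge> card (inrange P s)"
  shows "val_known P s n = val_known P s (Suc n)"
proof -
  have stay: "m \<le> m' \<Longrightarrow> val_known P s m = val_known P s (Suc m) \<Longrightarrow> val_known P s m' = val_known P s (Suc m')" for m m'
    by (induction m' rule: dec_induct) (simp, metis val_known_stable[OF assms(1)])
  show ?thesis
  proof (rule ccontr)
    assume neq: "val_known P s n \<noteq> val_known P s (Suc n)"
    have grow: "m \<le> Suc n \<Longrightarrow> m \<le> card (val_known P s m)" for m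
    proof (induction m)
      case (Suc m)
      have "val_known P s m \<subset> val_known P s (Suc m)"
        using stay[of m n] neq Suc.prems val_known_mono[of m "Suc m" P s] by auto
      then have "card (val_known P s m) < card (val_known P s (Suc m))"
        by (rule psubset_card_mono[rotated]) (auto intro: finite_subset[OF _ finite_inrange] simp: val_known_def)
      then show ?case using Suc by simp
    qed simp
    have "card (val_known P s (Suc n)) \<le> card (inrange P s)"
      by (rule card_mono) (auto simp: val_known_def)
    with grow[of "Suc n"] assms(2) show False by simp
  qed
qed

definition RV :: "('q, 'd::zero, 'r) program \<Rightarrow> ('q, 'd, 'r) pstate \<Rightarrow> nat \<Rightarrow> nat \<Rightarrow> 'r \<Rightarrow> 'd option" where
  "RV P s = rv (fuel P s) s"

lemma ev_expr_RV: "ev_expr P s t i e = eval (RV P s t i) e"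
  by (simp add: ev_expr_def RV_def)

text \<open>The fuel lies beyond the point of stabilisation, so the recursion holds without fuel. Of
  the state only \<open>reads_inrange\<close> is asked: the deletion argument evaluates registers in
  a state that is not known to be reachable.\<close>

lemma RV_fix:
  assumes "reads_inrange P s" "t < length P" "i \<le> length (Fs s t)"
  shows "RV P s t i r = reg_step s (RV P s) t i r"
  using rv_stable_step[OF assms(1) val_known_fix[OF assms(1), of "Suc (card (inrange P s))"] assms(2,3), of r]
  by (simp add: RV_def fuel_eq rv_Suc[of "Suc (Suc _)"])

section \<open>Monotonicity of evaluation along a computation\<close>

definition extends :: "('q, 'd::zero, 'r) pstate \<Rightarrow> ('q, 'd, 'r) pstate \<Rightarrow> bool" where
  "extends s s' \<longleftrightarrow> (\<forall>t. \<exists>zs. Fs s' t = Fs s t @ zs) \<and>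
     (\<forall>t i z. Ls s t i = Some z \<longrightarrow> Ls s' t i = Some z) \<and>
     (\<forall>x k. co s x = Some k \<longrightarrow> co s' x = Some k)"

lemma extends_refl [simp]: "extends s s" by (simp add: extends_def)

lemma extends_trans: "extends s s' \<Longrightarrow> extends s' s'' \<Longrightarrow> extends s s''"
  unfolding extends_def by (metis append.assoc)

lemma extends_cmd_of: "extends s s' \<Longrightarrow> i < length (Fs s t) \<Longrightarrow> cmd_of s' t i = cmd_of s t i"
  unfolding extends_def cmd_of_def by (metis nth_append)

lemma extends_length: "extends s s' \<Longrightarrow> length (Fs s t) \<le> length (Fs s' t)"
  unfolding extends_def by (metis length_append le_add1)

lemma extends_last_writer:
  "extends s s' \<Longrightarrow> i \<le> length (Fs s t) \<Longrightarrow> last_writer s' t i r = last_writer s t i r"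
  by (rule last_writer_cong) (simp add: extends_cmd_of)

lemma extends_fuel: "extends s s' \<Longrightarrow> fuel P s \<le> fuel P s'"
  unfolding fuel_def by (simp add: sum_mono extends_length)

text \<open>A register that has a value keeps it: the earlier instructions, and with them the last
  writers, stay the same, and a load that has read a store never changes its mind.\<close>

lemma extends_rv:
  assumes "extends s s'" "reads_inrange P s"
  shows "rv n s t i r = Some v \<Longrightarrow> i \<le> length (Fs s t) \<Longrightarrow> rv n s' t i r = Some v"
proof (induction n arbitrary: t i r v)
  case (Suc n)
  have L: "Ls s t j = Some z \<Longrightarrow> Ls s' t j = Some z" for t j z
    using assms(1) by (auto simp: extends_def)
  show ?case
  proof (cases "last_writer s t i r")
    case None
    then show ?thesis using Suc.prems extends_last_writer[OF assms(1) Suc.prems(2)]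
      by (simp add: rv_Suc reg_step_def)
  next
    case (Some j)
    have j: "j < length (Fs s t)" using last_writer_Some[OF Some] Suc.prems(2) by simp
    have lw: "last_writer s' t i r = Some j" using Some extends_last_writer[OF assms(1) Suc.prems(2)] by simp
    have c: "cmd_of s' t j = cmd_of s t j" using extends_cmd_of[OF assms(1) j] .
    have IH: "eval (rv n s t' i') e = Some v \<Longrightarrow> i' \<le> length (Fs s t') \<Longrightarrow> eval (rv n s' t' i') e = Some v" for t' i' e
      using Suc.IH by (blast intro: eval_mono)
    note S = Suc.prems(1)[unfolded rv_Suc reg_step_def Some option.case]
    show ?thesis
    proof (cases "cmd_of s t j")
      case (CAssign r' e)
      then show ?thesis using S c lw IH j by (simp add: rv_Suc reg_step_def)
    next
      case (CLoad r' e)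
      show ?thesis
      proof (cases "Ls s t j")
        case None then show ?thesis using S CLoad by simp
      next
        case (Some z)
        show ?thesis
        proof (cases z)
          case (Init a)
          then show ?thesis using S CLoad c lw Some L[OF Some] by (simp add: rv_Suc reg_step_def)
        next
          case (St t' i')
          have i': "i' < length (Fs s t')" using assms(2) Some St by (auto simp: reads_inrange_def inrange_def)
          show ?thesis using S CLoad c lw Some St L[OF Some] extends_cmd_of[OF assms(1) i'] IH i'
            by (auto simp: rv_Suc reg_step_def split: cmd.splits)
        qed
      qed
    qed (use S in auto)
  qed
qed simp

lemma extends_ev_expr:
  assumes "extends s s'" "reads_inrange P s" "i \<le> length (Fs s t)" "ev_expr P s t i e = Some v"
  shows "ev_expr P s' t i e = Some v"
  unfolding ev_expr_def
  by (rule eval_mono[OF assms(4)[unfolded ev_expr_def]])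
     (meson assms(1-3) extends_rv extends_fuel rv_mono)

lemma extends_addr:
  assumes "extends s s'" "reads_inrange P s" "i < length (Fs s t)" "addr P s t i \<noteq> Some None"
  shows "addr P s' t i = addr P s t i"
  using assms extends_ev_expr[OF assms(1,2), of i t] extends_cmd_of[OF assms(1,3)]
  unfolding addr_def by (cases "addr_expr (cmd_of s t i)") auto

lemma extends_val:
  assumes "extends s s'" "reads_inrange P s" "i < length (Fs s t)" "val P s t i \<noteq> Some None"
  shows "val P s' t i = val P s t i"
  using assms extends_ev_expr[OF assms(1,2), of i t] extends_cmd_of[OF assms(1,3)]
  unfolding val_def by (cases "val_expr (cmd_of s t i)") auto

section \<open>Reachable states\<close>

text \<open>Reading requires a known value: memory offers only committed stores, and an early read
  checks the value. This is why a performed load always yields a register value.\<close>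

definition readable :: "('q, 'd::zero, 'r) program \<Rightarrow> ('q, 'd, 'r) pstate \<Rightarrow> 'd sid \<Rightarrow> 'd \<Rightarrow> bool" where
  "readable P s z a \<longleftrightarrow> z = Init a \<or> (\<exists>t i. z = St t i \<and> (t, i) \<in> inrange P s \<and> is_store (cmd_of s t i) \<and>
      addr P s t i = Some (Some a) \<and> val P s t i \<noteq> Some None)"

definition wf_fetched :: "('q, 'd, 'r) program \<Rightarrow> ('q, 'd, 'r) pstate \<Rightarrow> bool" where
  "wf_fetched P s \<longleftrightarrow> (\<forall>t. length P \<le> t \<longrightarrow> Fs s t = []) \<and>
     (\<forall>t<length P. \<forall>i<length (Fs s t). Fs s t ! i \<in> snd (P ! t) \<and>
        fst (Fs s t ! i) = (if i = 0 then fst (P ! t) else snd (snd (Fs s t ! (i - 1)))))"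

definition wf_loads :: "('q, 'd::zero, 'r) program \<Rightarrow> ('q, 'd, 'r) pstate \<Rightarrow> bool" where
  "wf_loads P s \<longleftrightarrow> (\<forall>t i z. Ls s t i = Some z \<longrightarrow> (t, i) \<in> inrange P s \<and> is_load (cmd_of s t i) \<and>
      (\<exists>a. addr P s t i = Some (Some a) \<and> readable P s z a))"

definition wf_commits :: "('q, 'd::zero, 'r) program \<Rightarrow> ('q, 'd, 'r) pstate \<Rightarrow> bool" where
  "wf_commits P s \<longleftrightarrow> (\<forall>t i. i \<in> Cs s t \<longrightarrow> (t, i) \<in> inrange P s \<and> addr P s t i \<noteq> Some None \<and> val P s t i \<noteq> Some None \<and>
      (is_load (cmd_of s t i) \<longrightarrow> Ls s t i \<noteq> None) \<and>
      (is_assume (cmd_of s t i) \<longrightarrow> (\<exists>v. val P s t i = Some (Some v) \<and> v \<noteq> 0)))"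

definition wf_keys :: "('q, 'd::zero, 'r) pstate \<Rightarrow> bool" where
  "wf_keys s \<longleftrightarrow> (\<forall>t i. co s (t, i) \<noteq> None \<longleftrightarrow> i \<in> Cs s t \<and> is_store (cmd_of s t i)) \<and>
     (\<forall>x k. co s x = Some k \<longrightarrow> 0 < k) \<and> (\<forall>x y k. co s x = Some k \<longrightarrow> co s y = Some k \<longrightarrow> x = y)"

definition wf_prp :: "('q, 'd::zero, 'r) program \<Rightarrow> ('q, 'd, 'r) pstate \<Rightarrow> bool" where
  "wf_prp P s \<longleftrightarrow> (\<forall>t a. prp s t a = Init a \<or> (\<exists>t' i'. prp s t a = St t' i' \<and> i' \<in> Cs s t' \<and>
      is_store (cmd_of s t' i') \<and> addr P s t' i' = Some (Some a)))"

definition wf_state :: "('q, 'd::zero, 'r) program \<Rightarrow> ('q, 'd, 'r) pstate \<Rightarrow> bool" where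
  "wf_state P s \<longleftrightarrow> wf_fetched P s \<and> wf_loads P s \<and> wf_commits P s \<and> wf_keys s \<and> wf_prp P s"

lemma wf_loads_reads_inrange: "wf_loads P s \<Longrightarrow> reads_inrange P s"
  unfolding wf_loads_def reads_inrange_def readable_def by (metis sid.distinct(1) sid.inject(2))

lemma wf_state_reads_inrange: "wf_state P s \<Longrightarrow> reads_inrange P s"
  by (simp add: wf_state_def wf_loads_reads_inrange)

lemma deps_less: "j \<in> addr_deps s t i \<union> data_deps s t i \<union> ctrl_deps s t i \<Longrightarrow> j < i"
  using last_writer_Some(1)[of s t i]
  by (auto simp: addr_deps_def data_deps_def ctrl_deps_def deps_of_def split: option.splits)

lemma addr_cases: "is_store (cmd_of s t i) \<or> is_load (cmd_of s t i) \<Longrightarrow> addr P s t i \<noteq> Some None \<Longrightarrow> \<exists>a. addr P s t i = Some (Some a)"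
  by (cases "cmd_of s t i") (auto simp: addr_def)

lemma wf_init: "wf_state P init_state"
  by (simp add: wf_state_def wf_fetched_def wf_loads_def wf_commits_def wf_keys_def wf_prp_def init_state_def)

lemma step_extends:
  assumes "step P s e s'" "wf_keys s"
  shows "extends s s'"
  using assms(1)
proof cases
  case (commit_store t i a k)
  have "co s (t, i) = None"
    using assms(2) commit_store(3) unfolding wf_keys_def commit_ok_def by metis
  then show ?thesis using commit_store(2) by (auto simp: extends_def)
qed (auto simp: extends_def)

lemma inrange_extends: "extends s s' \<Longrightarrow> (t, i) \<in> inrange P s \<Longrightarrow> (t, i) \<in> inrange P s'"
  using extends_length[of s s' t] by (auto simp: inrange_def)

lemma readable_extends:
  assumes "extends s s'" "reads_inrange P s" "readable P s z a"
  shows "readable P s' z a"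
  using assms(3) extends_addr[OF assms(1,2)] extends_val[OF assms(1,2)] extends_cmd_of[OF assms(1)]
     inrange_extends[OF assms(1)]
  unfolding readable_def inrange_def by fastforce

lemma wf_fetched_step:
  assumes "step P s e s'" "wf_fetched P s"
  shows "wf_fetched P s'"
  using assms(1)
proof cases
  case (fetch t q c q')
  have "fst ((Fs s t @ [(q, c, q')]) ! i) = (if i = 0 then fst (P ! t) else snd (snd ((Fs s t @ [(q, c, q')]) ! (i - 1))))"
    if "i < Suc (length (Fs s t))" for i
    using that fetch(3,5) assms(2)
    by (cases "i = length (Fs s t)")
       (auto simp: wf_fetched_def nth_append cur_q_def last_conv_nth less_Suc_eq)
  moreover have "(Fs s t @ [(q, c, q')]) ! i \<in> snd (P ! t)" if "i < Suc (length (Fs s t))" for i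
    using that fetch(4) fetch(3) assms(2) by (auto simp: wf_fetched_def nth_append)
  ultimately show ?thesis using fetch(2,3) assms(2)
    unfolding wf_fetched_def by auto
qed (use assms(2) in \<open>auto simp: wf_fetched_def\<close>)

lemma wf_loads_step:
  assumes "step P s e s'" "wf_state P s"
  shows "wf_loads P s'"
proof -
  have ext: "extends s s'" using step_extends assms by (auto simp: wf_state_def)
  have ri: "reads_inrange P s" using wf_state_reads_inrange assms(2) .
  have old: "(t, i) \<in> inrange P s' \<and> is_load (cmd_of s' t i) \<and> (\<exists>a. addr P s' t i = Some (Some a) \<and> readable P s' z a)"
    if "(t, i) \<in> inrange P s \<and> is_load (cmd_of s t i) \<and> (\<exists>a. addr P s t i = Some (Some a) \<and> readable P s z a)" for t i z
    using that inrange_extends[OF ext] extends_cmd_of[OF ext] extends_addr[OF ext ri] readable_extends[OF ext ri]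
    by (fastforce simp: inrange_def)
  let ?C = "\<lambda>t i z. (t, i) \<in> inrange P s \<and> is_load (cmd_of s t i) \<and> (\<exists>a. addr P s t i = Some (Some a) \<and> readable P s z a)"
  have base: "?C t i z" if "Ls s t i = Some z" for t i z
    using that assms(2) unfolding wf_state_def wf_loads_def by blast
  have "?C t i z" if L: "Ls s' t i = Some z" for t i z
    using assms(1)
  proof cases
    case (load_mem t0 i0 a)
    have "readable P s (prp s t0 a) a"
      using assms(2) unfolding wf_state_def wf_prp_def wf_commits_def readable_def by metis
    moreover have "Ls s t i = Some z \<or> t = t0 \<and> i = i0 \<and> z = prp s t0 a"
      using L load_mem(2) by (auto split: if_splits)
    ultimately show ?thesis
    proof (elim disjE)
      assume "Ls s t i = Some z"
      then show ?thesis by (rule base)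
    next
      assume "readable P s (prp s t0 a) a" "t = t0 \<and> i = i0 \<and> z = prp s t0 a"
      then show ?thesis using load_mem(3-7) by (simp add: inrange_def)
    qed
  next
    case (early_read t0 i0 a j0)
    let ?Q = "\<lambda>j. j < i0 \<and> is_store (cmd_of s t0 j) \<and> addr P s t0 j \<in> {Some (Some a), Some None}"
    have "\<exists>j. ?Q j" using early_read(8) by simp
    then have "?Q j0" unfolding early_read(9) by (rule GreatestI_ex_nat[where b = i0]) simp
    then have "readable P s (St t0 j0) a"
      using early_read(3-7,10,11) by (simp add: readable_def inrange_def)
    moreover have "Ls s t i = Some z \<or> t = t0 \<and> i = i0 \<and> z = St t0 j0"
      using L early_read(2) by (auto split: if_splits)
    ultimately show ?thesis
    proof (elim disjE)
      assume "Ls s t i = Some z"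
      then show ?thesis by (rule base)
    next
      assume "readable P s (St t0 j0) a" "t = t0 \<and> i = i0 \<and> z = St t0 j0"
      then show ?thesis using early_read(3-7) by (simp add: inrange_def)
    qed
  qed (use L base[of t i z] in simp_all)
  then show ?thesis using old unfolding wf_loads_def by blast
qed

lemma wf_commits_step:
  assumes "step P s e s'" "wf_state P s"
  shows "wf_commits P s'"
proof -
  have ext: "extends s s'" using step_extends assms by (auto simp: wf_state_def)
  have ri: "reads_inrange P s" using wf_state_reads_inrange assms(2) .
  let ?C = "\<lambda>s t i. (t, i) \<in> inrange P s \<and> addr P s t i \<noteq> Some None \<and> val P s t i \<noteq> Some None \<and>
      (is_load (cmd_of s t i) \<longrightarrow> Ls s t i \<noteq> None) \<and>
      (is_assume (cmd_of s t i) \<longrightarrow> (\<exists>v. val P s t i = Some (Some v) \<and> v \<noteq> 0))"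
  have old: "?C s' t i" if "?C s t i" for t i
  proof -
    have il: "i < length (Fs s t)" using that by (simp add: inrange_def)
    have "Ls s t i \<noteq> None \<Longrightarrow> Ls s' t i \<noteq> None" using ext by (auto simp: extends_def)
    then show ?thesis
      using that inrange_extends[OF ext] extends_cmd_of[OF ext il] extends_addr[OF ext ri il] extends_val[OF ext ri il]
      by simp
  qed
  have new: "?C s t i" if "commit_ok P s t i" for t i
    using that by (simp add: commit_ok_def inrange_def)
  have base: "?C s t i" if "i \<in> Cs s t" for t i
    using assms(2) that unfolding wf_state_def wf_commits_def by blast
  have "i \<in> Cs s t \<or> commit_ok P s t i" if "i \<in> Cs s' t" for t i
    using assms(1) that by cases (auto split: if_splits)
  then have "?C s t i" if "i \<in> Cs s' t" for t i
    using new base that by blast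
  then show ?thesis using old unfolding wf_commits_def by blast
qed

lemma wf_keysD:
  assumes "wf_keys s"
  shows "co s (t, i) \<noteq> None \<longleftrightarrow> i \<in> Cs s t \<and> is_store (cmd_of s t i)"
    and "co s x = Some k \<Longrightarrow> 0 < k"
    and "co s x = Some k \<Longrightarrow> co s y = Some k \<Longrightarrow> x = y"
  using assms unfolding wf_keys_def by blast+

text \<open>A propagated store is initial, with key 0, or committed, with a positive key. A key
  chosen at a commit must exceed that of the propagated store and is therefore positive
  again.\<close>

lemma cokey_prp_nonneg:
  assumes "wf_state P s"
  shows "0 \<le> cokey s (prp s t a)"
proof (cases "prp s t a")
  case (St t' i')
  then have "i' \<in> Cs s t' \<and> is_store (cmd_of s t' i')"
    using assms unfolding wf_state_def wf_prp_def by (metis sid.distinct(1) sid.inject(2))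
  then obtain k where "co s (t', i') = Some k"
    using wf_keysD(1)[of s t' i'] assms by (auto simp: wf_state_def)
  then show ?thesis using wf_keysD(2)[of s "(t', i')" k] assms St by (auto simp: wf_state_def)
qed simp

lemma wf_keys_step:
  assumes "step P s e s'" "wf_state P s"
  shows "wf_keys s'"
proof -
  have ext: "extends s s'" using step_extends assms by (auto simp: wf_state_def)
  have c: "cmd_of s' t i = cmd_of s t i" if "i \<in> Cs s t" for i t
  proof -
    have "(t, i) \<in> inrange P s" using assms(2) that unfolding wf_state_def wf_commits_def by blast
    then show ?thesis using extends_cmd_of[OF ext] by (simp add: inrange_def)
  qed
  have wk: "wf_keys s" using assms(2) by (simp add: wf_state_def)
  note K = wf_keysD[OF wk]
  have same: ?thesis if "co s' = co s" "\<And>t i. i \<in> Cs s' t \<and> is_store (cmd_of s' t i) \<longleftrightarrow> i \<in> Cs s t \<and> is_store (cmd_of s t i)"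
    using wk that unfolding wf_keys_def by simp
  show ?thesis using assms(1)
  proof cases
    case (commit_store t i a k)
    have k: "0 < k" using commit_store(8) cokey_prp_nonneg[OF assms(2), of t a] by simp
    have c': "cmd_of s' t i = cmd_of s t i" for t i using commit_store(2) by (simp add: cmd_of_def)
    have co: "co s' = (co s)((t, i) := Some k)" "Cs s' = (Cs s)(t := insert i (Cs s t))"
      using commit_store(2) by simp_all
    have "co s' (t0, i0) \<noteq> None \<longleftrightarrow> i0 \<in> Cs s' t0 \<and> is_store (cmd_of s' t0 i0)" for t0 i0
      using K(1)[of t0 i0] commit_store(4) unfolding co c' by (cases "(t0, i0) = (t, i)") auto
    moreover have "0 < k'" if "co s' x = Some k'" for x k'
      using that k K(2)[of x k'] unfolding co by (auto split: if_splits)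
    moreover have "x = y" if "co s' x = Some k'" "co s' y = Some k'" for x y k'
      using that K(3)[of x k' y] commit_store(7)[rule_format, of x] commit_store(7)[rule_format, of y]
      unfolding co by (auto split: if_splits)
    ultimately show ?thesis unfolding wf_keys_def by blast
  next
    case (commit t i)
    have c': "cmd_of s' t i = cmd_of s t i" for t i using commit(2) by (simp add: cmd_of_def)
    have cs: "co s' = co s" "Cs s' = (Cs s)(t := insert i (Cs s t))"
      using commit(2) by simp_all
    show ?thesis using commit(4) by (intro same) (auto simp: c' cs split: if_splits)
  next
    case (fetch t q c q')
    then show ?thesis using c by (intro same) auto
  qed (intro same; simp add: cmd_of_def)+
qed

lemma wf_prp_step:
  assumes "step P s e s'" "wf_state P s"
  shows "wf_prp P s'"
proof -
  have ext: "extends s s'" using step_extends assms by (auto simp: wf_state_def)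
  have ri: "reads_inrange P s" using wf_state_reads_inrange assms(2) .
  let ?S = "\<lambda>s z a. z = Init a \<or> (\<exists>t' i'. z = St t' i' \<and> i' \<in> Cs s t' \<and>
      is_store (cmd_of s t' i') \<and> addr P s t' i' = Some (Some a))"
  have sub: "Cs s t \<subseteq> Cs s' t" for t using assms(1) by cases auto
  have tr: "cmd_of s' t i = cmd_of s t i \<and> addr P s' t i = addr P s t i" if "i \<in> Cs s t" for t i
  proof -
    have "(t, i) \<in> inrange P s" "addr P s t i \<noteq> Some None"
      using assms(2) that unfolding wf_state_def wf_commits_def by blast+
    then show ?thesis using extends_cmd_of[OF ext] extends_addr[OF ext ri] by (simp add: inrange_def)
  qed
  have old: "?S s' z a" if "?S s z a" for z a
    using that
  proof (elim disjE exE)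
    fix t' i' assume "z = St t' i' \<and> i' \<in> Cs s t' \<and> is_store (cmd_of s t' i') \<and> addr P s t' i' = Some (Some a)"
    then show ?thesis using tr[of i' t'] sub[of t'] by auto
  qed simp
  have s: "?S s (prp s t a) a" for t a using assms(2) unfolding wf_state_def wf_prp_def by blast
  show ?thesis using assms(1)
  proof cases
    case (commit_store t i a k)
    have il: "i < length (Fs s t)" using commit_store(3) by (simp add: commit_ok_def)
    have "i \<in> Cs s' t" "is_store (cmd_of s' t i)" "addr P s' t i = Some (Some a)"
      using commit_store extends_cmd_of[OF ext il] extends_addr[OF ext ri il] by auto
    then have n: "?S s' (St t i) a" by simp
    have pr: "prp s' = (prp s)(t := (prp s t)(a := St t i))" using commit_store(2) by simp
    have "?S s' (prp s' t0 a0) a0" for t0 a0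
      using old[OF s[of t0 a0]] n unfolding pr by (cases "t0 = t \<and> a0 = a") auto
    then show ?thesis unfolding wf_prp_def by blast
  next
    case (propagate t t' i' a k)
    have "?S s (St t' i') a" using propagate by simp
    note n = old[OF this]
    have pr: "prp s' = (prp s)(t := (prp s t)(a := St t' i'))" using propagate(2) by simp
    have "?S s' (prp s' t0 a0) a0" for t0 a0
      using old[OF s[of t0 a0]] n unfolding pr by (cases "t0 = t \<and> a0 = a") auto
    then show ?thesis unfolding wf_prp_def by blast
  qed (use old[OF s] in \<open>simp_all add: wf_prp_def\<close>)
qed

lemma wf_state_step: "step P s e s' \<Longrightarrow> wf_state P s \<Longrightarrow> wf_state P s'"
  using wf_fetched_step wf_loads_step wf_commits_step wf_keys_step wf_prp_step
  unfolding wf_state_def by metis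

lemma steps_wf_state: "steps P s es s' \<Longrightarrow> wf_state P s \<Longrightarrow> wf_state P s' \<and> extends s s'"
proof (induction rule: steps.induct)
  case (step s e s' es s'')
  then show ?case using wf_state_step step_extends extends_trans unfolding wf_state_def by blast
qed simp

text \<open>A register is known at an instruction once the loads it depends on within the thread
  (in the set \<open>D\<close>) have been performed: whatever store such a load has read, its value was already
  determined at that moment.\<close>

inductive reg_known :: "('q, 'd::zero, 'r) pstate \<Rightarrow> (nat \<times> nat) set \<Rightarrow> nat \<Rightarrow> nat \<Rightarrow> 'r \<Rightarrow> bool" for s D t where
  unwritten: "last_writer s t i r = None \<Longrightarrow> reg_known s D t i r"
| assigned: "last_writer s t i r = Some j \<Longrightarrow> cmd_of s t j = CAssign r' e \<Longrightarrow>
    (\<forall>r''\<in>regs e. reg_known s D t j r'') \<Longrightarrow> reg_known s D t i r"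
| loaded: "last_writer s t i r = Some j \<Longrightarrow> is_load (cmd_of s t j) \<Longrightarrow> (t, j) \<in> D \<Longrightarrow> reg_known s D t i r"

definition expr_known :: "('q, 'd::zero, 'r) pstate \<Rightarrow> (nat \<times> nat) set \<Rightarrow> nat \<Rightarrow> nat \<Rightarrow> ('d, 'r) expr option \<Rightarrow> bool" where
  "expr_known s D t i eo \<longleftrightarrow> (\<forall>e. eo = Some e \<longrightarrow> (\<forall>r\<in>regs e. reg_known s D t i r))"

lemma reg_known_mono:
  assumes "reg_known s D t i r" "\<And>j. j < i \<Longrightarrow> cmd_of s' t j = cmd_of s t j"
    "\<And>j. j < i \<Longrightarrow> (t, j) \<in> D \<Longrightarrow> (t, j) \<in> D'"
  shows "reg_known s' D' t i r"
  using assms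
proof (induction rule: reg_known.induct)
  case (unwritten i r)
  then show ?case using last_writer_cong[of i s t s' r] by (metis reg_known.unwritten)
next
  case (assigned i r j r' e)
  have j: "j < i" using last_writer_Some assigned(1) by fast
  have "last_writer s' t i r = Some j" using assigned last_writer_cong[of i s t s' r] by metis
  moreover have "cmd_of s' t j = CAssign r' e" using assigned j by metis
  moreover have "\<forall>r''\<in>regs e. reg_known s' D' t j r''" using assigned j by (meson less_trans)
  ultimately show ?case by (rule reg_known.assigned)
next
  case (loaded i r j)
  have j: "j < i" using last_writer_Some loaded(1) by fast
  show ?case using reg_known.loaded[of s' t i r j D'] loaded j last_writer_cong[of i s t s' r] by metis
qed

lemma expr_known_mono:
  assumes "expr_known s D t i eo" "\<And>j. j < i \<Longrightarrow> cmd_of s' t j = cmd_of s t j"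
    "\<And>j. j < i \<Longrightarrow> (t, j) \<in> D \<Longrightarrow> (t, j) \<in> D'"
  shows "expr_known s' D' t i eo"
  using assms(1) reg_known_mono[of s D t i _ s' D', OF _ assms(2,3)] unfolding expr_known_def by blast

definition done_loads :: "('q, 'd, 'r) pstate \<Rightarrow> (nat \<times> nat) set" where
  "done_loads s = {(t, i). Ls s t i \<noteq> None}"

text \<open>A performed load has read an initial store or a store of known value, so the recursion
  may stop at a load. The induction thus stays within one thread, although \<open>RV\<close> itself
  follows reads across threads.\<close>

lemma reg_known_RV:
  assumes "wf_loads P s" "t < length P"
  shows "i \<le> length (Fs s t) \<Longrightarrow> reg_known s (done_loads s) t i r \<longleftrightarrow> RV P s t i r \<noteq> None"
proof (induction i arbitrary: r rule: less_induct)
  case (less i)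
  have fx: "RV P s t i r = reg_step s (RV P s) t i r"
    using RV_fix[OF wf_loads_reads_inrange[OF assms(1)] assms(2) less.prems] .
  show ?case
  proof (cases "last_writer s t i r")
    case None
    then show ?thesis using fx by (auto simp: reg_step_def intro: unwritten)
  next
    case (Some j)
    have j: "j < i" "writes (cmd_of s t j) r" using last_writer_Some[OF Some] .
    show ?thesis
    proof (cases "cmd_of s t j")
      case (CAssign r' e)
      have "reg_known s (done_loads s) t i r \<longleftrightarrow> (\<forall>r''\<in>regs e. reg_known s (done_loads s) t j r'')"
        using Some CAssign by (auto intro: assigned elim: reg_known.cases)
      also have "\<dots> \<longleftrightarrow> (\<forall>r''\<in>regs e. RV P s t j r'' \<noteq> None)"
        using less.IH[OF j(1)] j(1) less.prems by simp
      also have "\<dots> \<longleftrightarrow> RV P s t i r \<noteq> None"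
        using fx Some CAssign eval_None_iff[of "RV P s t j" e] by (simp add: reg_step_def)
      finally show ?thesis .
    next
      case (CLoad r' e)
      have 1: "reg_known s (done_loads s) t i r \<longleftrightarrow> Ls s t j \<noteq> None"
        using Some CLoad by (auto simp: done_loads_def intro: loaded elim: reg_known.cases)
      show ?thesis
      proof (cases "Ls s t j")
        case None
        then show ?thesis using 1 fx Some CLoad by (simp add: reg_step_def)
      next
        case L: (Some z)
        then obtain a where a: "readable P s z a" using assms(1) unfolding wf_loads_def by metis
        have "RV P s t i r \<noteq> None"
        proof (cases z)
          case (Init x1)
          then show ?thesis using fx Some CLoad L by (simp add: reg_step_def)
        next
          case (St t' i')
          then have "is_store (cmd_of s t' i')" "val P s t' i' \<noteq> Some None"
            using a by (auto simp: readable_def)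
          then show ?thesis using fx Some CLoad L St
            by (cases "cmd_of s t' i'") (auto simp: reg_step_def val_def ev_expr_RV)
        qed
        then show ?thesis using 1 L by simp
      qed
    qed (use j(2) in auto)
  qed
qed

lemma expr_known_iff:
  assumes "wf_loads P s" "t < length P" "i \<le> length (Fs s t)"
  shows "expr_known s (done_loads s) t i eo \<longleftrightarrow> map_option (ev_expr P s t i) eo \<noteq> Some None"
  using reg_known_RV[OF assms] eval_None_iff[of "RV P s t i"]
  by (cases eo) (auto simp: expr_known_def ev_expr_RV)

lemma expr_known_addr:
  assumes "wf_loads P s" "t < length P" "i < length (Fs s t)"
  shows "expr_known s (done_loads s) t i (addr_expr (cmd_of s t i)) \<longleftrightarrow> addr P s t i \<noteq> Some None"
  using expr_known_iff[OF assms(1,2)] assms(3) by (simp add: addr_def)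

lemma expr_known_val:
  assumes "wf_loads P s" "t < length P" "i < length (Fs s t)"
  shows "expr_known s (done_loads s) t i (val_expr (cmd_of s t i)) \<longleftrightarrow> val P s t i \<noteq> Some None"
  using expr_known_iff[OF assms(1,2)] assms(3) by (simp add: val_def)

section \<open>Runs as sequences of actions\<close>

text \<open>Events stripped of what the final state determines: the fetched instruction, the
  address, the key and the store read. The commit of a store and the propagation to its own thread
  form one action, as they form one transition.\<close>

datatype action = AFetch nat nat | ALoad nat nat | ACommit nat nat | AProp nat nat nat

fun ins_of :: "action \<Rightarrow> nat \<times> nat" where
  "ins_of (AFetch t i) = (t, i)"
| "ins_of (ALoad t i) = (t, i)"
| "ins_of (ACommit t i) = (t, i)"
| "ins_of (AProp t t' i') = (t', i')"

fun evs :: "('q, 'd::zero, 'r) program \<Rightarrow> ('q, 'd, 'r) pstate \<Rightarrow> action \<Rightarrow> ('q, 'd, 'r) event list" where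
  "evs P s (AFetch t i) = [EFetch t (Fs s t ! i)]"
| "evs P s (ALoad t i) = [ELoad t i (the (the (addr P s t i)))]"
| "evs P s (ACommit t i) =
     (if is_store (cmd_of s t i)
      then [ECommitSt t i (the (co s (t, i))) (the (the (addr P s t i))), EProp t t i (the (the (addr P s t i)))]
      else [ECommit t i])"
| "evs P s (AProp t t' i') = [EProp t t' i' (the (the (addr P s t' i')))]"

definition propagated :: "('q, 'd, 'r) pstate \<Rightarrow> action set \<Rightarrow> nat \<Rightarrow> (nat \<times> nat) set" where
  "propagated s A t = {(t', i'). AProp t t' i' \<in> A \<or> t' = t \<and> ACommit t i' \<in> A \<and> is_store (cmd_of s t i')}"

definition cands :: "('q, 'd::zero, 'r) program \<Rightarrow> ('q, 'd, 'r) pstate \<Rightarrow> action set \<Rightarrow> nat \<Rightarrow> 'd \<Rightarrow> 'd sid set" where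
  "cands P s A t a = insert (Init a) {St t' i' |t' i'. (t', i') \<in> propagated s A t \<and> addr P s t' i' = Some (Some a)}"

text \<open>Stands in for \<open>prp\<close>. Propagation only ever raises the key, so the store
  propagated last is the one of greatest key, a notion that depends on the set of propagations and
  not on their order.\<close>

definition is_latest :: "('q, 'd::zero, 'r) program \<Rightarrow> ('q, 'd, 'r) pstate \<Rightarrow> action set \<Rightarrow> nat \<Rightarrow> 'd \<Rightarrow> 'd sid \<Rightarrow> bool" where
  "is_latest P s A t a z \<longleftrightarrow> z \<in> cands P s A t a \<and> (\<forall>z'\<in>cands P s A t a. cokey s z' \<le> cokey s z)"

definition loads_in :: "action set \<Rightarrow> (nat \<times> nat) set" where
  "loads_in A = {(t, i). ALoad t i \<in> A}"

text \<open>A known address never changes later on, so the address after the actions in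
  \<open>A\<close> is either bottom or already the final one; only the question whether it is known
  depends on \<open>A\<close>.\<close>

definition addr_at :: "('q, 'd::zero, 'r) program \<Rightarrow> ('q, 'd, 'r) pstate \<Rightarrow> action set \<Rightarrow> nat \<Rightarrow> nat \<Rightarrow> 'd option option" where
  "addr_at P s A t i =
     (if expr_known s (loads_in A) t i (addr_expr (cmd_of s t i)) then addr P s t i else Some None)"

definition val_known_at :: "('q, 'd::zero, 'r) pstate \<Rightarrow> action set \<Rightarrow> nat \<Rightarrow> nat \<Rightarrow> bool" where
  "val_known_at s A t i \<longleftrightarrow> expr_known s (loads_in A) t i (val_expr (cmd_of s t i))"

definition early_at :: "('q, 'd::zero, 'r) program \<Rightarrow> ('q, 'd, 'r) pstate \<Rightarrow> action set \<Rightarrow> nat \<Rightarrow> nat \<Rightarrow> 'd \<Rightarrow> nat \<Rightarrow> bool" where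
  "early_at P s A t i a j \<longleftrightarrow> j < i \<and> is_store (cmd_of s t j) \<and> addr_at P s A t j = Some (Some a) \<and>
     val_known_at s A t j \<and> ACommit t j \<notin> A \<and>
     (\<forall>k. j < k \<and> k < i \<and> is_store (cmd_of s t k) \<longrightarrow> addr_at P s A t k \<notin> {Some (Some a), Some None})"

definition commit_at :: "('q, 'd::zero, 'r) program \<Rightarrow> ('q, 'd, 'r) pstate \<Rightarrow> action set \<Rightarrow> nat \<Rightarrow> nat \<Rightarrow> bool" where
  "commit_at P s A t i \<longleftrightarrow> t < length P \<and> AFetch t i \<in> A \<and> ACommit t i \<notin> A \<and>
     (\<forall>j \<in> addr_deps s t i \<union> data_deps s t i \<union> ctrl_deps s t i. ACommit t j \<in> A) \<and>
     addr_at P s A t i \<noteq> Some None \<and> val_known_at s A t i \<and>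
     (\<forall>a. addr_at P s A t i = Some (Some a) \<longrightarrow>
        (\<forall>j < i. addr_at P s A t j \<in> {Some (Some a), Some None} \<longrightarrow> ACommit t j \<in> A)) \<and>
     (is_load (cmd_of s t i) \<longrightarrow> ALoad t i \<in> A) \<and>
     (is_assume (cmd_of s t i) \<longrightarrow> (\<exists>v. val P s t i = Some (Some v) \<and> v \<noteq> 0))"

text \<open>One condition serves both the commit of a store, with respect to its own thread, and a
  propagation. As the initial store is always a candidate and has key 0, it also forces the key to
  be positive.\<close>

definition overtakes :: "('q, 'd::zero, 'r) program \<Rightarrow> ('q, 'd, 'r) pstate \<Rightarrow> action set \<Rightarrow> nat \<Rightarrow> nat \<Rightarrow> nat \<Rightarrow> bool" where
  "overtakes P s A t t' i' \<longleftrightarrow> co s (t', i') \<noteq> None \<and>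
     (\<exists>a. addr P s t' i' = Some (Some a) \<and> (\<forall>z\<in>cands P s A t a. cokey s z < cokey s (St t' i')))"

text \<open>Enabledness of an action after the actions in \<open>A\<close>, in terms of the final state \<open>s\<close> alone. It
  refers to \<open>A\<close> only through membership, which is what makes reordering arguments possible.\<close>

fun enabled :: "('q, 'd::zero, 'r) program \<Rightarrow> ('q, 'd, 'r) pstate \<Rightarrow> action set \<Rightarrow> action \<Rightarrow> bool" where
  "enabled P s A (AFetch t i) \<longleftrightarrow> t < length P \<and> i < length (Fs s t) \<and> {j. AFetch t j \<in> A} = {..<i}"
| "enabled P s A (ALoad t i) \<longleftrightarrow> t < length P \<and> AFetch t i \<in> A \<and> ALoad t i \<notin> A \<and> is_load (cmd_of s t i) \<and>
     (\<exists>a z. addr_at P s A t i = Some (Some a) \<and> Ls s t i = Some z \<and>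
       (is_latest P s A t a z \<or> (\<exists>j. z = St t j \<and> early_at P s A t i a j)))"
| "enabled P s A (ACommit t i) \<longleftrightarrow> commit_at P s A t i \<and> (is_store (cmd_of s t i) \<longrightarrow> overtakes P s A t t i)"
| "enabled P s A (AProp t t' i') \<longleftrightarrow> t < length P \<and> t' < length P \<and> is_store (cmd_of s t' i') \<and> ACommit t' i' \<in> A \<and>
     overtakes P s A t t' i'"

text \<open>\<open>u\<close> is the state on the way to \<open>s\<close> at which exactly the
  actions in \<open>A\<close> have been done. Its fields are restrictions of those of
  \<open>s\<close> to \<open>A\<close>, except for \<open>prp\<close>, which is recovered as the
  latest candidate.\<close>

definition rep :: "('q, 'd::zero, 'r) program \<Rightarrow> ('q, 'd, 'r) pstate \<Rightarrow> action set \<Rightarrow> ('q, 'd, 'r) pstate \<Rightarrow> bool" where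
  "rep P s A u \<longleftrightarrow>
     (\<forall>t. (\<exists>zs. Fs s t = Fs u t @ zs) \<and> {i. AFetch t i \<in> A} = {..<length (Fs u t)}) \<and>
     (\<forall>t. Cs u t = {i. ACommit t i \<in> A}) \<and>
     (\<forall>t i. Ls u t i = (if ALoad t i \<in> A then Ls s t i else None)) \<and>
     (\<forall>t i. co u (t, i) = (if ACommit t i \<in> A then co s (t, i) else None)) \<and>
     (\<forall>t a. is_latest P s A t a (prp u t a)) \<and>
     (\<forall>t t' i'. AProp t t' i' \<in> A \<longrightarrow> ACommit t' i' \<in> A \<and> is_store (cmd_of s t' i')) \<and>
     (\<forall>t i. ALoad t i \<in> A \<longrightarrow> Ls s t i \<noteq> None)"

text \<open>What a replay has to know about the state it aims at. This is weaker than
  \<open>wf_state\<close>, so that it can be checked for the modified state of the deletion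
  argument.\<close>

definition target :: "('q, 'd, 'r) program \<Rightarrow> ('q, 'd::zero, 'r) pstate \<Rightarrow> bool" where
  "target P s \<longleftrightarrow> wf_fetched P s \<and> (\<forall>t i. co s (t, i) \<noteq> None \<longrightarrow> is_store (cmd_of s t i)) \<and>
     (\<forall>x y k. co s x = Some k \<longrightarrow> co s y = Some k \<longrightarrow> x = y)"

lemma wf_state_target: "wf_state P s \<Longrightarrow> target P s"
  unfolding wf_state_def target_def wf_keys_def by blast

lemma repD:
  assumes "rep P s A u"
  shows "\<exists>zs. Fs s t = Fs u t @ zs" "AFetch t i \<in> A \<longleftrightarrow> i < length (Fs u t)"
    "Cs u t = {i. ACommit t i \<in> A}" "Ls u t i = (if ALoad t i \<in> A then Ls s t i else None)"
    "co u (t, i) = (if ACommit t i \<in> A then co s (t, i) else None)"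
    "is_latest P s A t a (prp u t a)"
    "AProp t t' i' \<in> A \<Longrightarrow> ACommit t' i' \<in> A \<and> is_store (cmd_of s t' i')"
    "ALoad t i \<in> A \<Longrightarrow> Ls s t i \<noteq> None"
  using assms unfolding rep_def by (blast | simp)+

lemma rep_extends: "rep P s A u \<Longrightarrow> extends u s"
  unfolding rep_def extends_def by (auto split: if_splits)

lemma rep_done_loads: "rep P s A u \<Longrightarrow> done_loads u = loads_in A"
  unfolding rep_def done_loads_def loads_in_def by auto

lemma rep_expr_known:
  assumes "rep P s A u" "i \<le> length (Fs u t)"
  shows "expr_known s (loads_in A) t i eo \<longleftrightarrow> expr_known u (done_loads u) t i eo"
  using expr_known_mono[of s "loads_in A" t i eo u "loads_in A"] expr_known_mono[of u "loads_in A" t i eo s "loads_in A"]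
    extends_cmd_of[OF rep_extends[OF assms(1)]] assms(2) rep_done_loads[OF assms(1)] by auto

text \<open>The fetched prefix and the performed loads are the same for \<open>u\<close> and for
  \<open>A\<close>, so both sides agree on whether the address is known; if it is, it is the final
  one by monotonicity.\<close>

lemma rep_addr:
  assumes "rep P s A u" "wf_state P u" "t < length P" "i < length (Fs u t)"
  shows "addr P u t i = addr_at P s A t i"
proof -
  have l: "wf_loads P u" using assms(2) by (simp add: wf_state_def)
  show ?thesis
    using expr_known_addr[OF l assms(3,4)] rep_expr_known[OF assms(1), of i t "addr_expr (cmd_of u t i)"]
      extends_cmd_of[OF rep_extends[OF assms(1)] assms(4)]
      extends_addr[OF rep_extends[OF assms(1)] wf_loads_reads_inrange[OF l] assms(4)] assms(4)
    by (auto simp: addr_at_def)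
qed

lemma rep_val:
  assumes "rep P s A u" "wf_state P u" "t < length P" "i < length (Fs u t)"
  shows "val P u t i = (if val_known_at s A t i then val P s t i else Some None)"
    and "val P u t i \<noteq> Some None \<longleftrightarrow> val_known_at s A t i"
proof -
  have l: "wf_loads P u" using assms(2) by (simp add: wf_state_def)
  show *: "val P u t i \<noteq> Some None \<longleftrightarrow> val_known_at s A t i"
    using expr_known_val[OF l assms(3,4)] rep_expr_known[OF assms(1), of i t "val_expr (cmd_of u t i)"]
      extends_cmd_of[OF rep_extends[OF assms(1)] assms(4)] assms(4)
    by (auto simp: val_known_at_def)
  show "val P u t i = (if val_known_at s A t i then val P s t i else Some None)"
    using extends_val[OF rep_extends[OF assms(1)] wf_loads_reads_inrange[OF l] assms(4)] * by auto
qed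

lemma rep_commit_ok:
  assumes "rep P s A u" "wf_state P u"
  shows "commit_ok P u t i \<longleftrightarrow> commit_at P s A t i"
proof (cases "t < length P \<and> i < length (Fs u t)")
  case False
  then show ?thesis using repD(2)[OF assms(1)] unfolding commit_ok_def commit_at_def by blast
next
  case True
  then have t: "t < length P" and i: "i < length (Fs u t)" by auto
  note R = rep_addr[OF assms t] rep_val[OF assms t]
  have c: "cmd_of s t j = cmd_of u t j" if "j \<le> i" for j
    using extends_cmd_of[OF rep_extends[OF assms(1)]] that i by simp
  have lw: "last_writer s t i = last_writer u t i"
    using extends_last_writer[OF rep_extends[OF assms(1)]] i by (auto simp: fun_eq_iff)
  have deps: "addr_deps u t i = addr_deps s t i" "data_deps u t i = data_deps s t i" "ctrl_deps u t i = ctrl_deps s t i"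
    unfolding addr_deps_def data_deps_def ctrl_deps_def deps_of_def c[OF order.refl] lw using c by auto
  have mem: "j \<in> Cs u t \<longleftrightarrow> ACommit t j \<in> A" for j using repD(3)[OF assms(1)] by simp
  have ld: "Ls u t i \<noteq> None \<longleftrightarrow> ALoad t i \<in> A"
    using repD(4,8)[OF assms(1)] by simp
  have aa: "addr P u t j = addr_at P s A t j" if "j \<le> i" for j
    using R(1) i that by simp
  have d: "X \<subseteq> Cs u t \<longleftrightarrow> (\<forall>j\<in>X. ACommit t j \<in> A)" for X using mem by blast
  have f: "AFetch t i \<in> A" using repD(2)[OF assms(1)] i by simp
  show ?thesis
  proof (cases "val_known_at s A t i")
    case False
    then show ?thesis using R(3)[OF i] by (simp add: commit_ok_def commit_at_def)
  next
    case True
    then have v: "val P u t i = val P s t i" "val P s t i \<noteq> Some None" using R(2,3)[OF i] by auto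
    show ?thesis
      unfolding commit_ok_def commit_at_def deps d mem ld c[OF order.refl, symmetric] v(1)
      using v(2) t i f True by (simp add: aa)
  qed
qed

section \<open>Effect of a single action on represented states\<close>

lemma propagated_insert [simp]:
  "propagated s (insert (AFetch t i) A) t0 = propagated s A t0"
  "propagated s (insert (ALoad t i) A) t0 = propagated s A t0"
  "propagated s (insert (ACommit t i) A) t0 =
     (if is_store (cmd_of s t i) \<and> t0 = t then insert (t, i) (propagated s A t0) else propagated s A t0)"
  "propagated s (insert (AProp t t' i') A) t0 =
     (if t0 = t then insert (t', i') (propagated s A t0) else propagated s A t0)"
  by (auto simp: propagated_def)

lemma rep_fetch:
  assumes "rep P s A u" "i = length (Fs u t)" "i < length (Fs s t)"
    "u' = u\<lparr>Fs := (Fs u)(t := Fs u t @ [Fs s t ! i])\<rparr>"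
  shows "rep P s (insert (AFetch t i) A) u'"
proof -
  note R = repD[OF assms(1)]
  have F: "Fs u' = (Fs u)(t := Fs u t @ [Fs s t ! i])" "Cs u' = Cs u" "Ls u' = Ls u" "co u' = co u" "prp u' = prp u"
    using assms(4) by simp_all
  have "\<exists>zs. Fs s t0 = Fs u' t0 @ zs" for t0
  proof (cases "t0 = t")
    case True
    obtain zs where zs: "Fs s t = Fs u t @ zs" using R(1) by blast
    then obtain z zs' where "zs = z # zs'" using assms(2,3) by (cases zs) auto
    then show ?thesis using zs True assms(2) by (simp add: F)
  qed (use R(1) in \<open>simp add: F\<close>)
  moreover have "{j. AFetch t0 j \<in> insert (AFetch t i) A} = {..<length (Fs u' t0)}" for t0
    using R(2) assms(2) by (auto simp: F less_Suc_eq)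
  moreover have "is_latest P s (insert (AFetch t i) A) t0 a (prp u' t0 a)" for t0 a
    using R(6) by (simp add: F is_latest_def cands_def)
  ultimately show ?thesis using R(3-5,7,8) unfolding rep_def by (simp add: F lessThan_def)
qed

lemma rep_load:
  assumes "rep P s A u" "Ls s t i = Some z" "u' = u\<lparr>Ls := (Ls u)(t := (Ls u t)(i := Some z))\<rparr>"
  shows "rep P s (insert (ALoad t i) A) u'"
proof -
  note R = repD[OF assms(1)]
  have F: "Ls u' = (Ls u)(t := (Ls u t)(i := Some z))" "Cs u' = Cs u" "Fs u' = Fs u" "co u' = co u" "prp u' = prp u"
    using assms(3) by simp_all
  have "Ls u' t0 i0 = (if ALoad t0 i0 \<in> insert (ALoad t i) A then Ls s t0 i0 else None)" for t0 i0
    using R(4) assms(2) by (auto simp: F)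
  moreover have "is_latest P s (insert (ALoad t i) A) t0 a (prp u' t0 a)" for t0 a
    using R(6) by (simp add: F is_latest_def cands_def)
  ultimately show ?thesis using R(1-3,5,7,8) assms(2) unfolding rep_def by (simp add: F lessThan_def)
qed

lemma rep_commit:
  assumes "rep P s A u" "\<not> is_store (cmd_of s t i)" "co s (t, i) = None"
    "u' = u\<lparr>Cs := (Cs u)(t := insert i (Cs u t))\<rparr>"
  shows "rep P s (insert (ACommit t i) A) u'"
proof -
  note R = repD[OF assms(1)]
  have F: "Cs u' = (Cs u)(t := insert i (Cs u t))" "Fs u' = Fs u" "Ls u' = Ls u" "co u' = co u" "prp u' = prp u"
    using assms(4) by simp_all
  have "is_latest P s (insert (ACommit t i) A) t0 a (prp u' t0 a)" for t0 a
    using R(6) assms(2) by (simp add: F is_latest_def cands_def)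
  moreover have "co u' (t0, i0) = (if ACommit t0 i0 \<in> insert (ACommit t i) A then co s (t0, i0) else None)" for t0 i0
    using R(5) assms(3) by (auto simp: F)
  moreover have "Cs u' t0 = {j. ACommit t0 j \<in> insert (ACommit t i) A}" for t0
    using R(3) by (auto simp: F)
  moreover have "AProp t0 t' i' \<in> insert (ACommit t i) A \<longrightarrow>
     ACommit t' i' \<in> insert (ACommit t i) A \<and> is_store (cmd_of s t' i')" for t0 t' i'
    using R(7) by auto
  ultimately show ?thesis using R(1,2,4,8) unfolding rep_def by (simp add: F lessThan_def)
qed

text \<open>The new store exceeds all candidates for its address in thread \<open>t\<close>, and all
  other candidate sets remain as they are.\<close>

lemma is_latest_insert:
  assumes "\<And>t a. is_latest P s A t a (p t a)"
    "propagated s A' t = insert (t', i') (propagated s A t)" "\<And>t0. t0 \<noteq> t \<Longrightarrow> propagated s A' t0 = propagated s A t0"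
    "addr P s t' i' = Some (Some a)" "\<forall>z\<in>cands P s A t a. cokey s z < cokey s (St t' i')"
  shows "is_latest P s A' t0 a0 ((p(t := (p t)(a := St t' i'))) t0 a0)"
proof (cases "t0 = t \<and> a0 = a")
  case True
  have "cands P s A' t a = insert (St t' i') (cands P s A t a)"
    using assms(2,4) by (auto simp: cands_def)
  then show ?thesis using True assms(5) by (auto simp: is_latest_def)
next
  case False
  then have "cands P s A' t0 a0 = cands P s A t0 a0"
    using assms(2-4) by (cases "t0 = t") (auto simp: cands_def)
  then show ?thesis using assms(1)[of t0 a0] False by (auto simp: is_latest_def)
qed

lemma rep_commit_store:
  assumes "rep P s A u" "is_store (cmd_of s t i)" "co s (t, i) = Some k" "addr P s t i = Some (Some a)"
    "\<forall>z\<in>cands P s A t a. cokey s z < cokey s (St t i)"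
    "u' = u\<lparr>Cs := (Cs u)(t := insert i (Cs u t)), co := (co u)((t, i) := Some k),
           prp := (prp u)(t := (prp u t)(a := St t i))\<rparr>"
  shows "rep P s (insert (ACommit t i) A) u'"
proof -
  note R = repD[OF assms(1)]
  have F: "Cs u' = (Cs u)(t := insert i (Cs u t))" "Fs u' = Fs u" "Ls u' = Ls u" "co u' = (co u)((t, i) := Some k)"
    "prp u' = (prp u)(t := (prp u t)(a := St t i))"
    using assms(6) by simp_all
  have "is_latest P s (insert (ACommit t i) A) t0 a0 (prp u' t0 a0)" for t0 a0
    unfolding F by (rule is_latest_insert[OF R(6) _ _ assms(4,5)]) (use assms(2) in auto)
  moreover have "co u' (t0, i0) = (if ACommit t0 i0 \<in> insert (ACommit t i) A then co s (t0, i0) else None)" for t0 i0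
    using R(5) assms(3) by (auto simp: F)
  moreover have "Cs u' t0 = {j. ACommit t0 j \<in> insert (ACommit t i) A}" for t0
    using R(3) by (auto simp: F)
  moreover have "AProp t0 t' i' \<in> insert (ACommit t i) A \<longrightarrow>
     ACommit t' i' \<in> insert (ACommit t i) A \<and> is_store (cmd_of s t' i')" for t0 t' i'
    using R(7) by auto
  ultimately show ?thesis using R(1,2,4,8) unfolding rep_def by (simp add: F lessThan_def)
qed

lemma rep_propagate:
  assumes "rep P s A u" "ACommit t' i' \<in> A" "is_store (cmd_of s t' i')" "addr P s t' i' = Some (Some a)"
    "\<forall>z\<in>cands P s A t a. cokey s z < cokey s (St t' i')"
    "u' = u\<lparr>prp := (prp u)(t := (prp u t)(a := St t' i'))\<rparr>"
  shows "rep P s (insert (AProp t t' i') A) u'"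
proof -
  note R = repD[OF assms(1)]
  have F: "Cs u' = Cs u" "Fs u' = Fs u" "Ls u' = Ls u" "co u' = co u"
    "prp u' = (prp u)(t := (prp u t)(a := St t' i'))"
    using assms(6) by simp_all
  have "is_latest P s (insert (AProp t t' i') A) t0 a0 (prp u' t0 a0)" for t0 a0
    unfolding F by (rule is_latest_insert[OF R(6) _ _ assms(4,5)]) auto
  moreover have "AProp t0 t1 i1 \<in> insert (AProp t t' i') A \<longrightarrow>
     ACommit t1 i1 \<in> insert (AProp t t' i') A \<and> is_store (cmd_of s t1 i1)" for t0 t1 i1
    using R(7) assms(2,3) by auto
  ultimately show ?thesis using R(1-5,8) unfolding rep_def by (simp add: F lessThan_def)
qed

lemma rep_cokey_prp:
  assumes "rep P s A u" "wf_state P u"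
  shows "cokey u (prp u t a) = cokey s (prp u t a)"
proof (cases "prp u t a")
  case (St t' i')
  then have "i' \<in> Cs u t'" using assms(2) unfolding wf_state_def wf_prp_def by (metis sid.distinct(1) sid.inject(2))
  then show ?thesis using repD(3,5)[OF assms(1)] St by simp
qed simp

lemma rep_prp_less:
  assumes "rep P s A u" "wf_state P u"
  shows "cokey u (prp u t a) < k \<longleftrightarrow> (\<forall>z\<in>cands P s A t a. cokey s z < k)"
  using repD(6)[OF assms(1), of t a] rep_cokey_prp[OF assms, of t a] unfolding is_latest_def by fastforce

section \<open>Correspondence between transitions and enabled actions\<close>

lemma committed_inrange:
  assumes "wf_state P u" "i \<in> Cs u t"
  shows "t < length P" "i < length (Fs u t)" "addr P u t i \<noteq> Some None"
  using assms unfolding wf_state_def wf_commits_def inrange_def by blast+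

lemma addr_at_Some: "addr_at P s A t i = Some (Some a) \<Longrightarrow> addr P s t i = Some (Some a)"
  by (simp add: addr_at_def split: if_splits)

lemma greatest_early:
  fixes P' :: "nat \<Rightarrow> bool"
  assumes "j < i" "P' j" "\<And>k. j < k \<Longrightarrow> k < i \<Longrightarrow> \<not> P' k"
  shows "(GREATEST j. j < i \<and> P' j) = j"
  by (rule Greatest_equality) (use assms in \<open>auto simp: not_less[symmetric]\<close>)

text \<open>The hypothesis \<open>extends u' s\<close> places the step on the way to
  \<open>s\<close>, so that the fetched instruction, the store read and the key can be read off
  \<open>s\<close>; the action only has to name the instruction.\<close>

lemma forward_step:
  assumes "step P u e u'" "wf_state P u" "rep P s A u" "extends u' s" "target P s"
  shows "\<exists>b. e = evs P s b \<and> enabled P s A b \<and> rep P s (insert b A) u'"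
proof -
  note R = repD[OF assms(3)] and ext = rep_extends[OF assms(3)]
  show ?thesis using assms(1)
  proof cases
    case (fetch t q c q')
    let ?i = "length (Fs u t)"
    obtain zs where "Fs s t = (Fs u t @ [(q, c, q')]) @ zs"
      using assms(4) fetch(2) unfolding extends_def by (auto dest: spec[of _ t])
    then have i: "?i < length (Fs s t)" "Fs s t ! ?i = (q, c, q')" by auto
    have "{j. AFetch t j \<in> A} = {..<?i}" using R(2) by auto
    then show ?thesis
      using i fetch rep_fetch[OF assms(3) HOL.refl i(1)] by (intro exI[of _ "AFetch t ?i"]) simp
  next
    case (load_mem t i a)
    have L: "Ls s t i = Some (prp u t a)" using assms(4) load_mem(2) unfolding extends_def by simp
    have c: "cmd_of s t i = cmd_of u t i" using extends_cmd_of[OF ext load_mem(4)] .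
    have a: "addr_at P s A t i = Some (Some a)" using rep_addr[OF assms(3,2)] load_mem(3,4,7) by simp
    have nl: "ALoad t i \<notin> A" using R(4)[of t i] load_mem(6) L by (auto split: if_splits)
    show ?thesis
      using load_mem(1,3-5) L c a nl R(2) R(6)[of t a] rep_load[OF assms(3) L load_mem(2)] addr_at_Some[OF a]
      by (intro exI[of _ "ALoad t i"]) auto
  next
    case (early_read t i a j)
    let ?Q = "\<lambda>j. j < i \<and> is_store (cmd_of u t j) \<and> addr P u t j \<in> {Some (Some a), Some None}"
    have L: "Ls s t i = Some (St t j)" using assms(4) early_read(2) unfolding extends_def by simp
    have c: "cmd_of s t j = cmd_of u t j" if "j \<le> i" for j
      using extends_cmd_of[OF ext] early_read(4) that by simp
    have aa: "addr_at P s A t j = addr P u t j" if "j \<le> i" for j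
      using rep_addr[OF assms(3,2)] early_read(3,4) that by simp
    have a: "addr_at P s A t i = Some (Some a)" using aa early_read(7) by simp
    have nl: "ALoad t i \<notin> A" using R(4)[of t i] early_read(6) L by (auto split: if_splits)
    have "\<exists>j. ?Q j" using early_read(8) by simp
    then have Q: "?Q j" unfolding early_read(9) by (rule GreatestI_ex_nat[where b = i]) simp
    have "\<not> ?Q k" if "j < k" for k
      using that Greatest_le_nat[of ?Q k i] unfolding early_read(9) by force
    moreover have "val_known_at s A t j" using rep_val(2)[OF assms(3,2)] early_read(3,4,11) Q by simp
    moreover have "ACommit t j \<notin> A" using R(3) early_read(12) by simp
    ultimately have "early_at P s A t i a j"
      using Q early_read(10) c aa unfolding early_at_def by auto
    then show ?thesis
      using early_read(1,3-5) L c[of i] a nl R(2) rep_load[OF assms(3) L early_read(2)] addr_at_Some[OF a]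
      by (intro exI[of _ "ALoad t i"]) auto
  next
    case (commit t i)
    have i: "i < length (Fs u t)" using commit(3) by (simp add: commit_ok_def)
    have c: "\<not> is_store (cmd_of s t i)" using extends_cmd_of[OF ext i] commit(4) by simp
    then have "co s (t, i) = None" using assms(5) unfolding target_def by blast
    then show ?thesis
      using commit(1) c rep_commit[OF assms(3) c _ commit(2)] commit(3)[unfolded rep_commit_ok[OF assms(3,2)]]
      by (intro exI[of _ "ACommit t i"]) simp
  next
    case (commit_store t i a k)
    have i: "i < length (Fs u t)" "t < length P" using commit_store(3) by (simp_all add: commit_ok_def)
    have c: "is_store (cmd_of s t i)" using extends_cmd_of[OF ext i(1)] commit_store(4) by simp
    have K: "co s (t, i) = Some k" using assms(4) commit_store(2) unfolding extends_def by simp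
    have a: "addr P s t i = Some (Some a)"
      using addr_at_Some rep_addr[OF assms(3,2) i(2,1)] commit_store(5) by metis
    have k: "\<forall>z\<in>cands P s A t a. cokey s z < cokey s (St t i)"
      using rep_prp_less[OF assms(3,2), of t a k] commit_store(8) K by simp
    then show ?thesis
      using commit_store(1) c rep_commit_store[OF assms(3) c K a k commit_store(2)]
        commit_store(3)[unfolded rep_commit_ok[OF assms(3,2)]] K a
      by (intro exI[of _ "ACommit t i"]) (simp add: overtakes_def)
  next
    case (propagate t t' i' a k)
    have c: "is_store (cmd_of s t' i')" using extends_cmd_of[OF ext propagate(5)] propagate(7) by simp
    have C: "ACommit t' i' \<in> A" using R(3) propagate(6) by simp
    have K: "co s (t', i') = Some k" using ext propagate(9) unfolding extends_def by simp
    have a: "addr P s t' i' = Some (Some a)"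
      using addr_at_Some rep_addr[OF assms(3,2) propagate(4,5)] propagate(8) by metis
    have k: "\<forall>z\<in>cands P s A t a. cokey s z < cokey s (St t' i')"
      using rep_prp_less[OF assms(3,2), of t a k] propagate(10) K by simp
    then show ?thesis
      using propagate(1,3,4) c C rep_propagate[OF assms(3) C c a k propagate(2)] K a
      by (intro exI[of _ "AProp t t' i'"]) (simp add: overtakes_def)
  qed
qed

text \<open>Keys of distinct committed stores differ and are positive, and for one address there is
  only one initial store, of key 0. Hence there are no ties, and a replayed load finds exactly the
  store recorded in \<open>s\<close>.\<close>

lemma is_latest_unique:
  assumes "is_latest P s A t a z" "rep P s A u" "wf_state P u" "target P s"
  shows "z = prp u t a"
proof -
  have L: "is_latest P s A t a (prp u t a)" using repD(6)[OF assms(2)] .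
  have eq: "cokey s z = cokey s (prp u t a)"
    using assms(1) L unfolding is_latest_def by (meson antisym)
  have key: "\<exists>k. co s (t', i') = Some k \<and> 0 < k" if "St t' i' \<in> cands P s A t a" for t' i'
  proof -
    have C: "ACommit t' i' \<in> A" "is_store (cmd_of s t' i')"
      using that repD(7)[OF assms(2), of t t' i'] by (auto simp: cands_def propagated_def)
    then have "i' \<in> Cs u t'" using repD(3)[OF assms(2)] by simp
    moreover from this have "is_store (cmd_of u t' i')"
      using C(2) extends_cmd_of[OF rep_extends[OF assms(2)]] committed_inrange(2)[OF assms(3)] by metis
    moreover have "wf_keys u" using assms(3) by (simp add: wf_state_def)
    ultimately obtain k where k: "co u (t', i') = Some k" "0 < k"
      using wf_keysD(1)[of u t' i'] wf_keysD(2)[of u "(t', i')"] by blast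
    then show ?thesis using repD(5)[OF assms(2), of t' i'] C(1) by simp
  qed
  have z: "z \<in> cands P s A t a" "prp u t a \<in> cands P s A t a" using assms(1) L by (auto simp: is_latest_def)
  have inj: "\<And>x y k. co s x = Some k \<Longrightarrow> co s y = Some k \<Longrightarrow> x = y" using assms(4) unfolding target_def by blast
  show ?thesis
  proof (cases z)
    case z1: (Init b)
    show ?thesis
    proof (cases "prp u t a")
      case (Init b')
      then show ?thesis using z z1 by (auto simp: cands_def)
    next
      case (St t' i')
      then show ?thesis using key[of t' i'] z z1 eq by auto
    qed
  next
    case z1: (St t1 i1)
    show ?thesis
    proof (cases "prp u t a")
      case (Init b')
      then show ?thesis using key[of t1 i1] z z1 eq by auto
    next
      case (St t' i')
      then show ?thesis using key[of t1 i1] key[of t' i'] z z1 eq inj[of "(t1, i1)" _ "(t', i')"] by auto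
    qed
  qed
qed

lemma replay_step:
  assumes "enabled P s A b" "wf_state P u" "rep P s A u" "target P s"
  shows "\<exists>u'. step P u (evs P s b) u' \<and> rep P s (insert b A) u'"
proof -
  note R = repD[OF assms(3)] and ext = rep_extends[OF assms(3)]
  show ?thesis
  proof (cases b)
    case (AFetch t i)
    then have en: "t < length P" "i < length (Fs s t)" "{j. AFetch t j \<in> A} = {..<i}" using assms(1) by auto
    have i: "i = length (Fs u t)" using en(3) R(2)[of t] by (metis lessThan_eq_iff mem_Collect_eq set_eqI lessThan_iff)
    obtain zs where zs: "Fs s t = Fs u t @ zs" using R(1) by blast
    have w: "Fs s t ! i \<in> snd (P ! t)" "fst (Fs s t ! i) = (if i = 0 then fst (P ! t) else snd (snd (Fs s t ! (i - 1))))"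
      using assms(4) en(1,2) unfolding target_def wf_fetched_def by blast+
    obtain q c q' where qc: "Fs s t ! i = (q, c, q')" by (cases "Fs s t ! i")
    have "q = cur_q P u t"
      using w(2) qc zs i by (cases "Fs u t = []") (auto simp: cur_q_def last_conv_nth nth_append)
    then show ?thesis
      using step.fetch[of t P q c q' u] en(1) w(1) qc rep_fetch[OF assms(3) i en(2) HOL.refl] AFetch
      by (intro exI[of _ "u\<lparr>Fs := (Fs u)(t := Fs u t @ [Fs s t ! i])\<rparr>"]) simp
  next
    case (ALoad t i)
    then obtain a z where en: "t < length P" "AFetch t i \<in> A" "ALoad t i \<notin> A" "is_load (cmd_of s t i)"
      "addr_at P s A t i = Some (Some a)" "Ls s t i = Some z"
      and rd: "is_latest P s A t a z \<or> (\<exists>j. z = St t j \<and> early_at P s A t i a j)"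
      using assms(1) by auto
    have i: "i < length (Fs u t)" using R(2) en(2) by simp
    have c: "cmd_of s t j = cmd_of u t j" if "j \<le> i" for j
      using extends_cmd_of[OF ext] i that by simp
    have aa: "addr_at P s A t j = addr P u t j" if "j \<le> i" for j
      using rep_addr[OF assms(3,2)] en(1) i that by simp
    have Lu: "Ls u t i = None" using R(4) en(3) by simp
    have e: "evs P s b = [ELoad t i a]" using ALoad addr_at_Some[OF en(5)] by simp
    let ?u = "u\<lparr>Ls := (Ls u)(t := (Ls u t)(i := Some z))\<rparr>"
    have "step P u [ELoad t i a] ?u"
      using rd
    proof (elim disjE exE conjE)
      assume "is_latest P s A t a z"
      then have "z = prp u t a" using is_latest_unique assms(2-4) by blast
      then show ?thesis using step.load_mem[of t P i u a] en(1,4,5) i Lu c aa by simp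
    next
      fix j assume z: "z = St t j" and ea: "early_at P s A t i a j"
      note E = ea[unfolded early_at_def]
      let ?Q = "\<lambda>j. is_store (cmd_of u t j) \<and> addr P u t j \<in> {Some (Some a), Some None}"
      have Q: "?Q j" using E c[of j] aa[of j] by auto
      have "\<not> ?Q k" if "j < k" "k < i" for k
        using E c[of k] aa[of k] that by auto
      then have G: "(GREATEST j. j < i \<and> ?Q j) = j" using Q E by (intro greatest_early) auto
      have "val P u t j \<noteq> Some None" using rep_val(2)[OF assms(3,2)] en(1) i E by simp
      moreover have "j \<notin> Cs u t" using R(3) E by simp
      moreover have "addr P u t j = Some (Some a)" using E aa[of j] by auto
      moreover have "\<exists>j<i. ?Q j" using Q E by blast
      ultimately show ?thesis unfolding z
        using step.early_read[of t P i u a j] en(1,4,5) i Lu c[of i] aa[of i] G by simp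
    qed
    then show ?thesis using rep_load[OF assms(3) en(6) HOL.refl] unfolding e by (auto simp: ALoad)
  next
    case (ACommit t i)
    have ca: "commit_at P s A t i" using assms(1) ACommit by simp
    then have ok: "commit_ok P u t i" using rep_commit_ok[OF assms(3,2)] by simp
    have i: "t < length P" "i < length (Fs u t)" using ok by (simp_all add: commit_ok_def)
    have c: "cmd_of s t i = cmd_of u t i" using extends_cmd_of[OF ext i(2)] .
    show ?thesis
    proof (cases "is_store (cmd_of s t i)")
      case False
      then have "co s (t, i) = None" using assms(4) unfolding target_def by blast
      then show ?thesis
        using step.commit[OF ok] rep_commit[OF assms(3) False _ HOL.refl] c False ACommit by auto
    next
      case True
      obtain a k where a: "addr P s t i = Some (Some a)" and K: "co s (t, i) = Some k"
        and less: "\<forall>z\<in>cands P s A t a. cokey s z < cokey s (St t i)"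
        using assms(1) ACommit True by (auto simp: overtakes_def)
      have au: "addr P u t i = Some (Some a)"
        using rep_addr[OF assms(3,2) i] ca a by (auto simp: commit_at_def addr_at_def split: if_splits)
      have lt: "cokey u (prp u t a) < k" using rep_prp_less[OF assms(3,2)] less K by simp
      \<comment> \<open>\<open>Init a\<close> is among the candidates and has key 0.\<close>
      have k0: "0 < k" using less K by (auto simp: cands_def)
      \<comment> \<open>Keys of \<open>u\<close> are keys of \<open>s\<close>, where
        \<open>k\<close> belongs to \<open>(t, i)\<close> alone, and this store is not yet committed
        in \<open>u\<close>.\<close>
      have fresh: "co u x \<noteq> Some k" for x
      proof
        assume x: "co u x = Some k"
        then have "co s x = Some k" using ext unfolding extends_def by blast
        then have "x = (t, i)" using K assms(4) unfolding target_def by blast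
        then show False using x R(5)[of t i] ca by (simp add: commit_at_def)
      qed
      show ?thesis
        using step.commit_store[OF ok, of a k] True c au k0 fresh lt a K
          rep_commit_store[OF assms(3) True K a less HOL.refl] ACommit
        by (auto simp: True)
    qed
  next
    case (AProp t t' i')
    then obtain a k where en: "t < length P" "t' < length P" "is_store (cmd_of s t' i')" "ACommit t' i' \<in> A"
      and a: "addr P s t' i' = Some (Some a)" and K: "co s (t', i') = Some k"
        and less: "\<forall>z\<in>cands P s A t a. cokey s z < cokey s (St t' i')"
      using assms(1) by (auto simp: overtakes_def)
    have C: "i' \<in> Cs u t'" using R(3) en(4) by simp
    note i = committed_inrange[OF assms(2) C]
    have c: "cmd_of s t' i' = cmd_of u t' i'" using extends_cmd_of[OF ext i(2)] .
    have au: "addr P u t' i' = Some (Some a)"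
      using rep_addr[OF assms(3,2) i(1,2)] i(3) a by (auto simp: addr_at_def split: if_splits)
    have lt: "cokey u (prp u t a) < k" using rep_prp_less[OF assms(3,2)] less K by simp
    have Ku: "co u (t', i') = Some k" using R(5) K en(4) by simp
    show ?thesis
      using step.propagate[OF en(1,2) i(2) C _ au Ku lt] c en(3) a AProp
        rep_propagate[OF assms(3) en(4,3) a less HOL.refl] by auto
  qed
qed

definition valid_from :: "('q, 'd::zero, 'r) program \<Rightarrow> ('q, 'd, 'r) pstate \<Rightarrow> action set \<Rightarrow> action list \<Rightarrow> bool" where
  "valid_from P s A bs \<longleftrightarrow> (\<forall>k < length bs. enabled P s (A \<union> set (take k bs)) (bs ! k))"

lemma valid_from_Cons: "valid_from P s A (b # bs) \<longleftrightarrow> enabled P s A b \<and> valid_from P s (insert b A) bs"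
  by (auto simp: valid_from_def less_Suc_eq_0_disj)

lemma forward_run:
  assumes "steps P u es u'" "wf_state P u" "rep P s A u" "extends u' s" "target P s"
  shows "\<exists>bs. es = concat (map (evs P s) bs) \<and> valid_from P s A bs \<and> rep P s (A \<union> set bs) u'"
  using assms
proof (induction arbitrary: A rule: steps.induct)
  case (refl u)
  then show ?case by (intro exI[of _ "[]"]) (simp add: valid_from_def)
next
  case (step u e u1 es u2)
  have w1: "wf_state P u1" using wf_state_step step by blast
  have "extends u1 u2" using steps_wf_state step(2) w1 by blast
  then have "extends u1 s" using extends_trans step by blast
  then obtain b where b: "e = evs P s b" "enabled P s A b" "rep P s (insert b A) u1"
    using forward_step[OF step(1)] step by blast
  then obtain bs where "es = concat (map (evs P s) bs)" "valid_from P s (insert b A) bs" "rep P s (insert b A \<union> set bs) u2"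
    using step.IH[OF w1 b(3)] step.prems by blast
  then show ?case using b by (intro exI[of _ "b # bs"]) (simp add: valid_from_Cons)
qed

text \<open>Reduces every rescheduling argument to checking \<open>enabled\<close> action by action:
  a list of actions that passes this check is a computation, in whatever order it lists
  them.\<close>

lemma replay_run:
  assumes "valid_from P s A bs" "wf_state P u" "rep P s A u" "target P s"
  shows "\<exists>u'. steps P u (concat (map (evs P s) bs)) u' \<and> rep P s (A \<union> set bs) u'"
  using assms
proof (induction bs arbitrary: A u)
  case Nil
  then show ?case by (auto intro: steps.refl)
next
  case (Cons b bs)
  obtain u1 where u1: "step P u (evs P s b) u1" "rep P s (insert b A) u1"
    using replay_step[of P s A b u] Cons.prems by (auto simp: valid_from_Cons)
  obtain u' where "steps P u1 (concat (map (evs P s) bs)) u'" "rep P s (insert b A \<union> set bs) u'"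
    using Cons.IH[of "insert b A" u1] Cons.prems u1 wf_state_step[OF u1(1)] by (auto simp: valid_from_Cons)
  then show ?case using u1(1) by (auto intro: steps.step)
qed

lemma rep_init: "rep P s {} init_state"
  by (auto simp: rep_def init_state_def is_latest_def cands_def propagated_def)

section \<open>Happens-before on instructions and reordering\<close>

definition coh :: "('q, 'd::zero, 'r) program \<Rightarrow> ('q, 'd, 'r) pstate \<Rightarrow> 'd sid \<Rightarrow> nat \<times> nat \<Rightarrow> bool" where
  "coh P s z v \<longleftrightarrow> (\<exists>a. store_at P s (fst v) (snd v) a \<and>
     (z = Init a \<or> (\<exists>t i. z = St t i \<and> store_at P s t i a \<and> cokey s z < cokey s (St (fst v) (snd v)))))"

definition reads_from :: "('q, 'd::zero, 'r) program \<Rightarrow> ('q, 'd, 'r) pstate \<Rightarrow> nat \<times> nat \<Rightarrow> 'd sid \<Rightarrow> bool" where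
  "reads_from P s v z \<longleftrightarrow> v \<in> inrange P s \<and> is_load (cmd_of s (fst v) (snd v)) \<and> Ls s (fst v) (snd v) = Some z"

text \<open>Happens-before on pairs of thread and index. Program order is taken at all distances.
  Initial stores are dropped, since no edge leads into them and they lie on no cycle; conflicts that
  pass through one are kept by the quantifier over \<open>z\<close>.\<close>

definition hbi :: "('q, 'd::zero, 'r) program \<Rightarrow> ('q, 'd, 'r) pstate \<Rightarrow> (nat \<times> nat) rel" where
  "hbi P s = {(u, v). u \<in> inrange P s \<and> v \<in> inrange P s \<and>
     (fst u = fst v \<and> snd u < snd v \<or> coh P s (St (fst u) (snd u)) v \<or>
      reads_from P s v (St (fst u) (snd u)) \<or> (\<exists>z. reads_from P s u z \<and> coh P s z v))}"

lemma hbiI: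
  assumes "u \<in> inrange P s" "v \<in> inrange P s"
  shows "fst u = fst v \<Longrightarrow> snd u < snd v \<Longrightarrow> (u, v) \<in> hbi P s"
    "coh P s (St (fst u) (snd u)) v \<Longrightarrow> (u, v) \<in> hbi P s"
    "reads_from P s v (St (fst u) (snd u)) \<Longrightarrow> (u, v) \<in> hbi P s"
    "reads_from P s u z \<Longrightarrow> coh P s z v \<Longrightarrow> (u, v) \<in> hbi P s"
  using assms unfolding hbi_def by blast+

lemma propagated_mono: "A \<subseteq> A' \<Longrightarrow> propagated s A t \<subseteq> propagated s A' t"
  by (auto simp: propagated_def)

lemma cands_mono: "A \<subseteq> A' \<Longrightarrow> cands P s A t a \<subseteq> cands P s A' t a"
  using propagated_mono[of A A' s t] by (auto simp: cands_def)

text \<open>For a propagation the reason is indirect: a store that has arrived is a candidate and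
  would have to exceed its own key.\<close>

lemma enabled_fresh:
  assumes "enabled P s A b"
  shows "b \<notin> A"
proof (cases b)
  case (AProp t t' i')
  show ?thesis
  proof
    assume "b \<in> A"
    moreover obtain a where "addr P s t' i' = Some (Some a)" "\<forall>z\<in>cands P s A t a. cokey s z < cokey s (St t' i')"
      using assms AProp by (auto simp: overtakes_def)
    moreover from this calculation have "St t' i' \<in> cands P s A t a"
      using AProp by (auto simp: cands_def propagated_def)
    ultimately show False by blast
  qed
qed (use assms in \<open>auto simp: commit_at_def\<close>)

lemma valid_from_distinct:
  assumes "valid_from P s {} bs"
  shows "distinct bs"
proof -
  have "bs ! i \<noteq> bs ! j" if "j < length bs" "i < j" for i j
  proof -
    have "bs ! j \<notin> set (take j bs)" using assms that enabled_fresh by (fastforce simp: valid_from_def)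
    moreover have "bs ! i \<in> set (take j bs)" using that by (auto simp: in_set_conv_nth intro!: exI[of _ i])
    ultimately show ?thesis by metis
  qed
  then show ?thesis unfolding distinct_conv_nth by (metis linorder_neqE_nat)
qed

section \<open>Complete runs, given by a final state and a schedule\<close>

locale run =
  fixes P :: "('q, 'd::zero, 'r) program" and s :: "('q, 'd, 'r) pstate" and bs :: "action list"
  assumes wf: "wf_state P s" and fin: "final P s" and valid: "valid_from P s {} bs" and rep: "rep P s (set bs) s"
begin

lemma en_at: "k < length bs \<Longrightarrow> enabled P s (set (take k bs)) (bs ! k)"
  using valid by (simp add: valid_from_def)

lemma obtain_index:
  assumes "b \<in> set bs"
  obtains k where "k < length bs" "bs ! k = b" "enabled P s (set (take k bs)) b"
  using assms en_at by (metis in_set_conv_nth)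

definition pos :: "action \<Rightarrow> nat" where
  "pos b = (SOME k. k < length bs \<and> bs ! k = b)"

lemma pos:
  assumes "b \<in> set bs"
  shows "pos b < length bs" "bs ! pos b = b"
  using someI_ex[of "\<lambda>k. k < length bs \<and> bs ! k = b"] assms by (simp_all add: pos_def in_set_conv_nth)

lemma pos_inj: "a \<in> set bs \<Longrightarrow> b \<in> set bs \<Longrightarrow> pos a = pos b \<Longrightarrow> a = b"
  using pos(2) by metis

lemma take_subset: "set (take k bs) \<subseteq> set bs"
  by (rule set_take_subset)

lemma dist: "distinct bs"
  using valid valid_from_distinct by blast

lemma pos_nth: "i < length bs \<Longrightarrow> pos (bs ! i) = i"
  using pos[of "bs ! i"] dist nth_eq_iff_index_eq nth_mem by metis

lemma set_take_pos:
  assumes "k \<le> length bs"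
  shows "set (take k bs) = {c \<in> set bs. pos c < k}"
proof -
  have "set (take k bs) = (!) bs ` {0..<k}" "set bs = (!) bs ` {0..<length bs}"
    using nth_image[of k bs] nth_image[of "length bs" bs] assms by simp_all
  then show ?thesis using assms pos_nth by auto
qed

lemma fetch_iff: "AFetch t i \<in> set bs \<longleftrightarrow> (t, i) \<in> inrange P s"
proof -
  have "Fs s t \<noteq> [] \<Longrightarrow> t < length P" using wf unfolding wf_state_def wf_fetched_def by (meson not_le)
  then show ?thesis using repD(2)[OF rep] by (cases "Fs s t = []") (auto simp: inrange_def)
qed

lemma commit_iff: "ACommit t i \<in> set bs \<longleftrightarrow> (t, i) \<in> inrange P s"
  using repD(3)[OF rep, of t] fin committed_inrange[OF wf, of i t] by (auto simp: inrange_def final_def)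

lemma committed: "(t, i) \<in> inrange P s \<Longrightarrow> i \<in> Cs s t"
  using fin by (auto simp: inrange_def final_def)

lemma load_read:
  assumes "(t, i) \<in> inrange P s" "is_load (cmd_of s t i)"
  shows "\<exists>z. Ls s t i = Some z"
  using committed[OF assms(1)] wf assms(2) unfolding wf_state_def wf_commits_def by blast

lemma load_iff: "ALoad t i \<in> set bs \<longleftrightarrow> (t, i) \<in> inrange P s \<and> is_load (cmd_of s t i)"
proof
  assume "ALoad t i \<in> set bs"
  then obtain k where "enabled P s (set (take k bs)) (ALoad t i)" using obtain_index by metis
  then show "(t, i) \<in> inrange P s \<and> is_load (cmd_of s t i)"
    using fetch_iff take_subset by (auto dest: set_rev_mp[OF _ take_subset])
next
  assume "(t, i) \<in> inrange P s \<and> is_load (cmd_of s t i)"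
  then show "ALoad t i \<in> set bs" using load_read[of t i] repD(4)[OF rep, of t i] by (auto split: if_splits)
qed

lemma commit_before_prop:
  assumes "AProp t t' i' \<in> set (take k bs)"
  shows "ACommit t' i' \<in> set (take k bs)"
proof -
  obtain j where j: "j < length bs" "j < k" "bs ! j = AProp t t' i'"
    using assms by (auto simp: in_set_conv_nth)
  then have "ACommit t' i' \<in> set (take j bs)" using en_at[OF j(1)] by simp
  then show ?thesis using j(2) by (meson less_imp_le set_take_subset_set_take subsetD)
qed

lemma prop_in:
  assumes "AProp t t' i' \<in> set bs"
  shows "t < length P" "(t', i') \<in> inrange P s" "is_store (cmd_of s t' i')" "t \<noteq> t'"
proof -
  obtain k where k: "enabled P s (set (take k bs)) (AProp t t' i')" using obtain_index assms by metis
  then show "t < length P" "is_store (cmd_of s t' i')" by auto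
  show "(t', i') \<in> inrange P s" using k commit_iff take_subset by auto
  \<comment> \<open>The commit has already brought the store to its own thread, where a further
    propagation would require it to exceed its own key.\<close>
  show "t \<noteq> t'"
  proof
    assume tt: "t = t'"
    obtain a where a: "addr P s t' i' = Some (Some a)" "\<forall>z\<in>cands P s (set (take k bs)) t a. cokey s z < cokey s (St t' i')"
      using k by (auto simp: overtakes_def)
    have "St t' i' \<in> cands P s (set (take k bs)) t a"
      using k a(1) tt by (auto simp: cands_def propagated_def)
    then show False using a(2) by blast
  qed
qed

lemma action_inrange: "b \<in> set bs \<Longrightarrow> ins_of b \<in> inrange P s"
  using fetch_iff load_iff commit_iff prop_in(2) by (cases b) auto

lemma store_addr:
  assumes "(t, i) \<in> inrange P s" "is_store (cmd_of s t i)"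
  shows "\<exists>a. store_at P s t i a"
  using committed_inrange(3)[OF wf committed[OF assms(1)]] addr_cases[of s t i P] assms
  by (auto simp: store_at_def inrange_def)

lemma store_key:
  assumes "store_at P s t i a"
  shows "\<exists>k. co s (t, i) = Some k \<and> 0 < k"
proof -
  have "i \<in> Cs s t" using committed[of t i] assms by (simp add: store_at_def inrange_def)
  then show ?thesis using wf wf_keysD(1)[of s t i] wf_keysD(2)[of s "(t, i)"] assms
    by (auto simp: wf_state_def store_at_def)
qed

lemma store_key_inj:
  assumes "store_at P s t i a" "store_at P s t' i' a'" "cokey s (St t i) = cokey s (St t' i')"
  shows "(t, i) = (t', i')"
  using store_key[OF assms(1)] store_key[OF assms(2)] assms(3) wf wf_keysD(3)[of s "(t, i)" _ "(t', i')"]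
  by (auto simp: wf_state_def)

lemma propagated_store:
  assumes "(t', i') \<in> propagated s A t" "A \<subseteq> set bs" "addr P s t' i' = Some (Some a)"
  shows "store_at P s t' i' a"
  using assms prop_in commit_iff unfolding propagated_def store_at_def inrange_def by fastforce

lemma cands_store: "St t' i' \<in> cands P s A t a \<Longrightarrow> A \<subseteq> set bs \<Longrightarrow> store_at P s t' i' a"
  using propagated_store by (auto simp: cands_def)

text \<open>The store is committed later, and then it must exceed all candidates of that moment,
  which include the present ones. This is what lets an early read become a read from memory.\<close>

lemma cands_before_commit:
  assumes "store_at P s t j a" "ACommit t j \<notin> set (take k bs)" "z \<in> cands P s (set (take k bs)) t a"
  shows "cokey s z < cokey s (St t j)"
proof -
  have "ACommit t j \<in> set bs" using commit_iff assms(1) by (simp add: store_at_def inrange_def)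
  then obtain m where m: "m < length bs" "bs ! m = ACommit t j" "enabled P s (set (take m bs)) (ACommit t j)"
    using obtain_index by metis
  have "k \<le> m"
  proof (rule ccontr)
    assume "\<not> k \<le> m"
    then have "ACommit t j \<in> set (take k bs)" using m(1,2) by (auto simp: in_set_conv_nth intro!: exI[of _ m])
    then show False using assms(2) by blast
  qed
  then have "z \<in> cands P s (set (take m bs)) t a"
    using assms(3) cands_mono[OF set_take_subset_set_take, of k m P s bs t a] by blast
  then show ?thesis using m(3) assms(1) by (auto simp: overtakes_def store_at_def)
qed

end

text \<open>If the actions done before an action in another schedule differ from those done before it in the
  given run only in ways that do not contradict happens-before, it stays enabled. An early read
  whose store has meanwhile been committed becomes a read from memory.\<close>

locale reorder = run P s bs for P :: "('q, 'd::zero, 'r) program" and s :: "('q, 'd, 'r) pstate" and bs :: "action list" +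
  fixes k :: nat and A A' :: "action set" and b :: action
  assumes k: "k < length bs" and A: "A = set (take k bs)" and b: "b = bs ! k"
    and A': "A' \<subseteq> set bs"
    and keep: "\<And>c. c \<in> A \<Longrightarrow> ins_of c = ins_of b \<or> (ins_of c, ins_of b) \<in> hbi P s \<Longrightarrow> c \<in> A'"
    and drop: "\<And>c. c \<in> A' \<Longrightarrow> c \<notin> A \<Longrightarrow> \<forall>t i. c \<noteq> AFetch t i \<Longrightarrow>
      \<not> (ins_of c = ins_of b \<or> (ins_of b, ins_of c) \<in> hbi P s)"
begin

lemma en: "enabled P s A b"
  using en_at[OF k] A b by simp

lemma A_sub: "A \<subseteq> set bs"
  using A take_subset by simp

lemma b_in: "ins_of b \<in> inrange P s"
  using action_inrange k b by simp

lemma keep_po: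
  assumes "c \<in> A" "fst (ins_of c) = fst (ins_of b)" "snd (ins_of c) \<le> snd (ins_of b)"
  shows "c \<in> A'"
proof (cases "ins_of c = ins_of b")
  case False
  then have "snd (ins_of c) < snd (ins_of b)" using assms by (metis prod_eq_iff le_neq_implies_less)
  then show ?thesis using keep[OF assms(1)] hbiI(1)[OF action_inrange b_in, of c] assms A_sub by blast
qed (use keep assms in blast)

lemma expr_known_keep:
  assumes "expr_known s (loads_in A) t j eo" "ins_of b = (t, i)" "j \<le> i"
  shows "expr_known s (loads_in A') t j eo"
  using assms(1) by (rule expr_known_mono) (use keep_po assms(2,3) in \<open>auto simp: loads_in_def\<close>)

lemma addr_at_keep:
  assumes "ins_of b = (t, i)" "j \<le> i" "addr_at P s A t j \<noteq> Some None"
  shows "addr_at P s A' t j = addr_at P s A t j"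
proof (cases "expr_known s (loads_in A) t j (addr_expr (cmd_of s t j))")
  case True
  then show ?thesis using expr_known_keep[OF True assms(1,2)] by (simp add: addr_at_def)
next
  case False
  then show ?thesis using assms(3) by (simp add: addr_at_def)
qed

lemma val_known_keep:
  assumes "ins_of b = (t, i)" "j \<le> i" "val_known_at s A t j"
  shows "val_known_at s A' t j"
  using expr_known_keep assms by (auto simp: val_known_at_def)

lemma propagated_keep:
  assumes "w \<in> propagated s A t" "w = ins_of b \<or> (w, ins_of b) \<in> hbi P s"
  shows "w \<in> propagated s A' t"
proof -
  obtain t' i' where w: "w = (t', i')" by (cases w)
  consider "AProp t t' i' \<in> A" | "t' = t" "ACommit t i' \<in> A" "is_store (cmd_of s t i')"
    using assms(1) w by (auto simp: propagated_def)
  then show ?thesis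
  proof cases
    case 1
    then show ?thesis using keep[of "AProp t t' i'"] assms(2) w by (auto simp: propagated_def)
  next
    case 2
    then show ?thesis using keep[of "ACommit t i'"] assms(2) w by (auto simp: propagated_def)
  qed
qed

lemma propagated_drop:
  assumes "w \<in> propagated s A' t" "w = ins_of b \<or> (ins_of b, w) \<in> hbi P s"
  shows "w \<in> propagated s A t"
proof -
  obtain t' i' where w: "w = (t', i')" by (cases w)
  consider "AProp t t' i' \<in> A'" | "t' = t" "ACommit t i' \<in> A'" "is_store (cmd_of s t i')"
    using assms(1) w by (auto simp: propagated_def)
  then show ?thesis
  proof cases
    case 1
    then show ?thesis using drop[of "AProp t t' i'"] assms(2) w by (auto simp: propagated_def)
  next
    case 2
    then show ?thesis using drop[of "ACommit t i'"] assms(2) w by (auto simp: propagated_def)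
  qed
qed

lemma cands_keep:
  assumes "z \<in> cands P s A t a" "\<And>t' i'. z = St t' i' \<Longrightarrow> ((t', i'), ins_of b) \<in> hbi P s"
  shows "z \<in> cands P s A' t a"
  using assms propagated_keep by (auto simp: cands_def)

lemma cands_drop:
  assumes "St t' i' \<in> cands P s A' t a" "(ins_of b, (t', i')) \<in> hbi P s"
  shows "St t' i' \<in> cands P s A t a"
  using assms propagated_drop by (auto simp: cands_def)

text \<open>A candidate after \<open>A'\<close> that is not below the store is the store itself or
  lies coherence-after it, hence happens-after it. By \<open>drop\<close> it was a candidate after
  \<open>A\<close> already, where it would have blocked the action.\<close>

lemma overtakes_keep:
  assumes "overtakes P s A t t' i'" "ins_of b = (t', i')" "is_store (cmd_of s t' i')" 
  shows "overtakes P s A' t t' i'"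
proof -
  obtain a where a: "co s (t', i') \<noteq> None" "addr P s t' i' = Some (Some a)"
    "\<forall>z\<in>cands P s A t a. cokey s z < cokey s (St t' i')"
    using assms(1) by (auto simp: overtakes_def)
  have st: "store_at P s t' i' a" using b_in assms(2,3) a(2) by (simp add: store_at_def inrange_def)
  have "cokey s z < cokey s (St t' i')" if z: "z \<in> cands P s A' t a" for z
  proof (rule ccontr)
    assume ge: "\<not> cokey s z < cokey s (St t' i')"
    have "cokey s (Init a) < cokey s (St t' i')" using a(3) by (auto simp: cands_def)
    then obtain t1 i1 where z1: "z = St t1 i1" using z ge by (cases z) (auto simp: cands_def)
    then have st1: "store_at P s t1 i1 a" using cands_store z A' by blast
    have "St t1 i1 \<in> cands P s A t a"
    proof (cases "(t1, i1) = (t', i')")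
      case True
      then show ?thesis using z z1 propagated_drop[of "(t', i')" t] assms(2) by (auto simp: cands_def)
    next
      case False
      then have "cokey s (St t' i') < cokey s (St t1 i1)"
        using ge z1 store_key_inj[OF st1 st] by force
      then have "coh P s (St t' i') (t1, i1)" using st st1 by (auto simp: coh_def)
      then have "((t', i'), (t1, i1)) \<in> hbi P s"
        using st st1 by (intro hbiI(2)) (auto simp: store_at_def inrange_def)
      then show ?thesis using cands_drop z z1 assms(2) by simp
    qed
    then show False using a(3) ge z1 by blast
  qed
  then show ?thesis using a unfolding overtakes_def by blast
qed

text \<open>A candidate after \<open>A'\<close> with a greater key than the store read is the end of
  a conflict edge from the load. By \<open>drop\<close> it was a candidate after \<open>A\<close>,
  contrary to the bound assumed there.\<close>

lemma is_latest_keep: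
  assumes "ins_of b = (t, i)" "reads_from P s (t, i) z" "z \<in> cands P s A' t a"
    "\<And>z'. z' \<in> cands P s A t a \<Longrightarrow> cokey s z' \<le> cokey s z"
  shows "is_latest P s A' t a z"
proof -
  have "cokey s z' \<le> cokey s z" if z': "z' \<in> cands P s A' t a" for z'
  proof (rule ccontr)
    assume gt: "\<not> cokey s z' \<le> cokey s z"
    have "0 \<le> cokey s z" using assms(4)[of "Init a"] by (simp add: cands_def)
    then obtain t1 i1 where z1: "z' = St t1 i1" using z' gt by (cases z') (auto simp: cands_def)
    then have st1: "store_at P s t1 i1 a" using cands_store z' A' by blast
    have "coh P s z (t1, i1)"
    proof (cases z)
      case (Init a')
      then show ?thesis using assms(3) st1 by (auto simp: cands_def coh_def)
    next
      case (St t2 i2)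
      then have "store_at P s t2 i2 a" using cands_store assms(3) A' by blast
      then show ?thesis using St st1 gt z1 by (auto simp: coh_def)
    qed
    then have "((t, i), (t1, i1)) \<in> hbi P s"
      using assms(2) st1 by (intro hbiI(4)) (auto simp: store_at_def inrange_def reads_from_def)
    then have "z' \<in> cands P s A t a" using cands_drop z' z1 assms(1) by simp
    then show False using assms(4) gt by blast
  qed
  then show ?thesis using assms(3) by (simp add: is_latest_def)
qed

lemma enabled_reorder:
  assumes "\<And>t i. b \<noteq> AFetch t i"
  shows "enabled P s A' b"
proof (cases b)
  case (AFetch t i)
  then show ?thesis using assms by simp
next
  case (ALoad t i)
  have i: "ins_of b = (t, i)" by (simp add: ALoad)
  obtain a z where e: "t < length P" "AFetch t i \<in> A" "ALoad t i \<notin> A" "is_load (cmd_of s t i)"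
      "addr_at P s A t i = Some (Some a)" "Ls s t i = Some z"
    and rd: "is_latest P s A t a z \<or> (\<exists>j. z = St t j \<and> early_at P s A t i a j)"
    using en ALoad by auto
  have f: "AFetch t i \<in> A'" using keep_po[OF e(2)] i by simp
  have n: "ALoad t i \<notin> A'" using drop[of "ALoad t i"] e(3) i by auto
  have aa: "addr_at P s A' t i = Some (Some a)" using addr_at_keep[OF i order.refl] e(5) by simp
  have rf: "reads_from P s (t, i) z" using b_in i e(4,6) by (simp add: reads_from_def)
  have "is_latest P s A' t a z \<or> (\<exists>j. z = St t j \<and> early_at P s A' t i a j)"
    using rd
  proof (elim disjE exE conjE)
    assume L: "is_latest P s A t a z"
    have "z \<in> cands P s A' t a"
    proof (rule cands_keep)
      show z: "z \<in> cands P s A t a" using L by (simp add: is_latest_def)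
      \<comment> \<open>The source edge keeps the arrival of the store before the load.\<close>
      show "((t', i'), ins_of b) \<in> hbi P s" if "z = St t' i'" for t' i'
        using hbiI(3)[OF _ b_in, of "(t', i')"] rf i that cands_store[of t' i' A t a] z A_sub
        by (auto simp: store_at_def inrange_def)
    qed
    then show ?thesis using is_latest_keep[OF i rf] L by (auto simp: is_latest_def)
  next
    fix j assume z: "z = St t j" and ea: "early_at P s A t i a j"
    note E = ea[unfolded early_at_def]
    have st: "store_at P s t j a"
      using E e(1) b_in i addr_at_Some[of P s A t j a] by (auto simp: store_at_def inrange_def)
    show ?thesis
    proof (cases "ACommit t j \<in> A'")
      case True
      then have "z \<in> cands P s A' t a"
        using z st by (auto simp: cands_def propagated_def store_at_def)
      \<comment> \<open>At the moment of the early read the store was uncommitted, so its later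
        commit shows that it exceeds every candidate of that moment.\<close>
      moreover have "cokey s z' \<le> cokey s z" if "z' \<in> cands P s A t a" for z'
        using cands_before_commit[OF st, of k z'] that E A z by fastforce
      ultimately show ?thesis using is_latest_keep[OF i rf] by blast
    next
      case False
      have "early_at P s A' t i a j"
        unfolding early_at_def
      proof (intro conjI allI impI)
        show "j < i" "is_store (cmd_of s t j)" using E by auto
        show "addr_at P s A' t j = Some (Some a)" using addr_at_keep[OF i, of j] E by simp
        show "val_known_at s A' t j" using val_known_keep[OF i, of j] E by simp
        show "ACommit t j \<notin> A'" using False .
        show "addr_at P s A' t k \<notin> {Some (Some a), Some None}" if "j < k \<and> k < i \<and> is_store (cmd_of s t k)" for k
          using addr_at_keep[OF i, of k] E that by auto
      qed
      then show ?thesis using z by blast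
    qed
  qed
  then show ?thesis using ALoad e(1,4,6) f n aa by auto
next
  case (ACommit t i)
  have i: "ins_of b = (t, i)" by (simp add: ACommit)
  have ca: "commit_at P s A t i" and ov: "is_store (cmd_of s t i) \<longrightarrow> overtakes P s A t t i"
    using en ACommit by auto
  note C = ca[unfolded commit_at_def]
  have up: "ACommit t j \<in> A \<Longrightarrow> j < i \<Longrightarrow> ACommit t j \<in> A'" for j
    using keep_po[of "ACommit t j"] i by simp
  have aa: "addr_at P s A' t i = addr_at P s A t i" using addr_at_keep[OF i order.refl] C by simp
  have "commit_at P s A' t i"
    unfolding commit_at_def aa
  proof (intro conjI allI impI ballI)
    show "t < length P" "addr_at P s A t i \<noteq> Some None" using C by auto
    show "AFetch t i \<in> A'" using keep_po[of "AFetch t i"] C i by simp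
    show "ACommit t i \<notin> A'" using drop[of "ACommit t i"] C i by auto
    show "ACommit t j \<in> A'" if "j \<in> addr_deps s t i \<union> data_deps s t i \<union> ctrl_deps s t i" for j
      using C up deps_less that by blast
    show "val_known_at s A' t i" using val_known_keep[OF i order.refl] C by blast
    show "ACommit t j \<in> A'"
      if "addr_at P s A t i = Some (Some a)" "j < i" "addr_at P s A' t j \<in> {Some (Some a), Some None}" for a j
    proof -
      \<comment> \<open>An address of this instruction or thread-predecessor known after
        \<open>A\<close> is still known, with the same value, after \<open>A'\<close>; so a matching
        or unknown address after \<open>A'\<close> was matching or unknown after
        \<open>A\<close>.\<close>
      have "addr_at P s A t j \<in> {Some (Some a), Some None}"
        using addr_at_keep[OF i, of j] that by fastforce
      then show ?thesis using C that up by blast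
    qed
    show "ALoad t i \<in> A'" if "is_load (cmd_of s t i)" using keep_po[of "ALoad t i"] C i that by simp
    show "\<exists>v. val P s t i = Some (Some v) \<and> v \<noteq> 0" if "is_assume (cmd_of s t i)" using C that by blast
  qed
  then show ?thesis using ACommit ov overtakes_keep[OF _ i] by simp
next
  case (AProp t t' i')
  have i: "ins_of b = (t', i')" by (simp add: AProp)
  have e: "t < length P" "t' < length P" "is_store (cmd_of s t' i')" "ACommit t' i' \<in> A" "overtakes P s A t t' i'"
    using en AProp by auto
  have "ACommit t' i' \<in> A'" using keep[OF e(4)] i by simp
  then show ?thesis using AProp e overtakes_keep[OF e(5) i e(3)] by simp
qed

end

section \<open>Normal forms\<close>

text \<open>Topological sorting: a maximal element receives the greatest rank and is removed. The
  bound on the ranks leaves the number \<open>card S\<close> free for one additional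
  element.\<close>

lemma finite_acyclic_ranking:
  assumes "finite S" "acyclic (r \<inter> S \<times> S)"
  shows "\<exists>f :: 'a \<Rightarrow> nat. inj_on f S \<and> (\<forall>u\<in>S. f u < card S) \<and> (\<forall>u\<in>S. \<forall>v\<in>S. (u, v) \<in> r \<longrightarrow> f u < f v)"
  using assms
proof (induction "card S" arbitrary: S)
  case 0
  then show ?case by simp
next
  case (Suc n)
  have "wf ((r \<inter> S \<times> S)\<inverse>)"
    using Suc.prems by (intro finite_acyclic_wf_converse) (auto intro: finite_subset[of _ "S \<times> S"])
  moreover obtain y where "y \<in> S" using Suc.hyps(2) by (metis card.empty ex_in_conv nat.distinct(1))
  ultimately obtain m where m: "m \<in> S" "\<And>v. (v, m) \<in> (r \<inter> S \<times> S)\<inverse> \<Longrightarrow> v \<notin> S"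
    by (rule wfE_min) blast
  have max: "(m, v) \<notin> r" if "v \<in> S" for v using m that by blast
  have c: "card (S - {m}) = n" using Suc.hyps(2) Suc.prems(1) m(1) by simp
  have "acyclic (r \<inter> (S - {m}) \<times> (S - {m}))"
    using Suc.prems(2) by (rule acyclic_subset) blast
  then obtain f where f: "inj_on f (S - {m})" "\<And>u. u \<in> S - {m} \<Longrightarrow> f u < n"
    "\<And>u v. u \<in> S - {m} \<Longrightarrow> v \<in> S - {m} \<Longrightarrow> (u, v) \<in> r \<Longrightarrow> f u < f v"
    using Suc.hyps(1)[of "S - {m}"] Suc.prems(1) c by auto
  let ?f = "f(m := n)"
  have "inj_on ?f S"
    using f(1,2) by (fastforce simp: inj_on_def)
  moreover have "\<forall>u\<in>S. ?f u < card S" unfolding Suc.hyps(2)[symmetric] using f(2) by (auto simp: less_Suc_eq)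
  moreover have "\<forall>u\<in>S. \<forall>v\<in>S. (u, v) \<in> r \<longrightarrow> ?f u < ?f v" using f(2,3) max m(1) by auto
  ultimately show ?case by blast
qed

section \<open>Schedules sorted by a numerical key\<close>

lemma sort_by_key:
  fixes f :: "'a \<Rightarrow> nat"
  assumes "finite S" "inj_on f S"
  obtains xs where "set xs = S" "sorted_wrt (\<lambda>a b. f a < f b) xs"
proof -
  define xs where "xs = map (inv_into S f) (sorted_list_of_set (f ` S))"
  have "set xs = S" using assms by (simp add: xs_def)
  moreover have "sorted_wrt (\<lambda>a b. f a < f b) xs"
    unfolding xs_def sorted_wrt_map
    by (rule sorted_wrt_mono_rel[OF _ strict_sorted_list_of_set])
       (use assms(1) in \<open>auto simp: f_inv_into_f\<close>)
  ultimately show thesis using that by blast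
qed

lemma set_take_sorted:
  fixes f :: "'a \<Rightarrow> nat"
  assumes "sorted_wrt (\<lambda>a b. f a < f b) xs" "k < length xs"
  shows "set (take k xs) = {c \<in> set xs. f c < f (xs ! k)}"
proof -
  have "f (xs ! i) < f (xs ! k) \<longleftrightarrow> i < k" if "i < length xs" for i
    using sorted_wrt_nth_less[OF assms(1), of i k] sorted_wrt_nth_less[OF assms(1), of k i] that assms(2)
    by (metis less_asym' linorder_neqE_nat)
  moreover have "set (take k xs) = (!) xs ` {0..<k}" "set xs = (!) xs ` {0..<length xs}"
    using nth_image[of k xs] nth_image[of "length xs" xs] assms(2) by simp_all
  ultimately show ?thesis using assms(2) by auto
qed

text \<open>Positional notation with base m turns a lexicographic comparison into a comparison of
  single numbers, so that one injective key can sort a schedule by several criteria.\<close>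

lemma lex_le:
  fixes a1 a2 r1 r2 m :: nat
  assumes "r1 < m" "r2 < m"
  shows "a1 * m + r1 \<le> a2 * m + r2 \<longleftrightarrow> a1 < a2 \<or> a1 = a2 \<and> r1 \<le> r2"
proof -
  have "a * m + r < a' * m + r'" if "a < a'" "r < m" for a a' r r' :: nat
  proof -
    have "(a + 1) * m \<le> a' * m" using that(1) by (intro mult_le_mono1) simp
    then show ?thesis using that(2) by (simp add: algebra_simps)
  qed
  from this[of a1 a2 r1 r2] this[of a2 a1 r2 r1] show ?thesis
    using assms by (cases a1 a2 rule: linorder_cases) auto
qed

lemma lex_less:
  fixes a1 a2 r1 r2 m :: nat
  assumes "r1 < m" "r2 < m"
  shows "a1 * m + r1 < a2 * m + r2 \<longleftrightarrow> a1 < a2 \<or> a1 = a2 \<and> r1 < r2"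
  using lex_le[OF assms(2,1), of a2 a1] by auto

lemma lex_eq:
  fixes a1 a2 r1 r2 m :: nat
  assumes "r1 < m" "r2 < m"
  shows "a1 * m + r1 = a2 * m + r2 \<longleftrightarrow> a1 = a2 \<and> r1 = r2"
  unfolding order_eq_iff[of "a1 * m + r1"] lex_le[OF assms] lex_le[OF assms(2,1)] by auto

text \<open>In a sorted list the elements of value below \<open>k\<close> form a prefix, so their
  number is the position where segment \<open>k\<close> starts.\<close>

lemma length_filter_less_sorted:
  fixes f :: "'a \<Rightarrow> nat"
  shows "sorted (map f xs) \<Longrightarrow> p < length xs \<Longrightarrow> p < length (filter (\<lambda>y. f y < k) xs) \<longleftrightarrow> f (xs ! p) < k"
proof (induction xs arbitrary: p)
  case (Cons x xs)
  show ?case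
  proof (cases "f x < k")
    case True
    then show ?thesis using Cons by (cases p) auto
  next
    case False
    then have "\<not> f y < k" if "y \<in> set xs" for y using Cons.prems(1) that by fastforce
    moreover from this have "filter (\<lambda>y. f y < k) xs = []" by (simp add: filter_empty_conv)
    moreover have "(x # xs) ! p \<in> set (x # xs)" using Cons.prems(2) nth_mem by blast
    ultimately show ?thesis using False by auto
  qed
qed simp

text \<open>Aligned with \<open>events\<close>: the entry at a position is the action that emitted
  the event there. The commit of a store emits two events and is therefore listed twice.\<close>

definition labels :: "('q, 'd::zero, 'r) program \<Rightarrow> ('q, 'd, 'r) pstate \<Rightarrow> action list \<Rightarrow> action list" where
  "labels P s bs = concat (map (\<lambda>b. replicate (length (evs P s b)) b) bs)"

abbreviation events :: "('q, 'd::zero, 'r) program \<Rightarrow> ('q, 'd, 'r) pstate \<Rightarrow> action list \<Rightarrow> ('q, 'd, 'r) event list" where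
  "events P s bs \<equiv> concat (map (evs P s) bs)"

lemma length_labels: "length (labels P s bs) = length (events P s bs)"
  by (induction bs) (simp_all add: labels_def)

lemma set_labels: "set (labels P s bs) \<subseteq> set bs"
  by (auto simp: labels_def)

lemma evs_nonempty: "0 < length (evs P s b)"
  by (cases b) auto

lemma sorted_labels:
  fixes f :: "action \<Rightarrow> nat"
  shows "sorted_wrt (\<lambda>a b. f a < f b) bs \<Longrightarrow> sorted (map f (labels P s bs))"
proof (induction bs)
  case (Cons b bs)
  have "labels P s (b # bs) = replicate (length (evs P s b)) b @ labels P s bs" by (simp add: labels_def)
  then show ?case using Cons set_labels[of P s bs]
    by (auto simp: sorted_append less_imp_le)
qed (simp add: labels_def)

lemma event_label: "p < length (events P s bs) \<Longrightarrow> events P s bs ! p \<in> set (evs P s (labels P s bs ! p))"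
proof (induction bs arbitrary: p)
  case (Cons b bs)
  have l: "labels P s (b # bs) = replicate (length (evs P s b)) b @ labels P s bs" by (simp add: labels_def)
  show ?case
    using Cons.IH[of "p - length (evs P s b)"] Cons.prems
    by (cases "p < length (evs P s b)") (auto simp: l nth_append)
qed simp

lemma valid_from_snoc: "valid_from P s A (bs @ [b]) \<longleftrightarrow> valid_from P s A bs \<and> enabled P s (A \<union> set bs) b"
  unfolding valid_from_def by (auto simp: less_Suc_eq nth_append)

lemma length_filter_fetch:
  assumes "valid_from P s {} bs"
  shows "length (filter (is_fetch_of t) (events P s bs)) = card {j. AFetch t j \<in> set bs}"
  using assms
proof (induction bs rule: rev_induct)
  case (snoc b bs)
  have IH: "length (filter (is_fetch_of t) (events P s bs)) = card {j. AFetch t j \<in> set bs}"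
    and en: "enabled P s (set bs) b"
    using snoc by (simp_all add: valid_from_snoc)
  have fin: "finite {j. AFetch t j \<in> set bs}"
    using finite_vimageI[of "set bs" "AFetch t"] by (simp add: inj_def vimage_def)
  show ?case
  proof (cases "\<exists>i. b = AFetch t i")
    case True
    then obtain i where i: "b = AFetch t i" by blast
    have "{j. AFetch t j \<in> set (bs @ [b])} = insert i {j. AFetch t j \<in> set bs}" using i by auto
    moreover have "AFetch t i \<notin> set bs" using enabled_fresh[OF en] i by simp
    ultimately show ?thesis using IH fin i by simp
  next
    case False
    then have "{j. AFetch t j \<in> set (bs @ [b])} = {j. AFetch t j \<in> set bs}" by auto
    moreover have "filter (is_fetch_of t) (evs P s b) = []" using False by (cases b) auto
    ultimately show ?thesis using IH by simp
  qed
qed simp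

lemma rel_instr_append: "p < length es \<Longrightarrow> rel_instr (es @ es') p = rel_instr es p"
  by (auto simp: rel_instr_def nth_append split: event.split)

text \<open>For a fetch, \<open>rel_instr\<close> counts the earlier fetches of the thread. An
  enabled fetch of index i comes after exactly the fetches of the indices below i, so the count is
  i.\<close>

lemma rel_instr_label:
  assumes "valid_from P s {} bs" "p < length (events P s bs)"
  shows "rel_instr (events P s bs) p = ins_of (labels P s bs ! p)"
  using assms
proof (induction bs rule: rev_induct)
  case (snoc b bs)
  have v: "valid_from P s {} bs" and en: "enabled P s (set bs) b"
    using snoc.prems(1) by (simp_all add: valid_from_snoc)
  have ev: "events P s (bs @ [b]) = events P s bs @ evs P s b" by simp
  have lb: "labels P s (bs @ [b]) = labels P s bs @ replicate (length (evs P s b)) b" by (simp add: labels_def)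
  show ?case
  proof (cases "p < length (events P s bs)")
    case True
    then show ?thesis
      unfolding ev lb using snoc.IH[OF v True] rel_instr_append[OF True]
      by (simp add: nth_append length_labels)
  next
    case False
    define q where "q = p - length (events P s bs)"
    have p: "p = length (events P s bs) + q" using False q_def by simp
    have q: "q < length (evs P s b)" using snoc.prems(2) p by simp
    have l: "labels P s (bs @ [b]) ! p = b"
      unfolding lb p using q by (simp add: nth_append length_labels)
    have "rel_instr (events P s bs @ evs P s b) p = ins_of b"
    proof (cases b)
      case (AFetch t i)
      then have "q = 0" using q by simp
      moreover have "card {j. AFetch t j \<in> set bs} = i" using en AFetch by simp
      ultimately show ?thesis using AFetch length_filter_fetch[OF v, of t] by (simp add: rel_instr_def p)
    next
      case (ACommit t i)
      then show ?thesis using q by (auto simp: rel_instr_def p nth_append less_Suc_eq)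
    qed (use q in \<open>auto simp: rel_instr_def p nth_append\<close>)
    then show ?thesis unfolding ev l .
  qed
qed simp

text \<open>Each segment is sorted by the same injective rank \<open>\<rho>\<close> of instructions,
  so two instructions appear in the same order in every segment in which both have events.\<close>

lemma normal_form_by_key:
  fixes \<kappa> seg :: "action \<Rightarrow> nat" and \<rho> :: "nat \<times> nat \<Rightarrow> nat"
  assumes v: "valid_from P s {} bs" and so: "sorted_wrt (\<lambda>a b. \<kappa> a < \<kappa> b) bs"
    and seg: "\<And>a b. a \<in> set bs \<Longrightarrow> b \<in> set bs \<Longrightarrow> \<kappa> a \<le> \<kappa> b \<Longrightarrow> seg a < seg b \<or> seg a = seg b \<and> \<rho> (ins_of a) \<le> \<rho> (ins_of b)"
    and inj: "inj_on \<rho> (ins_of ` set bs)"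
    and fetch: "\<And>t i. seg (AFetch t i) = 0"
    and n: "\<And>b. b \<in> set bs \<Longrightarrow> seg b < n" "0 < n"
  shows "normal_form (events P s bs) n"
proof -
  let ?es = "events P s bs" and ?L = "labels P s bs"
  define b where "b k = length (filter (\<lambda>y. seg y < k) ?L)" for k
  have mem: "?L ! p \<in> set bs" if "p < length ?es" for p
    using set_labels[of P s bs] nth_mem[of p ?L] that by (auto simp: length_labels)
  have mono: "\<kappa> (?L ! p) \<le> \<kappa> (?L ! q)" if "p \<le> q" "q < length ?es" for p q
    using sorted_nth_mono[OF sorted_labels[OF so], of p q P s] that by (simp add: length_labels)
  have "seg (?L ! p) \<le> seg (?L ! q)" if "p \<le> q" "q < length ?es" for p q
    using seg[OF mem mem mono[OF that]] that by auto
  then have "sorted (map seg ?L)"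
    by (simp add: sorted_iff_nth_mono length_labels)
  then have bk: "p < b k \<longleftrightarrow> seg (?L ! p) < k" if "p < length ?es" for p k
    unfolding b_def using length_filter_less_sorted that by (metis length_labels)
  have b_le: "b k \<le> length ?es" for k unfolding b_def length_labels[symmetric] by simp
  have in_seg: "p < length ?es \<and> seg (?L ! p) = k" if "p \<in> {b k ..< b (Suc k)}" for p k
  proof -
    have "p < length ?es" using that b_le[of "Suc k"] by auto
    then show ?thesis using that bk[of p k] bk[of p "Suc k"] by auto
  qed
  have ord: "p1 < p2 \<longleftrightarrow> \<rho> (rel_instr ?es p1) < \<rho> (rel_instr ?es p2)"
    if "p1 \<in> {b k ..< b (Suc k)}" "p2 \<in> {b k ..< b (Suc k)}" "rel_instr ?es p1 \<noteq> rel_instr ?es p2" for p1 p2 k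
  proof -
    note i = in_seg[OF that(1)] in_seg[OF that(2)]
    have r: "rel_instr ?es p = ins_of (?L ! p)" if "p < length ?es" for p using rel_instr_label[OF v that] .
    have "\<rho> (rel_instr ?es p) < \<rho> (rel_instr ?es q)"
      if "p < q" "q < length ?es" "seg (?L ! p) = seg (?L ! q)" "rel_instr ?es p \<noteq> rel_instr ?es q" for p q
    proof -
      have "\<rho> (ins_of (?L ! p)) \<le> \<rho> (ins_of (?L ! q))"
        using seg[OF mem mem mono[of p q]] that by auto
      moreover have "\<rho> (ins_of (?L ! p)) \<noteq> \<rho> (ins_of (?L ! q))"
        using inj_onD[OF inj, of "ins_of (?L ! p)" "ins_of (?L ! q)"] that r[of p] r[of q] mem[of p] mem[of q] by auto
      ultimately show ?thesis using r[of p] r[of q] that by simp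
    qed
    from this[of p1 p2] this[of p2 p1] show ?thesis using i that(3)
      by (cases p1 p2 rule: linorder_cases) auto
  qed
  have "b 0 = 0" by (simp add: b_def)
  moreover have "b n = length ?es"
  proof -
    have "filter (\<lambda>y. seg y < n) ?L = ?L" using n set_labels[of P s bs] by (intro filter_True) auto
    then show ?thesis by (simp add: b_def length_labels)
  qed
  moreover have "b k \<le> b (Suc k)" for k
  proof (rule ccontr)
    assume "\<not> b k \<le> b (Suc k)"
    then have "b (Suc k) < b k" "b (Suc k) < length ?es" using b_le[of k] by auto
    then show False using bk[of "b (Suc k)" k] bk[of "b (Suc k)" "Suc k"] by auto
  qed
  moreover have "p < b 1" if "p < length ?es" "is_fetch (?es ! p)" for p
  proof -
    have "\<exists>t i. ?L ! p = AFetch t i"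
      using event_label[OF that(1)] that(2) by (cases "?L ! p") (auto split: if_splits)
    then show ?thesis using bk[OF that(1), of 1] fetch by auto
  qed
  moreover have "p1 < p2 \<longleftrightarrow> q1 < q2"
    if "p1 \<in> {b k ..< b (Suc k)} \<and> p2 \<in> {b k ..< b (Suc k)} \<and>
        q1 \<in> {b k' ..< b (Suc k')} \<and> q2 \<in> {b k' ..< b (Suc k')} \<and>
        rel_instr ?es p1 = rel_instr ?es q1 \<and> rel_instr ?es p2 = rel_instr ?es q2 \<and>
        rel_instr ?es p1 \<noteq> rel_instr ?es p2" for k k' p1 p2 q1 q2
    using ord[of p1 k p2] ord[of q1 k' q2] that by auto
  ultimately show ?thesis unfolding normal_form_def by (intro exI[of _ b]) blast
qed

context run
begin

text \<open>The cut actions are the non-fetch actions of the po-last instruction \<open>x\<close>. Each of them closes a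
  segment, and within the segments the actions are sorted by a linear extension of
  happens-before on the other instructions, with \<open>x\<close> placed last.\<close>

lemma reorder_around:
  assumes x: "x \<in> inrange P s" and last: "\<And>j. (fst x, j) \<in> inrange P s \<Longrightarrow> j \<le> snd x"
    and ac: "acyclic (hbi P s \<inter> (inrange P s - {x}) \<times> (inrange P s - {x}))"
    and cnt: "card {b \<in> set bs. (\<forall>t i. b \<noteq> AFetch t i) \<and> ins_of b = x} \<le> length P + 1"
  obtains bs' where "set bs' = set bs" "valid_from P s {} bs'" "normal_form (events P s bs') (length P + 3)"
proof -
  define X where "X = {b \<in> set bs. (\<forall>t i. b \<noteq> AFetch t i) \<and> ins_of b = x}"
  obtain f where f: "inj_on f (inrange P s - {x})" "\<And>u. u \<in> inrange P s - {x} \<Longrightarrow> f u < card (inrange P s - {x})"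
    "\<And>u v. u \<in> inrange P s - {x} \<Longrightarrow> v \<in> inrange P s - {x} \<Longrightarrow> (u, v) \<in> hbi P s \<Longrightarrow> f u < f v"
    using finite_acyclic_ranking[OF _ ac] by auto
  define R where "R = card (inrange P s)"
  \<comment> \<open>\<open>f\<close> stays below this number, so x becomes the greatest
    instruction.\<close>
  define \<rho> where "\<rho> = f(x := card (inrange P s - {x}))"
  have R: "card (inrange P s - {x}) < R" unfolding R_def using x by (intro psubset_card_mono) auto
  have \<rho>_less: "\<rho> u < R" if "u \<in> inrange P s" for u
    using that f(2)[of u] R by (auto simp: \<rho>_def)
  have \<rho>_inj: "inj_on \<rho> (inrange P s)"
    using f(1,2) by (fastforce simp: inj_on_def \<rho>_def)
  have \<rho>_hb: "\<rho> u < \<rho> v" if "(u, v) \<in> hbi P s" "u \<noteq> x" for u v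
  proof -
    have "u \<in> inrange P s" "v \<in> inrange P s" using that(1) by (auto simp: hbi_def)
    then show ?thesis using that f(2,3) by (auto simp: \<rho>_def)
  qed
  \<comment> \<open>Segment 0 is reserved for the fetches. Only the cut actions strictly before
    \<open>b\<close> are counted, so a cut action still belongs to the segment that it
    closes.\<close>
  define seg where "seg b = (if \<exists>t i. b = AFetch t i then 0 else Suc (card {c \<in> X. pos c < pos b}))" for b
  have finX: "finite X" by (simp add: X_def)
  have segF: "seg (AFetch t i) = 0" for t i by (simp add: seg_def)
  have segN: "seg b = Suc (card {c \<in> X. pos c < pos b})" if "\<forall>t i. b \<noteq> AFetch t i" for b
    using that by (simp add: seg_def)
  have seg_mono: "seg b \<le> seg c" if "\<forall>t i. c \<noteq> AFetch t i" "pos b \<le> pos c" for b c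
    using that finX by (auto simp: seg_def intro!: card_mono)
  have seg_X: "seg b < seg c" if "b \<in> X" "\<forall>t i. c \<noteq> AFetch t i" "pos b < pos c" for b c
  proof -
    have "\<forall>t i. b \<noteq> AFetch t i" using that(1) by (simp add: X_def)
    moreover have "card {d \<in> X. pos d < pos b} < card {d \<in> X. pos d < pos c}"
      using finX that(1,3) by (intro psubset_card_mono) auto
    ultimately show ?thesis using segN that(2) by simp
  qed
  have seg_less: "seg b < length P + 3" for b
  proof -
    have "card {c \<in> X. pos c < pos b} \<le> card X" using finX by (intro card_mono) auto
    then show ?thesis using cnt unfolding seg_def X_def by auto
  qed
  \<comment> \<open>Lexicographic in segment, rank and original position, with \<open>R\<close> and
    \<open>length bs\<close> as bases. The last component separates the actions of one instruction
    within a segment.\<close>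
  define \<kappa> where "\<kappa> b = (seg b * R + \<rho> (ins_of b)) * length bs + pos b" for b
  have \<rho>a: "\<rho> (ins_of b) < R" if "b \<in> set bs" for b using \<rho>_less action_inrange that by blast
  have less: "\<kappa> a < \<kappa> b \<longleftrightarrow> seg a < seg b \<or> seg a = seg b \<and>
      (\<rho> (ins_of a) < \<rho> (ins_of b) \<or> \<rho> (ins_of a) = \<rho> (ins_of b) \<and> pos a < pos b)"
    if "a \<in> set bs" "b \<in> set bs" for a b
  proof -
    note r = \<rho>a[OF that(1)] \<rho>a[OF that(2)]
    let ?x = "seg a * R + \<rho> (ins_of a)" and ?y = "seg b * R + \<rho> (ins_of b)"
    have "\<kappa> a < \<kappa> b \<longleftrightarrow> ?x < ?y \<or> ?x = ?y \<and> pos a < pos b"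
      unfolding \<kappa>_def by (rule lex_less) (use pos(1) that in auto)
    moreover have "?x < ?y \<longleftrightarrow> seg a < seg b \<or> seg a = seg b \<and> \<rho> (ins_of a) < \<rho> (ins_of b)"
      using r by (rule lex_less)
    moreover have "?x = ?y \<longleftrightarrow> seg a = seg b \<and> \<rho> (ins_of a) = \<rho> (ins_of b)"
      using r by (rule lex_eq)
    ultimately show ?thesis by blast
  qed
  have "inj_on \<kappa> (set bs)"
  proof (rule inj_onI)
    fix a b assume "a \<in> set bs" "b \<in> set bs" "\<kappa> a = \<kappa> b"
    moreover from this have "pos a = pos b"
      using less[of a b] less[of b a] by (metis less_irrefl linorder_neqE_nat)
    ultimately show "a = b" using pos_inj by blast
  qed
  then obtain bs' where bs': "set bs' = set bs" and so: "sorted_wrt (\<lambda>a b. \<kappa> a < \<kappa> b) bs'"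
    using sort_by_key[of "set bs" \<kappa>] by auto
  have "valid_from P s {} bs'"
    unfolding valid_from_def
  proof (intro allI impI)
    fix k assume k: "k < length bs'"
    define b where "b = bs' ! k"
    define A' where "A' = {c \<in> set bs. \<kappa> c < \<kappa> b}"
    have A': "{} \<union> set (take k bs') = A'" unfolding A'_def b_def using set_take_sorted[OF so k, unfolded bs'] by (simp only: Un_empty_left)
    have b: "b \<in> set bs" unfolding b_def by (rule nth_mem[OF k, unfolded bs'])
    have "enabled P s A' b"
    proof (cases "\<exists>t i. b = AFetch t i")
      case True
      then obtain t i where ti: "b = AFetch t i" by blast
      have i: "(t, i) \<in> inrange P s" using b ti fetch_iff by simp
      \<comment> \<open>As x is po-last, its artificially high rank does not disturb the order of
        the fetches.\<close>
      have po: "\<rho> (t, j) < \<rho> (t, j')" if "j < j'" "(t, j') \<in> inrange P s" for j j'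
      proof -
        have j: "(t, j) \<in> inrange P s" using that by (auto simp: inrange_def)
        have "(t, j) \<noteq> x" using last[of j'] that by auto
        then show ?thesis using \<rho>_hb[OF hbiI(1)[OF j that(2)]] that(1) by simp
      qed
      have "AFetch t j \<in> A' \<longleftrightarrow> j < i" for j
      proof (cases "(t, j) \<in> inrange P s")
        case True
        then have "AFetch t j \<in> set bs" using fetch_iff by simp
        then have "AFetch t j \<in> A' \<longleftrightarrow> \<rho> (t, j) < \<rho> (t, i) \<or> \<rho> (t, j) = \<rho> (t, i) \<and> pos (AFetch t j) < pos (AFetch t i)"
          unfolding A'_def using less[of "AFetch t j" b] b ti segF by auto
        then show ?thesis using po[of j i] po[of i j] i True
          by (cases i j rule: linorder_cases) auto
      next
        case False
        then have "\<not> j < i" using i by (auto simp: inrange_def)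
        then show ?thesis using False fetch_iff by (auto simp: A'_def)
      qed
      then show ?thesis using ti i by (auto simp: inrange_def)
    next
      case nf: False
      define A where "A = set (take (pos b) bs)"
      have Ai: "c \<in> A \<longleftrightarrow> c \<in> set bs \<and> pos c < pos b" for c
        unfolding A_def using set_take_pos[of "pos b"] pos(1)[OF b] by auto
      interpret reorder P s bs "pos b" A A' b
      proof
        show "pos b < length bs" "A = set (take (pos b) bs)" "b = bs ! pos b" "A' \<subseteq> set bs"
          using pos b A_def by (auto simp: A'_def)
        show "c \<in> A'" if c: "c \<in> A" "ins_of c = ins_of b \<or> (ins_of c, ins_of b) \<in> hbi P s" for c
        proof -
          have cb: "c \<in> set bs" "pos c < pos b" using c(1) Ai by auto
          have "seg c \<le> seg b" using seg_mono[of b c] nf cb(2) by simp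
          \<comment> \<open>An action of x in front of \<open>b\<close> is a fetch, which lies in
            segment 0, or a cut, after which a new segment starts; so in the segment of
            \<open>b\<close> the rank agrees with happens-before.\<close>
          moreover have "\<rho> (ins_of c) < \<rho> (ins_of b) \<or> \<rho> (ins_of c) = \<rho> (ins_of b)" if "seg c = seg b"
          proof (cases "ins_of c = x")
            case True
            have "\<forall>t i. c \<noteq> AFetch t i" using that segN[of b] nf segF by force
            then have "c \<in> X" using True cb(1) by (simp add: X_def)
            then show ?thesis using seg_X[of c b] nf cb(2) that by simp
          next
            case False
            then show ?thesis using c(2) \<rho>_hb by metis
          qed
          ultimately show ?thesis unfolding A'_def using less[OF cb(1) b] cb by auto
        qed
        show "\<not> (ins_of c = ins_of b \<or> (ins_of b, ins_of c) \<in> hbi P s)"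
          if c: "c \<in> A'" "c \<notin> A" "\<forall>t i. c \<noteq> AFetch t i" for c
        proof -
          have cb: "c \<in> set bs" "\<kappa> c < \<kappa> b" using c(1) by (auto simp: A'_def)
          have "c \<noteq> b" using cb(2) by auto
          then have p: "pos b < pos c" using Ai[of c] c(2) cb(1) pos_inj[OF cb(1) b] by force
          have "seg b \<le> seg c" using seg_mono[of c b] c(3) p by simp
          then have eq: "seg c = seg b" and lt: "\<rho> (ins_of c) < \<rho> (ins_of b)"
            using less[OF cb(1) b] cb(2) p by auto
          \<comment> \<open>A cut action is the last of its segment: what follows it in the given
            run, apart from fetches, lies in a later segment and cannot have moved ahead of
            it.\<close>
          have "ins_of b \<noteq> x"
          proof
            assume "ins_of b = x"
            then have "b \<in> X" using nf b by (simp add: X_def)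
            then show False using seg_X[of b c] c(3) p eq by simp
          qed
          then show ?thesis using lt \<rho>_hb by fastforce
        qed
      qed
      show ?thesis using enabled_reorder nf by blast
    qed
    then show "enabled P s ({} \<union> set (take k bs')) (bs' ! k)" unfolding A' b_def .
  qed
  moreover have "normal_form (events P s bs') (length P + 3)"
  proof (rule normal_form_by_key[where \<kappa> = \<kappa> and seg = seg and \<rho> = \<rho>])
    show "seg a < seg b \<or> seg a = seg b \<and> \<rho> (ins_of a) \<le> \<rho> (ins_of b)"
      if "a \<in> set bs'" "b \<in> set bs'" "\<kappa> a \<le> \<kappa> b" for a b
      using less[of b a] that bs' by (auto simp: not_less[symmetric])
    show "inj_on \<rho> (ins_of ` set bs')"
      using \<rho>_inj by (rule inj_on_subset) (use action_inrange bs' in auto)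
  qed (use calculation so segF seg_less in auto)
  ultimately show thesis using that bs' by blast
qed

end

section \<open>Sequential consistency\<close>

lemma rv_cong:
  assumes "Fs u = Fs s" "Ls u = Ls s"
  shows "rv n u = rv n s"
proof (induction n)
  case (Suc n)
  have c: "cmd_of u = cmd_of s" using assms(1) by (simp add: cmd_of_def fun_eq_iff)
  have l: "last_writer u = last_writer s" by (simp add: last_writer_def c fun_eq_iff)
  have r: "reg_step u R = reg_step s R" for R
    by (intro ext) (unfold reg_step_def c l assms(2), rule HOL.refl)
  show ?case by (intro ext) (simp only: rv_Suc r Suc)
qed (simp add: fun_eq_iff)

lemma ev_expr_cong: "Fs u = Fs s \<Longrightarrow> Ls u = Ls s \<Longrightarrow> ev_expr P u = ev_expr P s"
  by (intro ext) (simp only: ev_expr_def fuel_def rv_cong[of u s])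

lemma addr_cong: "Fs u = Fs s \<Longrightarrow> Ls u = Ls s \<Longrightarrow> addr P u = addr P s"
  by (intro ext) (simp only: addr_def ev_expr_cong[of u s] cmd_of_def)

lemma cokey_cong: "co u = co s \<Longrightarrow> cokey u z = cokey s z"
  by (cases z) auto

lemma final_cong:
  assumes "Fs u = Fs s" "Ls u = Ls s" "co u = co s" "Cs u = Cs s"
  shows "final P u \<longleftrightarrow> final P s"
  unfolding final_def addr_cong[OF assms(1,2)] cokey_cong[OF assms(3)] cmd_of_def assms ..

lemma trace_of_cong:
  assumes "Fs u = Fs s" "Ls u = Ls s" "co u = co s"
  shows "trace_of P u = trace_of P s"
proof -
  have n: "nd u = nd s" by (simp add: nd_def fun_eq_iff assms(1))
  have "sid_node u z = sid_node s z" for z by (cases z) (simp_all add: n)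
  moreover have "store_at P u = store_at P s"
    by (intro ext) (simp only: store_at_def addr_cong[OF assms(1,2)] cmd_of_def assms(1))
  ultimately show ?thesis
    unfolding trace_of_def n cokey_cong[OF assms(3)] cmd_of_def assms by simp
qed

text \<open>A replay with another set of propagations may end in a state that differs from
  \<open>s\<close>, but only in \<open>prp\<close>, which neither the trace nor finality
  consults.\<close>

lemma rep_fields:
  assumes "rep P s A u" "\<And>t i. AFetch t i \<in> A \<longleftrightarrow> i < length (Fs s t)" "\<And>t. Cs s t = {i. ACommit t i \<in> A}"
    "\<And>t i. ALoad t i \<notin> A \<Longrightarrow> Ls s t i = None" "\<And>t i. ACommit t i \<notin> A \<Longrightarrow> co s (t, i) = None"
  shows "Fs u = Fs s" "Ls u = Ls s" "co u = co s" "Cs u = Cs s"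
proof -
  note U = repD[OF assms(1)]
  show "Fs u = Fs s"
  proof
    fix t
    obtain zs where zs: "Fs s t = Fs u t @ zs" using U(1) by blast
    have "i < length (Fs u t) \<longleftrightarrow> i < length (Fs s t)" for i using U(2) assms(2) by blast
    then have "length (Fs u t) = length (Fs s t)" by (metis less_irrefl linorder_neqE_nat)
    then show "Fs u t = Fs s t" using zs by simp
  qed
  show "Ls u = Ls s" using U(4) assms(4) by (auto simp: fun_eq_iff)
  show "co u = co s" using U(5) assms(5) by (auto simp: fun_eq_iff)
  show "Cs u = Cs s" using U(3) assms(3) by (auto simp: fun_eq_iff)
qed

lemma power_comp_run:
  assumes "power_comp P es s"
  shows "\<exists>bs. run P s bs \<and> es = events P s bs"
proof -
  have st: "steps P init_state es s" "final P s" using assms by (auto simp: power_comp_def)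
  have wf: "wf_state P s" using steps_wf_state[OF st(1) wf_init] by blast
  obtain bs where "es = events P s bs" "valid_from P s {} bs" "rep P s ({} \<union> set bs) s"
    using forward_run[OF st(1) wf_init rep_init extends_refl wf_state_target[OF wf]] by blast
  then show ?thesis using wf st(2) by (auto simp: run_def)
qed

lemma tcf_iff: "(x, y) \<in> tcf (trace_of P s) \<longleftrightarrow> (\<exists>z. (z, x) \<in> tsrc (trace_of P s) \<and> (z, y) \<in> tco (trace_of P s))"
  by (simp add: trace_of_def Let_def)

text \<open>The trace relates only consecutive instructions of a thread, while \<open>hbi\<close>
  relates all ordered pairs; hence the transitive closure.\<close>

lemma hbi_hb:
  assumes wf: "wf_state P s" and uv: "(u, v) \<in> hbi P s"
  shows "(nd s (fst u) (snd u), nd s (fst v) (snd v)) \<in> (hb (trace_of P s))\<^sup>+"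
proof -
  obtain t i t' i' where u: "u = (t, i)" and v: "v = (t', i')" by (cases u, cases v) auto
  have r: "t < length P" "i < length (Fs s t)" "t' < length P" "i' < length (Fs s t')"
    using uv u v by (auto simp: hbi_def inrange_def)
  have po: "(nd s t j, nd s t j') \<in> (hb (trace_of P s))\<^sup>+" if "j < j'" "j' < length (Fs s t)" for j j'
    using that
  proof (induction j')
    case (Suc j')
    have e: "(nd s t j', nd s t (Suc j')) \<in> hb (trace_of P s)"
      using Suc.prems(2) r(1) by (auto simp: hb_def trace_of_def)
    show ?case
    proof (cases "j = j'")
      case False
      then have "(nd s t j, nd s t j') \<in> (hb (trace_of P s))\<^sup>+" using Suc by simp
      then show ?thesis using e by (rule trancl_into_trancl)
    qed (use e in auto)
  qed simp
  have co: "(sid_node s z, nd s t' i') \<in> tco (trace_of P s)" if "coh P s z (t', i')" for z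
    using that unfolding coh_def trace_of_def Let_def by fastforce
  have src: "(sid_node s z, nd s t0 i0) \<in> tsrc (trace_of P s)" if "reads_from P s (t0, i0) z" for z t0 i0
    using that unfolding reads_from_def trace_of_def Let_def inrange_def by fastforce
  consider "t = t'" "i < i'" | "coh P s (St t i) (t', i')" | "reads_from P s (t', i') (St t i)"
    | z where "reads_from P s (t, i) z" "coh P s z (t', i')"
    using uv u v by (auto simp: hbi_def)
  then show ?thesis
  proof cases
    case 1
    then show ?thesis using po[of i i'] r u v by simp
  next
    case 2
    then show ?thesis using co[of "St t i"] u v by (auto simp: hb_def)
  next
    case 3
    then show ?thesis using src[of t' i' "St t i"] u v by (auto simp: hb_def)
  next
    case 4
    then have "(nd s t i, nd s t' i') \<in> tcf (trace_of P s)"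
      using co[of z] src[of t i z] unfolding tcf_iff by blast
    then show ?thesis using u v by (auto simp: hb_def)
  qed
qed

lemma acyclic_hbi:
  assumes "wf_state P s" "\<not> cyclic_hb (trace_of P s)"
  shows "acyclic (hbi P s)"
proof -
  have "(u, v) \<in> (hbi P s)\<^sup>+ \<Longrightarrow> (nd s (fst u) (snd u), nd s (fst v) (snd v)) \<in> (hb (trace_of P s))\<^sup>+" for u v
    by (induction rule: trancl_induct) (auto intro: hbi_hb[OF assms(1)] trancl_trans)
  then show ?thesis using assms(2) unfolding acyclic_def cyclic_hb_def by blast
qed

section \<open>An acyclic run has the trace of an SC computation\<close>

context run
begin

lemma target: "target P s"
  using wf wf_state_target by blast

text \<open>The new schedule must agree with the old one on fetches, loads and commits but not on
  propagations. An SC computation needs this freedom, because it propagates every store to every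
  thread.\<close>

lemma replay:
  assumes "valid_from P s {} bs'"
    "\<And>t i. AFetch t i \<in> set bs' \<longleftrightarrow> AFetch t i \<in> set bs" "\<And>t i. ACommit t i \<in> set bs' \<longleftrightarrow> ACommit t i \<in> set bs"
    "\<And>t i. ALoad t i \<in> set bs' \<longleftrightarrow> ALoad t i \<in> set bs"
  obtains u where "power_comp P (events P s bs') u" "trace_of P u = trace_of P s"
    "Fs u = Fs s" "Ls u = Ls s" "co u = co s" "Cs u = Cs s"
proof -
  obtain u where u: "steps P init_state (events P s bs') u" "rep P s ({} \<union> set bs') u"
    using replay_run[OF assms(1) wf_init rep_init target] by blast
  then have r: "rep P s (set bs') u" by simp
  have "AFetch t i \<in> set bs' \<longleftrightarrow> i < length (Fs s t)" "Cs s t = {i. ACommit t i \<in> set bs'}"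
    "ALoad t i \<notin> set bs' \<Longrightarrow> Ls s t i = None" "ACommit t i \<notin> set bs' \<Longrightarrow> co s (t, i) = None" for t i
    using repD(2,3)[OF rep] repD(4)[OF rep, of t i] repD(5)[OF rep, of t i] assms(2-4) by (simp_all split: if_splits)
  note f = rep_fields[OF r this]
  show thesis using that[of u] u(1) f final_cong[OF f] trace_of_cong[OF f(1-3)] fin
    by (simp add: power_comp_def)
qed

text \<open>Whether an expression is known depends only on loads earlier in the thread; once all of
  them are done, it is as well known as at the end of the run, where nothing is unknown.\<close>

lemma addr_at_all:
  assumes "(t, i) \<in> inrange P s" "\<And>j. j < i \<Longrightarrow> ALoad t j \<in> set bs \<Longrightarrow> ALoad t j \<in> A"
  shows "addr_at P s A t i = addr P s t i" "val_known_at s A t i"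
proof -
  have r: "t < length P" "i < length (Fs s t)" using assms(1) by (auto simp: inrange_def)
  have k: "addr P s t i \<noteq> Some None" "val P s t i \<noteq> Some None"
    using committed[OF assms(1)] wf unfolding wf_state_def wf_commits_def by blast+
  have mono: "expr_known s (loads_in A) t i eo" if "expr_known s (loads_in (set bs)) t i eo" for eo
    using that by (rule expr_known_mono) (use assms(2) in \<open>auto simp: loads_in_def\<close>)
  have "expr_known s (loads_in (set bs)) t i (addr_expr (cmd_of s t i))"
    using rep_addr[OF rep wf r] k(1) by (auto simp: addr_at_def split: if_splits)
  then show "addr_at P s A t i = addr P s t i" using mono by (simp add: addr_at_def)
  have "val_known_at s (set bs) t i" using rep_val(2)[OF rep wf r] k(2) by simp
  then show "val_known_at s A t i" using mono by (simp add: val_known_at_def)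
qed

text \<open>Executes the instructions one at a time along a linear extension of happens-before.
  Coherence edges let the stores to an address arrive in the order of their keys; source and
  conflict edges make the store to be read the latest one present. All early reads thereby turn into
  reads from memory.\<close>

lemma sc_exists:
  assumes "acyclic (hbi P s)"
  shows "\<exists>es u. sc_comp P es u \<and> trace_of P u = trace_of P s"
proof -
  let ?I = "inrange P s"
  have hb_in: "u \<in> ?I \<and> v \<in> ?I" if "(u, v) \<in> hbi P s" for u v using that by (simp add: hbi_def)
  have "acyclic (hbi P s \<inter> ?I \<times> ?I)" using assms by (rule acyclic_subset) blast
  then obtain \<rho> where \<rho>_inj: "inj_on \<rho> ?I" and \<rho>_hb: "\<And>u v. (u, v) \<in> hbi P s \<Longrightarrow> \<rho> u < (\<rho> v :: nat)"
    using finite_acyclic_ranking[of ?I "hbi P s"] hb_in by (metis finite_inrange)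
  \<comment> \<open>Propagations to all other threads are included, whether or not the given run
    performed them.\<close>
  define S where "S = {b. case b of AFetch t i \<Rightarrow> (t, i) \<in> ?I | ALoad t i \<Rightarrow> (t, i) \<in> ?I \<and> is_load (cmd_of s t i) |
     ACommit t i \<Rightarrow> (t, i) \<in> ?I | AProp t' t i \<Rightarrow> t' < length P \<and> (t, i) \<in> ?I \<and> t' \<noteq> t \<and> is_store (cmd_of s t i)}"
  have S: "AFetch t i \<in> S \<longleftrightarrow> (t, i) \<in> ?I" "ALoad t i \<in> S \<longleftrightarrow> (t, i) \<in> ?I \<and> is_load (cmd_of s t i)"
    "ACommit t i \<in> S \<longleftrightarrow> (t, i) \<in> ?I"
    "AProp t' t i \<in> S \<longleftrightarrow> t' < length P \<and> (t, i) \<in> ?I \<and> t' \<noteq> t \<and> is_store (cmd_of s t i)" for t i t'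
    by (simp_all add: S_def)
  have "S \<subseteq> (\<lambda>(t, i). AFetch t i) ` ?I \<union> (\<lambda>(t, i). ALoad t i) ` ?I \<union> (\<lambda>(t, i). ACommit t i) ` ?I \<union>
     (\<lambda>(t', t, i). AProp t' t i) ` ({..<length P} \<times> ?I)"
  proof
    fix b assume b: "b \<in> S"
    then show "b \<in> (\<lambda>(t, i). AFetch t i) ` ?I \<union> (\<lambda>(t, i). ALoad t i) ` ?I \<union> (\<lambda>(t, i). ACommit t i) ` ?I \<union>
       (\<lambda>(t', t, i). AProp t' t i) ` ({..<length P} \<times> ?I)"
    proof (cases b)
      case (AFetch t i)
      then have "(t, i) \<in> ?I" using b S by simp
      from imageI[OF this, of "\<lambda>(t, i). AFetch t i"] show ?thesis using AFetch by simp
    next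
      case (ALoad t i)
      then have "(t, i) \<in> ?I" using b S by simp
      from imageI[OF this, of "\<lambda>(t, i). ALoad t i"] show ?thesis using ALoad by simp
    next
      case (ACommit t i)
      then have "(t, i) \<in> ?I" using b S by simp
      from imageI[OF this, of "\<lambda>(t, i). ACommit t i"] show ?thesis using ACommit by simp
    next
      case (AProp t' t i)
      then have "(t', t, i) \<in> {..<length P} \<times> ?I" using b S by simp
      from imageI[OF this, of "\<lambda>(t', t, i). AProp t' t i"] show ?thesis using AProp by simp
    qed
  qed
  then have finS: "finite S" by (rule finite_subset) simp
  \<comment> \<open>Order of the actions of one instruction. The propagations come last, by thread
    id; as ids are below |P|, all stages are below the base \<open>M\<close>.\<close>
  define stage where "stage b = (case b of AFetch _ _ \<Rightarrow> 0 | ALoad _ _ \<Rightarrow> 1 | ACommit _ _ \<Rightarrow> 2 | AProp t _ _ \<Rightarrow> 3 + t)" for b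
  have stage: "stage (AFetch t i) = 0" "stage (ALoad t i) = 1" "stage (ACommit t i) = 2" "stage (AProp t' t i) = 3 + t'" for t i t'
    by (simp_all add: stage_def)
  define M where "M = length P + 3"
  have st_less: "stage b < M" if "b \<in> S" for b using that S by (cases b) (auto simp: stage_def M_def)
  have insS: "ins_of b \<in> ?I" if "b \<in> S" for b using that S by (cases b) auto
  define \<kappa> where "\<kappa> b = \<rho> (ins_of b) * M + stage b" for b
  have less: "\<kappa> a < \<kappa> b \<longleftrightarrow> \<rho> (ins_of a) < \<rho> (ins_of b) \<or> \<rho> (ins_of a) = \<rho> (ins_of b) \<and> stage a < stage b"
    if "a \<in> S" "b \<in> S" for a b
    unfolding \<kappa>_def using that by (intro lex_less st_less)
  have \<rho>_eq: "\<rho> u = \<rho> v \<longleftrightarrow> u = v" if "u \<in> ?I" "v \<in> ?I" for u v using that \<rho>_inj by (auto dest: inj_onD)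
  have "inj_on \<kappa> S"
  proof (rule inj_onI)
    fix a b assume ab: "a \<in> S" "b \<in> S" "\<kappa> a = \<kappa> b"
    then have "\<rho> (ins_of a) = \<rho> (ins_of b) \<and> stage a = stage b"
      unfolding \<kappa>_def using lex_eq[OF st_less st_less] by blast
    then have "ins_of a = ins_of b" "stage a = stage b" using \<rho>_eq insS ab by auto
    then show "a = b" by (cases a; cases b) (auto simp: stage_def)
  qed
  then obtain cs where cs: "set cs = S" and so: "sorted_wrt (\<lambda>a b. \<kappa> a < \<kappa> b) cs"
    using sort_by_key[OF finS] by blast
  have val: "valid_from P s {} cs"
    unfolding valid_from_def
  proof (intro allI impI)
    fix k assume k: "k < length cs"
    define b where "b = cs ! k"
    define A where "A = {c \<in> S. \<kappa> c < \<kappa> b}"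
    have A': "{} \<union> set (take k cs) = A" using set_take_sorted[OF so k] cs by (simp add: A_def b_def)
    have b: "b \<in> S" unfolding b_def by (rule nth_mem[OF k, unfolded cs])
    have A: "c \<in> A \<longleftrightarrow> c \<in> S \<and> (\<rho> (ins_of c) < \<rho> (ins_of b) \<or> ins_of c = ins_of b \<and> stage c < stage b)" for c
      using less[of c b] b \<rho>_eq insS by (auto simp: A_def)
    have po: "\<rho> (t, j) < \<rho> (t, i)" if "j < i" "(t, i) \<in> ?I" for t i j
      using hbiI(1)[of "(t, j)" P s "(t, i)"] that \<rho>_hb by (auto simp: inrange_def)
    have AI: "ins_of c \<in> ?I \<and> \<rho> (ins_of c) \<le> \<rho> (ins_of b)" if "c \<in> A" for c
      using that A[of c] insS by auto
    have addr: "addr_at P s A t j = addr P s t j" "val_known_at s A t j" if "ins_of b = (t, i)" "j \<le> i" for t i j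
    proof -
      have I: "(t, i) \<in> ?I" using insS[OF b] that by simp
      then have j: "(t, j) \<in> ?I" using that by (auto simp: inrange_def)
      have "ALoad t l \<in> A" if l: "l < j" "ALoad t l \<in> set bs" for l
      proof -
        have "\<rho> (t, l) < \<rho> (t, i)" using po[of l i t] l(1) \<open>j \<le> i\<close> I by simp
        then show ?thesis using A[of "ALoad t l"] S(2) load_iff l(2) \<open>ins_of b = (t, i)\<close> by simp
      qed
      from addr_at_all[OF j this] show "addr_at P s A t j = addr P s t j" "val_known_at s A t j" by auto
    qed
    have commit_po: "ACommit t j \<in> A" if "ins_of b = (t, i)" "j < i" for t i j
      using A[of "ACommit t j"] S(3) insS[OF b] that po[of j i t] by (auto simp: inrange_def)
    have prp_le: "\<rho> w \<le> \<rho> (ins_of b) \<and> w \<in> ?I" if "w \<in> propagated s A t" for w t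
      using that AI[of "AProp t (fst w) (snd w)"] AI[of "ACommit t (snd w)"] by (auto simp: propagated_def)
    have cand_store: "store_at P s t' i' a \<and> \<rho> (t', i') \<le> \<rho> (ins_of b)" if "St t' i' \<in> cands P s A t a" for t' i' t a
    proof -
      have p: "(t', i') \<in> propagated s A t" "addr P s t' i' = Some (Some a)" using that by (auto simp: cands_def)
      have "is_store (cmd_of s t' i')" using p(1) S(4) A by (auto simp: propagated_def)
      then show ?thesis using prp_le[OF p(1)] p(2) by (auto simp: store_at_def inrange_def)
    qed
    \<comment> \<open>A candidate of greater key would be coherence-after this store although its
      rank is not greater. Equal keys would mean the same store, which \<open>np\<close>
      excludes.\<close>
    have overt: "overtakes P s A t t' i'"
      if i: "ins_of b = (t', i')" and st: "is_store (cmd_of s t' i')" and np: "(t', i') \<notin> propagated s A t" for t t' i'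
    proof -
      have I: "(t', i') \<in> ?I" using insS[OF b] i by simp
      obtain a where a: "store_at P s t' i' a" using store_addr[OF I st] by blast
      obtain key where key: "co s (t', i') = Some key" "0 < key" using store_key[OF a] by blast
      have "cokey s z < cokey s (St t' i')" if z: "z \<in> cands P s A t a" for z
      proof (cases z)
        case (Init a')
        then show ?thesis using key by simp
      next
        case z1: (St t1 i1)
        then have st1: "store_at P s t1 i1 a" "\<rho> (t1, i1) \<le> \<rho> (t', i')" using cand_store z i by auto
        show ?thesis
        proof (rule ccontr)
          assume ge: "\<not> ?thesis"
          have "(t1, i1) \<noteq> (t', i')" using z z1 np by (auto simp: cands_def)
          then have "cokey s (St t' i') < cokey s (St t1 i1)"
            using ge z1 store_key_inj[OF st1(1) a] by force
          then have "coh P s (St t' i') (t1, i1)" using a st1(1) by (auto simp: coh_def)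
          then have "((t', i'), (t1, i1)) \<in> hbi P s"
            using I st1 by (intro hbiI(2)) (auto simp: store_at_def inrange_def)
          then show False using \<rho>_hb st1(2) by force
        qed
      qed
      then show ?thesis using key a by (auto simp: overtakes_def store_at_def)
    qed
    have "enabled P s A b"
    proof (cases b)
      case (AFetch t i)
      have I: "(t, i) \<in> ?I" using b AFetch S(1) by simp
      have "AFetch t j \<in> A \<longleftrightarrow> j < i" for j
      proof -
        have "j < i \<Longrightarrow> (t, j) \<in> ?I" using I by (auto simp: inrange_def)
        then show ?thesis
          using A[of "AFetch t j"] S(1)[of t j] po[of j i t] po[of i j t] I AFetch stage
          by (cases i j rule: linorder_cases) auto
      qed
      then show ?thesis using AFetch I by (auto simp: inrange_def)
    next
      case (ALoad t i)
      have I: "(t, i) \<in> ?I" "is_load (cmd_of s t i)" and i: "ins_of b = (t, i)" using b ALoad S(2) by auto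
      obtain z where z: "Ls s t i = Some z" using load_read[OF I] by blast
      then obtain a where a: "addr P s t i = Some (Some a)" and rd: "readable P s z a"
        using wf unfolding wf_state_def wf_loads_def by blast
      have rf: "reads_from P s (t, i) z" using I z by (simp add: reads_from_def)
      have zst: "z = Init a \<or> (\<exists>t' i'. z = St t' i' \<and> store_at P s t' i' a)"
        using rd by (auto simp: readable_def store_at_def inrange_def)
      have "z \<in> cands P s A t a"
        using zst
      proof (elim disjE exE conjE)
        fix t' i' assume zz: "z = St t' i'" and st: "store_at P s t' i' a"
        have I': "(t', i') \<in> ?I" using st by (simp add: store_at_def inrange_def)
        \<comment> \<open>By the source edge. All actions of a lower-ranked instruction come first,
          among them the one that brings the store to thread \<open>t\<close>.\<close>
        have "\<rho> (t', i') < \<rho> (t, i)" using rf zz hbiI(3)[OF I' I(1)] \<rho>_hb by simp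
        then have "(t', i') \<in> propagated s A t"
          using A[of "ACommit t' i'"] A[of "AProp t t' i'"] S(3)[of t' i'] S(4)[of t t' i'] I' i st I(1)
          by (auto simp: propagated_def store_at_def inrange_def)
        then show ?thesis using zz st by (auto simp: cands_def store_at_def)
      qed (simp add: cands_def)
      moreover have "cokey s z' \<le> cokey s z" if z': "z' \<in> cands P s A t a" for z'
      proof (rule ccontr)
        assume gt: "\<not> cokey s z' \<le> cokey s z"
        have "0 \<le> cokey s z" using zst store_key by fastforce
        then obtain t1 i1 where z1: "z' = St t1 i1" using z' gt by (cases z') (auto simp: cands_def)
        then have st1: "store_at P s t1 i1 a" "\<rho> (t1, i1) \<le> \<rho> (t, i)" using cand_store z' i by auto
        have "coh P s z (t1, i1)" using zst st1(1) gt z1 by (auto simp: coh_def)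
        then have "((t, i), (t1, i1)) \<in> hbi P s"
          using rf st1(1) I by (intro hbiI(4)) (auto simp: store_at_def inrange_def)
        then show False using \<rho>_hb st1(2) by force
      qed
      ultimately have "is_latest P s A t a z" by (simp add: is_latest_def)
      moreover have "AFetch t i \<in> A" using A[of "AFetch t i"] S(1) I(1) i ALoad stage by simp
      moreover have "ALoad t i \<notin> A" using A[of "ALoad t i"] i ALoad by simp
      ultimately show ?thesis using ALoad I addr[OF i order.refl] a z by (auto simp: inrange_def)
    next
      case (ACommit t i)
      have I: "(t, i) \<in> ?I" and i: "ins_of b = (t, i)" using b ACommit S(3) by auto
      have C: "addr P s t i \<noteq> Some None" "is_assume (cmd_of s t i) \<longrightarrow> (\<exists>v. val P s t i = Some (Some v) \<and> v \<noteq> 0)"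
        using committed[OF I] wf unfolding wf_state_def wf_commits_def by blast+
      have nc: "ACommit t i \<notin> A" using A[of "ACommit t i"] i ACommit by simp
      have "commit_at P s A t i"
        unfolding commit_at_def addr(1)[OF i order.refl]
        using I nc C addr(2)[OF i order.refl] commit_po[OF i] deps_less[of _ s t i] A[of "AFetch t i"] A[of "ALoad t i"] S(1,2) ACommit i stage
        by (auto simp: inrange_def)
      moreover have "overtakes P s A t t i" if st: "is_store (cmd_of s t i)"
      proof (rule overt[OF i st])
        have "AProp t t i \<notin> A" using A[of "AProp t t i"] S(4) by simp
        then show "(t, i) \<notin> propagated s A t" using nc by (auto simp: propagated_def)
      qed
      ultimately show ?thesis using ACommit by simp
    next
      case (AProp t t' i')
      have I: "t < length P" "(t', i') \<in> ?I" "t \<noteq> t'" "is_store (cmd_of s t' i')" and i: "ins_of b = (t', i')"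
        using b AProp S(4) by auto
      have "ACommit t' i' \<in> A" using A[of "ACommit t' i'"] S(3) I(2) i AProp stage by simp
      moreover have "overtakes P s A t t' i'"
      proof (rule overt[OF i I(4)])
        have "AProp t t' i' \<notin> A" using A[of "AProp t t' i'"] AProp by simp
        then show "(t', i') \<notin> propagated s A t" using I(3) by (auto simp: propagated_def)
      qed
      ultimately show ?thesis using AProp I by (auto simp: inrange_def)
    qed
    then show "enabled P s ({} \<union> set (take k cs)) (cs ! k)" unfolding A' b_def .
  qed
  obtain u where u: "power_comp P (events P s cs) u" "trace_of P u = trace_of P s" "Fs u = Fs s" "Ls u = Ls s" "co u = co s" "Cs u = Cs s"
    using replay[OF val] cs S fetch_iff commit_iff load_iff by metis
  let ?es = "events P s cs"
  \<comment> \<open>Ranks do not decrease along the events, so an event between two events of one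
    instruction has the same rank and belongs to that instruction.\<close>
  have contig: "rel_instr ?es q = rel_instr ?es p"
    if pqr: "p < q" "q < r" "r < length ?es" "rel_instr ?es p = rel_instr ?es r" for p q r
  proof -
    have le: "\<rho> (rel_instr ?es p) \<le> \<rho> (rel_instr ?es q) \<and> rel_instr ?es p \<in> ?I" if "p \<le> q" "q < length ?es" for p q
    proof -
      have m: "labels P s cs ! p \<in> S" "labels P s cs ! q \<in> S"
        using set_labels[of P s cs] nth_mem[of _ "labels P s cs"] that cs by (auto simp: length_labels subset_iff)
      have "\<kappa> (labels P s cs ! p) \<le> \<kappa> (labels P s cs ! q)"
        using sorted_nth_mono[OF sorted_labels[OF so], of p q P s] that by (simp add: length_labels)
      then have "\<rho> (ins_of (labels P s cs ! p)) \<le> \<rho> (ins_of (labels P s cs ! q))"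
        using less[OF m(2,1)] by (auto simp: not_less[symmetric])
      then show ?thesis using rel_instr_label[OF val] that insS[OF m(1)] by simp
    qed
    have l: "\<rho> (rel_instr ?es p) \<le> \<rho> (rel_instr ?es q)" "rel_instr ?es p \<in> ?I"
      "\<rho> (rel_instr ?es q) \<le> \<rho> (rel_instr ?es r)" "rel_instr ?es q \<in> ?I"
      using le[of p q] le[of q r] pqr(1-3) by auto
    then have "\<rho> (rel_instr ?es q) = \<rho> (rel_instr ?es p)" using pqr(4) by simp
    then show ?thesis using \<rho>_eq[OF l(4,2)] by blast
  qed
  have props: "EProp t' t i a \<in> set ?es"
    if "is_committed_store P u t i" "addr P u t i = Some (Some a)" "t' < length P" for t i a t'
  proof -
    have ad: "addr P s t i = Some (Some a)" using that(2) addr_cong[OF u(3,4)] by metis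
    have c: "(t, i) \<in> ?I" "is_store (cmd_of s t i)"
      using that(1) u(3) by (simp_all add: is_committed_store_def inrange_def cmd_of_def)
    define b where "b = (if t' = t then ACommit t i else AProp t' t i)"
    have "b \<in> set cs" using S(3,4) cs c that(3) by (simp add: b_def)
    moreover have "EProp t' t i a \<in> set (evs P s b)" using ad c by (simp add: b_def)
    ultimately show ?thesis by auto
  qed
  have "sc_comp P ?es u"
    unfolding sc_comp_def using u(1) contig props by blast
  then show ?thesis using u(2) by blast
qed

end

section \<open>SC computations have acyclic happens-before\<close>

lemma nth_labels_offset:
  assumes "k < length bs"
  shows "length (events P s (take k bs)) < length (events P s bs)"
    "labels P s bs ! length (events P s (take k bs)) = bs ! k"
proof -
  have bs: "bs = take k bs @ bs ! k # drop (Suc k) bs" using assms by (simp add: id_take_nth_drop)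
  have e: "events P s bs = events P s (take k bs) @ evs P s (bs ! k) @ events P s (drop (Suc k) bs)"
    by (subst bs) simp
  show "length (events P s (take k bs)) < length (events P s bs)"
    unfolding e using evs_nonempty[of P s "bs ! k"] by simp
  have l: "labels P s bs = labels P s (take k bs) @ replicate (length (evs P s (bs ! k))) (bs ! k) @ labels P s (drop (Suc k) bs)"
    by (subst bs) (simp add: labels_def)
  show "labels P s bs ! length (events P s (take k bs)) = bs ! k"
    unfolding l using evs_nonempty[of P s "bs ! k"] by (simp add: nth_append length_labels[symmetric])
qed

lemma length_events_take_mono:
  assumes "i < j" "j < length bs"
  shows "length (events P s (take i bs)) < length (events P s (take j bs))"
proof -
  have "take i (take j bs) = take i bs" using assms(1) by (simp add: min_def)
  then show ?thesis using nth_labels_offset(1)[of i "take j bs" P s] assms by simp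
qed

text \<open>By atomicity, if any action of one instruction precedes any action of another, the
  commits are in the same order. The position of the commit is therefore a rank, and every
  happens-before edge raises it.\<close>

lemma sc_acyclic:
  assumes "sc_comp P es s"
  shows "\<not> cyclic_hb (trace_of P s)"
proof -
  have pc: "power_comp P es s" using assms by (simp add: sc_comp_def)
  obtain bs where "run P s bs" and es: "es = events P s bs" using power_comp_run[OF pc] by blast
  then interpret run P s bs by simp
  let ?I = "inrange P s"
  have contig: "ins_of (bs ! j) = ins_of (bs ! i)"
    if ijk: "i < j" "j < k" "k < length bs" "ins_of (bs ! i) = ins_of (bs ! k)" for i j k
  proof -
    let ?o = "\<lambda>k. length (events P s (take k bs))"
    have r: "rel_instr es (?o m) = ins_of (bs ! m)" if "m < length bs" for m
      using rel_instr_label[OF valid] nth_labels_offset[OF that, of P s] es by simp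
    have o: "?o i < ?o j" "?o j < ?o k" "?o k < length es"
      using length_events_take_mono[of i j bs P s] length_events_take_mono[of j k bs P s]
        nth_labels_offset(1)[of k bs P s] ijk es by auto
    have sc: "rel_instr es q = rel_instr es p"
      if "p < q" "q < r" "r < length es" "rel_instr es p = rel_instr es r" for p q r
      using assms that unfolding sc_comp_def by blast
    have "rel_instr es (?o i) = rel_instr es (?o k)" using r[of i] r[of k] ijk by simp
    from sc[OF o this] have "rel_instr es (?o j) = rel_instr es (?o i)" .
    then show ?thesis using r[of i] r[of j] ijk by simp
  qed
  define c where "c u = pos (ACommit (fst u) (snd u))" for u
  have cm: "ACommit (fst u) (snd u) \<in> set bs" if "u \<in> ?I" for u using that commit_iff by simp
  \<comment> \<open>Were the commit of \<open>v\<close> first, it would lie between \<open>a\<close>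
    and the commit of \<open>u\<close>, or else \<open>a\<close> would lie between the commit of
    \<open>v\<close> and \<open>b\<close>; atomicity excludes both.\<close>
  have before: "c u < c v" if ab: "a \<in> set bs" "b \<in> set bs" "ins_of a = u" "ins_of b = v" "u \<noteq> v" "pos a < pos b" for a b u v
  proof (rule ccontr)
    assume "\<not> c u < c v"
    have uv: "u \<in> ?I" "v \<in> ?I" using action_inrange ab by auto
    note cu = pos[OF cm[OF uv(1)], folded c_def] and cv = pos[OF cm[OF uv(2)], folded c_def]
    note pa = pos[OF ab(1)] and pb = pos[OF ab(2)]
    have ne: "c u \<noteq> c v" using cu(2) cv(2) ab(5) by (metis action.inject(3) prod_eq_iff)
    then have lt: "c v < c u" using \<open>\<not> c u < c v\<close> by simp
    have i: "ins_of (bs ! c u) = u" "ins_of (bs ! c v) = v" using cu(2) cv(2) by simp_all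
    show False
    proof (cases "pos a < c v")
      case True
      then show False using contig[of "pos a" "c v" "c u"] lt cu pa i ab by simp
    next
      case False
      moreover have "pos a \<noteq> c v" using pa(2) i(2) ab by metis
      ultimately show False using contig[of "c v" "pos a" "pos b"] ab pa pb i by simp
    qed
  qed
  have en: "enabled P s (set (take (pos b) bs)) b" if "b \<in> set bs" for b using en_at pos that by metis
  have tk: "pos a < pos b" if "a \<in> set (take (pos b) bs)" "b \<in> set bs" for a b
    using that pos(1)[OF that(2)] pos_nth by (auto simp: in_set_conv_nth)
  have tk': "a \<in> set (take k bs)" if "a \<in> set bs" "pos a < k" for a k
    using pos[OF that(1)] that by (metis in_set_conv_nth length_take min_less_iff_conj nth_take)
  \<comment> \<open>Here complete propagation enters: for each thread some action of the store
    brings it there, its commit if the thread is its own.\<close>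
  have prop_act: "\<exists>b\<in>set bs. ins_of b = v \<and> (\<forall>A. b \<in> A \<longrightarrow> St (fst v) (snd v) \<in> cands P s A t a)"
    if v: "store_at P s (fst v) (snd v) a" and t: "t < length P" for t v a
  proof -
    obtain t' i' where v': "v = (t', i')" by (cases v)
    have I: "(t', i') \<in> ?I" using v v' by (simp add: store_at_def inrange_def)
    have "is_committed_store P s t' i'"
      using committed[OF I] v v' by (simp add: is_committed_store_def store_at_def)
    then have "EProp t t' i' a \<in> set es" using assms v v' t by (auto simp: sc_comp_def store_at_def)
    then obtain b where b: "b \<in> set bs" "EProp t t' i' a \<in> set (evs P s b)" using es by auto
    have "b = AProp t t' i' \<or> t = t' \<and> b = ACommit t' i' \<and> is_store (cmd_of s t' i')"
      using b(2) by (cases b) (auto split: if_splits)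
    then show ?thesis using b(1) v v' by (intro bexI[of _ b]) (auto simp: cands_def propagated_def store_at_def)
  qed
  have coh_less: "c u < c v" if uv: "coh P s (St (fst u) (snd u)) v" for u v
  proof -
    obtain t i where u: "u = (t, i)" by (cases u)
    obtain t' i' where v: "v = (t', i')" by (cases v)
    obtain a where a: "store_at P s t' i' a" "store_at P s t i a" "cokey s (St t i) < cokey s (St t' i')"
      using uv u v by (auto simp: coh_def)
    have I: "(t, i) \<in> ?I" "t < length P" using a by (auto simp: store_at_def inrange_def)
    obtain b where b: "b \<in> set bs" "ins_of b = v" "\<And>A. b \<in> A \<Longrightarrow> St t' i' \<in> cands P s A t a"
      using prop_act[of v a t] a(1) v I(2) by auto
    have cb: "ACommit t i \<in> set bs" using cm[OF I(1)] by simp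
    have ne: "u \<noteq> v" using a(3) u v by auto
    show ?thesis
    proof (rule ccontr)
      \<comment> \<open>Otherwise \<open>v\<close> has reached the thread of \<open>u\<close> before
        \<open>u\<close> is committed, and its greater key blocks that commit.\<close>
      assume nl: "\<not> c u < c v"
      have "\<not> pos (ACommit t i) < pos b" using before[OF cb b(1) _ b(2) ne] nl u by auto
      moreover have "pos (ACommit t i) \<noteq> pos b"
      proof
        assume "pos (ACommit t i) = pos b"
        then have "ACommit t i = b" by (rule pos_inj[OF cb b(1)])
        then show False using b(2) ne u by force
      qed
      ultimately have "b \<in> set (take (pos (ACommit t i)) bs)" using tk' b(1) by simp
      then have "St t' i' \<in> cands P s (set (take (pos (ACommit t i)) bs)) t a" using b(3) by blast
      then show False using en[OF cb] a by (auto simp: overtakes_def store_at_def)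
    qed
  qed
  \<comment> \<open>Atomicity excludes early reads: the fetches put the commit of the earlier store
    before that of the load, whereas an early read puts the load before the commit of the
    store.\<close>
  have load: "is_latest P s (set (take (pos (ALoad t i)) bs)) t a z"
    if "reads_from P s (t, i) z" "addr P s t i = Some (Some a)" for t i a z
  proof -
    have lb: "ALoad t i \<in> set bs" using that load_iff by (simp add: reads_from_def)
    have "\<not> (\<exists>j. z = St t j \<and> early_at P s (set (take (pos (ALoad t i)) bs)) t i a j)"
    proof
      assume "\<exists>j. z = St t j \<and> early_at P s (set (take (pos (ALoad t i)) bs)) t i a j"
      then obtain j where j: "j < i" "ACommit t j \<notin> set (take (pos (ALoad t i)) bs)" by (auto simp: early_at_def)
      have I: "(t, i) \<in> ?I" "(t, j) \<in> ?I" using that(1) j(1) by (auto simp: reads_from_def inrange_def)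
      then have fb: "AFetch t i \<in> set bs" "AFetch t j \<in> set bs" "ACommit t j \<in> set bs" using fetch_iff commit_iff by auto
      have "pos (AFetch t j) < pos (AFetch t i)"
        using en[OF fb(1)] j(1) tk[OF _ fb(1), of "AFetch t j"] by auto
      then have "c (t, j) < c (t, i)" using before[OF fb(2,1)] j(1) by simp
      moreover have "pos (ALoad t i) < pos (ACommit t j)"
      proof -
        have "\<not> pos (ACommit t j) < pos (ALoad t i)" using tk'[OF fb(3)] j(2) by blast
        moreover have "pos (ACommit t j) \<noteq> pos (ALoad t i)" using pos_inj[OF fb(3) lb] by blast
        ultimately show ?thesis by simp
      qed
      then have "c (t, i) < c (t, j)" using before[OF lb fb(3)] j(1) by simp
      ultimately show False by simp
    qed
    then show ?thesis using en[OF lb] that addr_at_Some[of P s _ t i] by (fastforce simp: reads_from_def)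
  qed
  have load_addr: "\<exists>a. addr P s t i = Some (Some a) \<and> readable P s z a" if "reads_from P s (t, i) z" for t i z
    using that wf unfolding reads_from_def wf_state_def wf_loads_def by auto
  have src_less: "c u < c v" if uv: "reads_from P s v (St (fst u) (snd u))" for u v
  proof -
    obtain t i where u: "u = (t, i)" by (cases u)
    obtain t' i' where v: "v = (t', i')" by (cases v)
    obtain a where a: "addr P s t' i' = Some (Some a)" "readable P s (St t i) a" using load_addr[of t' i' "St t i"] uv u v by auto
    let ?A = "set (take (pos (ALoad t' i')) bs)"
    have lb: "ALoad t' i' \<in> set bs" using uv v load_iff by (simp add: reads_from_def)
    have "St t i \<in> cands P s ?A t' a" using load[of t' i' "St t i"] uv u v a(1) by (simp add: is_latest_def)
    then obtain b where b: "b \<in> ?A" "ins_of b = u" by (auto simp: cands_def propagated_def u)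
    have "u \<noteq> v" using a(2) uv u v by (auto simp: readable_def reads_from_def) (metis is_load.simps(2) is_store.elims(2))
    then show ?thesis using before[OF in_set_takeD[OF b(1)] lb b(2) _ _ tk[OF b(1) lb]] v by simp
  qed
  have cf_less: "c u < c v" if uv: "reads_from P s u z" "coh P s z v" for u v z
  proof -
    obtain t i where u: "u = (t, i)" by (cases u)
    obtain t' i' where v: "v = (t', i')" by (cases v)
    obtain a where a: "addr P s t i = Some (Some a)" "readable P s z a" using load_addr[of t i z] uv(1) u by auto
    have st: "store_at P s t' i' a" "cokey s z < cokey s (St t' i')"
    proof -
      have "store_at P s t' i' a \<and> (z = Init a \<or> cokey s z < cokey s (St t' i'))"
        using uv(2) a(2) v by (auto simp: coh_def readable_def store_at_def)
      moreover have "store_at P s t' i' a \<Longrightarrow> 0 < cokey s (St t' i')" using store_key by fastforce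
      ultimately show "store_at P s t' i' a" "cokey s z < cokey s (St t' i')" by auto
    qed
    have lb: "ALoad t i \<in> set bs" using uv u load_iff by (simp add: reads_from_def)
    have t: "t < length P" using uv(1) u by (simp add: reads_from_def inrange_def)
    obtain b where b: "b \<in> set bs" "ins_of b = v" "\<And>A. b \<in> A \<Longrightarrow> St t' i' \<in> cands P s A t a"
      using prop_act[of v a t] st(1) v t by auto
    have ne: "u \<noteq> v" using uv(1) st(1) u v
      by (auto simp: store_at_def reads_from_def) (metis is_load.simps(2) is_store.elims(2))
    show ?thesis
    proof (rule ccontr)
      \<comment> \<open>Otherwise \<open>v\<close> is visible when \<open>u\<close> is performed,
        and \<open>u\<close> would not have read a store of smaller key.\<close>
      assume nl: "\<not> c u < c v"
      have "\<not> pos (ALoad t i) < pos b" using before[OF lb b(1) _ b(2) ne] nl u by auto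
      moreover have "pos (ALoad t i) \<noteq> pos b"
      proof
        assume "pos (ALoad t i) = pos b"
        then have "ALoad t i = b" by (rule pos_inj[OF lb b(1)])
        then show False using b(2) ne u by force
      qed
      ultimately have "b \<in> set (take (pos (ALoad t i)) bs)" using tk' b(1) by simp
      then have "St t' i' \<in> cands P s (set (take (pos (ALoad t i)) bs)) t a" using b(3) by blast
      then show False using load[of t i z a] uv(1) a(1) u st(2) by (force simp: is_latest_def)
    qed
  qed
  \<comment> \<open>No edge leads into an initial store, so rank 0 is safe for all of them.\<close>
  define rank where "rank x = (case x of INIT _ \<Rightarrow> 0 | INS t i _ \<Rightarrow> Suc (c (t, i)))" for x :: "('a, 'b, 'c) node"
  have rank_nd: "rank (nd s t i) = Suc (c (t, i))" for t i by (simp add: rank_def nd_def)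
  have tco: "\<exists>z v. x = sid_node s z \<and> y = nd s (fst v) (snd v) \<and> coh P s z v" if "(x, y) \<in> tco (trace_of P s)" for x y
  proof -
    have "(\<exists>a t i. x = INIT a \<and> y = nd s t i \<and> store_at P s t i a) \<or>
       (\<exists>t i t' i' a. x = nd s t i \<and> y = nd s t' i' \<and> store_at P s t i a \<and> store_at P s t' i' a \<and>
          cokey s (St t i) < cokey s (St t' i'))"
      using that by (simp add: trace_of_def Let_def)
    then show ?thesis
    proof (elim disjE exE conjE)
      fix a t i assume "x = INIT a" "y = nd s t i" "store_at P s t i a"
      then show ?thesis by (intro exI[of _ "Init a"] exI[of _ "(t, i)"]) (auto simp: coh_def)
    next
      fix t i t' i' a
      assume "x = nd s t i" "y = nd s t' i'" "store_at P s t i a" "store_at P s t' i' a"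
        "cokey s (St t i) < cokey s (St t' i')"
      then show ?thesis by (intro exI[of _ "St t i"] exI[of _ "(t', i')"]) (auto simp: coh_def)
    qed
  qed
  have tsrc: "\<exists>z v. x = sid_node s z \<and> y = nd s (fst v) (snd v) \<and> reads_from P s v z" if "(x, y) \<in> tsrc (trace_of P s)" for x y
    using that unfolding trace_of_def Let_def reads_from_def inrange_def by fastforce
  have sid_inj: "z = z'" if "sid_node s z = sid_node s z'" for z z'
    using that by (cases z; cases z') (auto simp: nd_def)
  have up: "rank x < rank y" if xy: "(x, y) \<in> hb (trace_of P s)" for x y
  proof -
    consider "(x, y) \<in> tpo (trace_of P s)" | "(x, y) \<in> tco (trace_of P s)" | "(x, y) \<in> tsrc (trace_of P s)" | "(x, y) \<in> tcf (trace_of P s)"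
      using xy by (auto simp: hb_def)
    then show ?thesis
    proof cases
      case 1
      then obtain t i where ti: "x = nd s t i" "y = nd s t (Suc i)" "t < length P" "Suc i < length (Fs s t)"
        unfolding trace_of_def Let_def by auto
      have fb: "AFetch t i \<in> set bs" "AFetch t (Suc i) \<in> set bs" using ti fetch_iff by (auto simp: inrange_def)
      have "pos (AFetch t i) < pos (AFetch t (Suc i))"
        using en[OF fb(2)] tk[OF _ fb(2), of "AFetch t i"] by auto
      then show ?thesis using before[OF fb] ti(1,2) by (simp add: rank_nd)
    next
      case 2
      then obtain z v where z: "x = sid_node s z" "y = nd s (fst v) (snd v)" "coh P s z v" using tco by blast
      show ?thesis
      proof (cases z)
        case (St t i)
        then show ?thesis using coh_less[of "(t, i)" v] z by (simp add: rank_nd)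
      qed (use z in \<open>simp add: rank_nd, simp add: rank_def\<close>)
    next
      case 3
      then obtain z v where z: "x = sid_node s z" "y = nd s (fst v) (snd v)" "reads_from P s v z" using tsrc by blast
      show ?thesis
      proof (cases z)
        case (St t i)
        then show ?thesis using src_less[of v "(t, i)"] z by (simp add: rank_nd)
      qed (use z in \<open>simp add: rank_nd, simp add: rank_def\<close>)
    next
      case 4
      then obtain w where w: "(w, x) \<in> tsrc (trace_of P s)" "(w, y) \<in> tco (trace_of P s)"
        unfolding tcf_iff by blast
      obtain z u where z: "w = sid_node s z" "x = nd s (fst u) (snd u)" "reads_from P s u z" using tsrc[OF w(1)] by blast
      obtain z' v where z': "w = sid_node s z'" "y = nd s (fst v) (snd v)" "coh P s z' v" using tco[OF w(2)] by blast
      \<comment> \<open>A node determines its store, so the source and the coherence edge behind a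
        conflict share the same store.\<close>
      have "z' = z" using z(1) z'(1) sid_inj by metis
      then show ?thesis using cf_less[OF z(3)] z z' by (simp add: rank_nd)
    qed
  qed
  have "(x, y) \<in> (hb (trace_of P s))\<^sup>+ \<Longrightarrow> rank x < rank y" for x y
    by (induction rule: trancl_induct) (auto dest: up)
  then show ?thesis unfolding cyclic_hb_def by (metis less_irrefl)
qed

section \<open>Deleting an instruction\<close>

lemma hbi_cong:
  assumes "Fs u = Fs s" "Ls u = Ls s" "co u = co s"
  shows "hbi P u = hbi P s" "inrange P u = inrange P s"
proof -
  show i: "inrange P u = inrange P s" by (simp add: inrange_def assms(1))
  have st: "store_at P u = store_at P s"
    by (intro ext) (simp only: store_at_def addr_cong[OF assms(1,2)] cmd_of_def assms(1))
  have c: "coh P u = coh P s" by (intro ext) (simp only: coh_def st cokey_cong[OF assms(3)])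
  have r: "reads_from P u = reads_from P s"
    by (intro ext) (simp only: reads_from_def i cmd_of_def assms)
  show "hbi P u = hbi P s" unfolding hbi_def i c r ..
qed

lemma expr_known_at_mono: "expr_known s (loads_in A) t i eo \<Longrightarrow> A \<subseteq> B \<Longrightarrow> expr_known s (loads_in B) t i eo"
  by (erule expr_known_mono) (auto simp: loads_in_def)

lemma addr_at_mono: "addr_at P s A t i \<noteq> Some None \<Longrightarrow> A \<subseteq> B \<Longrightarrow> addr_at P s B t i \<noteq> Some None"
  using expr_known_at_mono[of s A t i _ B] by (auto simp: addr_at_def split: if_splits)

lemma val_known_at_mono: "val_known_at s A t i \<Longrightarrow> A \<subseteq> B \<Longrightarrow> val_known_at s B t i"
  using expr_known_at_mono by (auto simp: val_known_at_def)

section \<open>Reads, candidates and action counts in a complete run\<close>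

context run
begin

lemma commit_at_before:
  assumes "ACommit t i \<in> set (take k bs)"
  shows "addr_at P s (set (take k bs)) t i \<noteq> Some None" "val_known_at s (set (take k bs)) t i"
proof -
  obtain m where m: "m < length bs" "m < k" "bs ! m = ACommit t i"
    using assms by (auto simp: in_set_conv_nth)
  have "commit_at P s (set (take m bs)) t i" using en_at[OF m(1)] m(3) by simp
  then have c: "addr_at P s (set (take m bs)) t i \<noteq> Some None" "val_known_at s (set (take m bs)) t i"
    by (simp_all add: commit_at_def)
  have sub: "set (take m bs) \<subseteq> set (take k bs)" using m(2) by (simp add: set_take_subset_set_take)
  show "addr_at P s (set (take k bs)) t i \<noteq> Some None" by (rule addr_at_mono[OF c(1) sub])
  show "val_known_at s (set (take k bs)) t i" by (rule val_known_at_mono[OF c(2) sub])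
qed

lemma cands_committed:
  assumes "St t' i' \<in> cands P s (set (take k bs)) t a"
  shows "ACommit t' i' \<in> set (take k bs)"
  using assms commit_before_prop by (auto simp: cands_def propagated_def)

lemma load_cases:
  assumes "k < length bs" "bs ! k = ALoad t i"
  obtains a z where "addr P s t i = Some (Some a)" "Ls s t i = Some z"
    "is_latest P s (set (take k bs)) t a z \<or> (\<exists>j. z = St t j \<and> early_at P s (set (take k bs)) t i a j)"
proof -
  obtain a z where "addr_at P s (set (take k bs)) t i = Some (Some a)" "Ls s t i = Some z"
    "is_latest P s (set (take k bs)) t a z \<or> (\<exists>j. z = St t j \<and> early_at P s (set (take k bs)) t i a j)"
    using en_at[OF assms(1)] assms(2) by auto
  then show thesis using that addr_at_Some by blast
qed

text \<open>A store found in memory is committed, and an early read checks the value. The prefix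
  ends just before the load, which allows induction on prefixes to follow a read into another
  thread.\<close>

lemma read_val_known:
  assumes "k < length bs" "bs ! k = ALoad t i" "Ls s t i = Some (St t' i')"
  shows "val_known_at s (set (take k bs)) t' i'"
proof -
  obtain a z where "Ls s t i = Some z"
    "is_latest P s (set (take k bs)) t a z \<or> (\<exists>j. z = St t j \<and> early_at P s (set (take k bs)) t i a j)"
    by (rule load_cases[OF assms(1,2)])
  then have "is_latest P s (set (take k bs)) t a (St t' i') \<or>
      (\<exists>j. St t' i' = St t j \<and> early_at P s (set (take k bs)) t i a j)"
    unfolding assms(3) by auto
  then show ?thesis
  proof (elim disjE exE conjE)
    assume "is_latest P s (set (take k bs)) t a (St t' i')"
    then have "ACommit t' i' \<in> set (take k bs)" unfolding is_latest_def by (blast intro: cands_committed)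
    then show ?thesis by (rule commit_at_before(2))
  next
    fix j assume "St t' i' = St t j" "early_at P s (set (take k bs)) t i a j"
    then show ?thesis by (simp add: early_at_def)
  qed
qed

lemma load_index:
  assumes "(t, i) \<in> inrange P s" "is_load (cmd_of s t i)"
  obtains k where "k < length bs" "bs ! k = ALoad t i"
  using load_iff[of t i] assms in_set_conv_nth[of "ALoad t i" bs] by blast

text \<open>A store that was read early is committed in the end and thereby propagated to its own
  thread, so it too is a final candidate.\<close>

lemma load_facts:
  assumes "(t, i) \<in> inrange P s" "is_load (cmd_of s t i)"
  obtains a z where "addr P s t i = Some (Some a)" "Ls s t i = Some z" "z \<in> cands P s (set bs) t a"
proof -
  obtain k where k: "k < length bs" "bs ! k = ALoad t i" using load_index[OF assms] .
  obtain a z where a: "addr P s t i = Some (Some a)" "Ls s t i = Some z"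
    and rd: "is_latest P s (set (take k bs)) t a z \<or> (\<exists>j. z = St t j \<and> early_at P s (set (take k bs)) t i a j)"
    by (rule load_cases[OF k])
  have "z \<in> cands P s (set bs) t a"
    using rd
  proof (elim disjE exE conjE)
    assume "is_latest P s (set (take k bs)) t a z"
    then show ?thesis using cands_mono[OF take_subset, of P s k t a] by (auto simp: is_latest_def)
  next
    fix j assume z: "z = St t j" and e: "early_at P s (set (take k bs)) t i a j"
    then have "j < i" "is_store (cmd_of s t j)" "addr P s t j = Some (Some a)"
      using addr_at_Some[of P s _ t j a] by (auto simp: early_at_def)
    moreover from this have "(t, j) \<in> inrange P s" using assms(1) by (auto simp: inrange_def)
    ultimately show ?thesis using z commit_iff by (auto simp: cands_def propagated_def)
  qed
  then show thesis using that a by blast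
qed

lemma final_load_load:
  assumes "(t, i) \<in> inrange P s" "i' < i" "is_load (cmd_of s t i')" "is_load (cmd_of s t i)"
    "addr P s t i' = Some (Some a)" "addr P s t i = Some (Some a)"
  shows "cokey s (the (Ls s t i')) \<le> cokey s (the (Ls s t i))"
  using fin[unfolded final_def, THEN conjunct2, THEN conjunct1, rule_format, of t i' i a] assms
  by (simp add: inrange_def)

lemma final_store_load:
  assumes "(t, i) \<in> inrange P s" "i' < i" "store_at P s t i' a" "is_load (cmd_of s t i)" "addr P s t i = Some (Some a)"
  shows "cokey s (St t i') \<le> cokey s (the (Ls s t i))"
  using fin[unfolded final_def, THEN conjunct2, THEN conjunct2, rule_format, of t i' i a] assms
  by (simp add: inrange_def store_at_def)

lemma own_store_cand: "store_at P s t i a \<Longrightarrow> St t i \<in> cands P s (set bs) t a"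
  using commit_iff[of t i] by (auto simp: cands_def propagated_def store_at_def inrange_def)

lemma finite_cands:
  assumes "A \<subseteq> set bs"
  shows "finite (cands P s A t a)"
proof (rule finite_subset)
  show "cands P s A t a \<subseteq> insert (Init a) ((\<lambda>(t, i). St t i) ` inrange P s)"
  proof
    fix z assume z: "z \<in> cands P s A t a"
    show "z \<in> insert (Init a) ((\<lambda>(t, i). St t i) ` inrange P s)"
    proof (cases z)
      case (St t' i')
      then have "(t', i') \<in> inrange P s" using cands_store z assms by (fastforce simp: store_at_def inrange_def)
      then show ?thesis using St by (auto intro: image_eqI[where x = "(t', i')"])
    qed (use z in \<open>auto simp: cands_def\<close>)
  qed
qed simp

text \<open>A store has its commit, which covers its own thread, and at most |P| - 1 propagations.
  Any other instruction has at most a load and a commit, within the bound because there is at least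
  one thread.\<close>

lemma card_actions_of:
  assumes "x \<in> inrange P s"
  shows "card {b \<in> set bs. (\<forall>t i. b \<noteq> AFetch t i) \<and> ins_of b = x} \<le> length P + 1" (is "card ?X \<le> _")
proof -
  obtain t i where x: "x = (t, i)" by (cases x)
  have t: "t < length P" using assms x by (simp add: inrange_def)
  show ?thesis
  proof (cases "is_store (cmd_of s t i)")
    case True
    then have nl: "\<not> is_load (cmd_of s t i)" by (cases "cmd_of s t i") auto
    have "?X \<subseteq> insert (ACommit t i) ((\<lambda>t'. AProp t' t i) ` ({..<length P} - {t}))"
    proof
      fix b assume b: "b \<in> ?X"
      show "b \<in> insert (ACommit t i) ((\<lambda>t'. AProp t' t i) ` ({..<length P} - {t}))"
      proof (cases b)
        case (AProp t' t1 i1)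
        then show ?thesis using b x prop_in[of t' t1 i1] by auto
      qed (use b x nl load_iff in auto)
    qed
    then have "card ?X \<le> card (insert (ACommit t i) ((\<lambda>t'. AProp t' t i) ` ({..<length P} - {t})))"
      by (rule card_mono[rotated]) simp
    also have "\<dots> \<le> Suc (card ((\<lambda>t'. AProp t' t i) ` ({..<length P} - {t})))"
      by (rule card_insert_le_m1) simp_all
    also have "\<dots> \<le> Suc (card ({..<length P} - {t}))" by (simp add: card_image_le)
    also have "\<dots> \<le> length P + 1" by (simp add: card_Diff_singleton_if)
    finally show ?thesis .
  next
    case False
    have "?X \<subseteq> {ALoad t i, ACommit t i}"
    proof
      fix b assume b: "b \<in> ?X"
      show "b \<in> {ALoad t i, ACommit t i}"
      proof (cases b)
        case (AProp t' t1 i1)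
        then show ?thesis using b x prop_in(3)[of t' t1 i1] False by auto
      qed (use b x in auto)
    qed
    then have "card ?X \<le> card {ALoad t i, ACommit t i}" by (rule card_mono[rotated]) simp
    then show ?thesis using t by simp
  qed
qed

end

text \<open>Loads that read from the deleted instruction are redirected to the store they would find
  propagated otherwise. This may change values, but no address and no assumed condition,
  because those are already determined by the first \<open>T\<close> actions.\<close>

locale deletion = run P s bs for P :: "('q, 'd::zero, 'r) program" and s :: "('q, 'd, 'r) pstate" and bs :: "action list" +
  fixes xt xi T :: nat
  assumes x: "(xt, xi) \<in> inrange P s" and last: "length (Fs s xt) = Suc xi"
    and unread: "\<And>t i. ALoad t i \<in> set (take T bs) \<Longrightarrow> Ls s t i \<noteq> Some (St xt xi)"
    and known_addr: "\<And>t i. (t, i) \<in> inrange P s \<Longrightarrow> (t, i) \<noteq> (xt, xi) \<Longrightarrow> addr_at P s (set (take T bs)) t i \<noteq> Some None"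
    and known_assume: "\<And>t i. (t, i) \<in> inrange P s \<Longrightarrow> (t, i) \<noteq> (xt, xi) \<Longrightarrow> is_assume (cmd_of s t i) \<Longrightarrow>
      val_known_at s (set (take T bs)) t i"
begin

definition xa :: 'd where
  "xa = the (the (addr P s xt xi))"

definition below :: "nat \<Rightarrow> 'd sid set" where
  "below t = {z \<in> cands P s (set bs) t xa. cokey s z < cokey s (St xt xi)}"

text \<open>The store that thread \<open>t\<close> finds if x is ignored. It depends on the thread,
  as threads may have received different stores, but not on the moment, by
  \<open>below_stable\<close>.\<close>

definition pred_store :: "nat \<Rightarrow> 'd sid" where
  "pred_store t = (SOME z. z \<in> below t \<and> (\<forall>z'\<in>below t. cokey s z' \<le> cokey s z))"

text \<open>The state aimed at by the run without x. Its \<open>prp\<close> may still name x, which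
  does no harm because a replay recovers \<open>prp\<close> from the candidates.\<close>

definition s' :: "('q, 'd, 'r) pstate" where
  "s' = s\<lparr>Fs := (Fs s)(xt := butlast (Fs s xt)), Cs := (Cs s)(xt := Cs s xt - {xi}),
     Ls := (\<lambda>t i. if (t, i) = (xt, xi) then None
        else if Ls s t i = Some (St xt xi) then Some (pred_store t) else Ls s t i),
     co := (co s)((xt, xi) := None)\<rparr>"

lemma sel:
  "Fs s' = (Fs s)(xt := butlast (Fs s xt))" "Cs s' = (Cs s)(xt := Cs s xt - {xi})"
  "Ls s' t i = (if (t, i) = (xt, xi) then None
        else if Ls s t i = Some (St xt xi) then Some (pred_store t) else Ls s t i)"
  "co s' = (co s)((xt, xi) := None)"
  by (simp_all add: s'_def)

lemma length_Fs': "length (Fs s' t) = (if t = xt then xi else length (Fs s t))"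
  using last by (simp add: sel)

lemma inrange': "inrange P s' = inrange P s - {(xt, xi)}"
  using last x by (auto simp: inrange_def length_Fs' split: if_splits)

lemma nth_Fs': "i < length (Fs s' t) \<Longrightarrow> Fs s' t ! i = Fs s t ! i"
  by (auto simp: sel nth_butlast split: if_splits)

lemma cmd': "i < length (Fs s' t) \<Longrightarrow> cmd_of s' t i = cmd_of s t i"
  by (simp add: cmd_of_def nth_Fs')

lemma lw': "i \<le> length (Fs s' t) \<Longrightarrow> last_writer s' t i r = last_writer s t i r"
  by (rule last_writer_cong) (simp add: cmd')

lemma not_x: "i < length (Fs s' t) \<Longrightarrow> (t, i) \<noteq> (xt, xi)"
  by (auto simp: length_Fs')

lemma cokey': "z \<noteq> St xt xi \<Longrightarrow> cokey s' z = cokey s z"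
  by (cases z) (auto simp: sel)

lemma x_store:
  assumes "is_store (cmd_of s xt xi)"
  shows "store_at P s xt xi xa"
  using store_addr[OF x assms] by (auto simp: xa_def store_at_def)

lemma read_x_store:
  assumes "Ls s t i = Some (St xt xi)"
  shows "store_at P s xt xi xa" "addr P s t i = Some (Some xa)"
proof -
  have "is_store (cmd_of s xt xi)" "addr P s t i = addr P s xt xi"
    using wf assms unfolding wf_state_def wf_loads_def readable_def by fastforce+
  then show "store_at P s xt xi xa" "addr P s t i = Some (Some xa)"
    using x_store by (auto simp: store_at_def)
qed

lemma pred_store:
  assumes "store_at P s xt xi xa"
  shows "pred_store t \<in> below t" "z \<in> below t \<Longrightarrow> cokey s z \<le> cokey s (pred_store t)"
proof -
  have "Init xa \<in> below t" using store_key[OF assms] by (auto simp: below_def cands_def)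
  moreover have fin: "finite (below t)" using finite_cands[of "set bs" t xa] by (simp add: below_def)
  ultimately have "Max (cokey s ` below t) \<in> cokey s ` below t" by (intro Max_in) auto
  then obtain y where "y \<in> below t" "cokey s y = Max (cokey s ` below t)" by auto
  then have "y \<in> below t \<and> (\<forall>z'\<in>below t. cokey s z' \<le> cokey s y)" using fin by simp
  then have "pred_store t \<in> below t \<and> (\<forall>z'\<in>below t. cokey s z' \<le> cokey s (pred_store t))"
    unfolding pred_store_def by (rule someI)
  then show "pred_store t \<in> below t" "z \<in> below t \<Longrightarrow> cokey s z \<le> cokey s (pred_store t)" by auto
qed

lemma pred_store_neq: "store_at P s xt xi xa \<Longrightarrow> pred_store t \<noteq> St xt xi"
  using pred_store(1)[of t] by (auto simp: below_def)

lemma pred_store_cases: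
  assumes "store_at P s xt xi xa"
  shows "pred_store t = Init xa \<or> (\<exists>t' i'. pred_store t = St t' i' \<and> store_at P s t' i' xa)"
  using pred_store(1)[OF assms, of t] cands_store[of _ _ "set bs" t xa]
  by (cases "pred_store t") (auto simp: below_def cands_def)

lemma reads_inrange': "reads_inrange P s'"
  unfolding reads_inrange_def
proof (intro allI impI)
  fix t i t' i' assume L: "Ls s' t i = Some (St t' i')"
  show "(t', i') \<in> inrange P s'"
  proof (cases "Ls s t i = Some (St xt xi)")
    case True
    then have "pred_store t = St t' i'" using L by (auto simp: sel split: if_splits)
    moreover note st = read_x_store(1)[OF True]
    ultimately have "store_at P s t' i' xa" "(t', i') \<noteq> (xt, xi)"
      using pred_store_cases[OF st, of t] pred_store_neq[OF st, of t] by auto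
    then show ?thesis unfolding inrange' by (auto simp: store_at_def inrange_def)
  next
    case False
    then have "Ls s t i = Some (St t' i')" using L by (auto simp: sel split: if_splits)
    moreover from this have "(t', i') \<in> inrange P s"
      using wf_state_reads_inrange[OF wf] by (auto simp: reads_inrange_def)
    ultimately show ?thesis using False by (auto simp: inrange')
  qed
qed

text \<open>The outer induction is on the length of the prefix, the inner one on the reason why the
  register is known. A load in the prefix does not read x, so its entry in \<open>Ls\<close> is
  unchanged; the value of the store it reads was known when it was performed, that is, after a
  strictly shorter prefix.\<close>

lemma RV':
  assumes "m \<le> T" "t < length P"
  shows "reg_known s (loads_in (set (take m bs))) t i r \<Longrightarrow> i \<le> length (Fs s' t) \<Longrightarrow> RV P s' t i r = RV P s t i r"
  using assms
proof (induction m arbitrary: t i r rule: less_induct)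
  case (less m)
  show ?case using less.prems
  proof (induction rule: reg_known.induct)
    case (unwritten i r)
    have i: "i \<le> length (Fs s t)" using unwritten.prems(1) by (auto simp: length_Fs' last split: if_splits)
    show ?case
      using RV_fix[OF reads_inrange' \<open>t < length P\<close> unwritten.prems(1), of r] RV_fix[OF wf_state_reads_inrange[OF wf] \<open>t < length P\<close> i, of r]
        unwritten lw'[OF unwritten.prems(1)] by (simp add: reg_step_def)
  next
    case (assigned i r j r' e)
    have i: "i \<le> length (Fs s t)" using assigned.prems(1) by (auto simp: length_Fs' last split: if_splits)
    have j: "j < i" using last_writer_Some(1) assigned.hyps(1) by fast
    then have j': "j < length (Fs s' t)" using assigned.prems(1) by simp
    have "eval (RV P s' t j) e = eval (RV P s t j) e"
      by (rule eval_cong) (use assigned.IH assigned.prems j' in auto)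
    then show ?case
      using RV_fix[OF reads_inrange' \<open>t < length P\<close> assigned.prems(1), of r] RV_fix[OF wf_state_reads_inrange[OF wf] \<open>t < length P\<close> i, of r]
        assigned.hyps(1,2) lw'[OF assigned.prems(1)] cmd'[OF j'] by (simp add: reg_step_def)
  next
    case (loaded i r j)
    have i: "i \<le> length (Fs s t)" using loaded.prems(1) by (auto simp: length_Fs' last split: if_splits)
    have j: "j < i" using last_writer_Some(1) loaded.hyps(1) by fast
    then have j': "j < length (Fs s' t)" using loaded.prems(1) by simp
    have "ALoad t j \<in> set (take m bs)" using loaded.hyps(3) by (simp add: loads_in_def)
    then obtain k where k: "k < length bs" "k < m" "bs ! k = ALoad t j" by (auto simp: in_set_conv_nth)
    have "ALoad t j \<in> set (take T bs)"
      using \<open>ALoad t j \<in> set (take m bs)\<close> set_take_subset_set_take[OF \<open>m \<le> T\<close>, of bs] by blast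
    then have L: "Ls s' t j = Ls s t j" using unread not_x[OF j'] by (auto simp: sel)
    obtain z where z: "Ls s t j = Some z" by (rule load_cases[OF k(1,3)])
    obtain r' e where c: "cmd_of s t j = CLoad r' e" using loaded.hyps(2) by (cases "cmd_of s t j") auto
    have "reg_step s' (RV P s') t i r = reg_step s (RV P s) t i r"
    proof (cases z)
      case (Init a)
      then show ?thesis
        using loaded.hyps(1) lw'[OF loaded.prems(1)] cmd'[OF j'] c L z by (simp add: reg_step_def)
    next
      case (St t' i')
      have "(t', i') \<in> inrange P s'" using reads_inrange' L z St by (auto simp: reads_inrange_def)
      then have i': "t' < length P" "i' < length (Fs s' t')" by (simp_all add: inrange_def)
      have v: "val_known_at s (set (take k bs)) t' i'" using read_val_known[OF k(1,3)] z St by simp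
      have "eval (RV P s' t' i') e' = eval (RV P s t' i') e'" if "val_expr (cmd_of s t' i') = Some e'" for e'
      proof (rule eval_cong)
        fix q assume "q \<in> regs e'"
        then have "reg_known s (loads_in (set (take k bs))) t' i' q"
          using v that by (auto simp: val_known_at_def expr_known_def)
        then show "RV P s' t' i' q = RV P s t' i' q"
          using less.IH[OF k(2), of t' i' q] i' k(2) \<open>m \<le> T\<close> by simp
      qed
      then show ?thesis
        using loaded.hyps(1) lw'[OF loaded.prems(1)] cmd'[OF j'] cmd'[OF i'(2)] c L z St
        by (auto simp: reg_step_def split: cmd.split)
    qed
    then show ?case
      using RV_fix[OF reads_inrange' \<open>t < length P\<close> loaded.prems(1), of r] RV_fix[OF wf_state_reads_inrange[OF wf] \<open>t < length P\<close> i, of r]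
      by simp
  qed
qed

lemma ev_expr':
  assumes "expr_known s (loads_in (set (take T bs))) t i (Some e)" "t < length P" "i \<le> length (Fs s' t)"
  shows "ev_expr P s' t i e = ev_expr P s t i e"
  unfolding ev_expr_RV
  by (rule eval_cong) (use assms RV'[OF order.refl assms(2)] in \<open>auto simp: expr_known_def\<close>)

lemma addr':
  assumes "(t, i) \<in> inrange P s'"
  shows "addr P s' t i = addr P s t i"
proof -
  have r: "t < length P" "i < length (Fs s' t)" using assms by (simp_all add: inrange_def)
  have k: "addr_at P s (set (take T bs)) t i \<noteq> Some None" using known_addr assms by (simp add: inrange')
  show ?thesis
  proof (cases "addr_expr (cmd_of s t i)")
    case None
    then show ?thesis using cmd'[OF r(2)] by (simp add: addr_def)
  next
    case (Some e)
    then have "expr_known s (loads_in (set (take T bs))) t i (Some e)"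
      using k by (auto simp: addr_at_def split: if_splits)
    then show ?thesis using ev_expr'[of t i e] r Some cmd'[OF r(2)] by (simp add: addr_def)
  qed
qed

lemma val_assume':
  assumes "(t, i) \<in> inrange P s'" "is_assume (cmd_of s t i)"
  shows "val P s' t i = val P s t i"
proof -
  have r: "t < length P" "i < length (Fs s' t)" using assms by (simp_all add: inrange_def)
  have k: "val_known_at s (set (take T bs)) t i" using known_assume assms by (simp add: inrange')
  obtain e where e: "val_expr (cmd_of s t i) = Some e" using assms(2) by (cases "cmd_of s t i") auto
  then have "expr_known s (loads_in (set (take T bs))) t i (Some e)"
    using k by (simp add: val_known_at_def)
  then show ?thesis using ev_expr'[of t i e] r e cmd'[OF r(2)] by (simp add: val_def)
qed

lemma store_at': "store_at P s' t i a \<longleftrightarrow> store_at P s t i a \<and> (t, i) \<noteq> (xt, xi)"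
proof (cases "(t, i) \<in> inrange P s'")
  case True
  then have "t < length P" "i < length (Fs s' t)" "i < length (Fs s t)" "(t, i) \<noteq> (xt, xi)"
    by (simp_all add: inrange_def length_Fs' last split: if_splits)
  then show ?thesis using addr'[OF True] cmd'[of i t] by (simp add: store_at_def)
next
  case False
  then have "\<not> store_at P s' t i a" unfolding store_at_def inrange_def by blast
  moreover have "\<not> (store_at P s t i a \<and> (t, i) \<noteq> (xt, xi))"
    using False unfolding inrange' unfolding store_at_def inrange_def by blast
  ultimately show ?thesis by blast
qed

abbreviation X :: "action set" where "X \<equiv> {b. ins_of b = (xt, xi)}"

text \<open>x is the last instruction of its thread, so no remaining expression refers to it through
  registers.\<close>

lemma expr_known':
  assumes "i \<le> length (Fs s' t)"
  shows "expr_known s' (loads_in (A - X)) t i eo \<longleftrightarrow> expr_known s (loads_in A) t i eo"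
proof
  have c: "cmd_of s' t j = cmd_of s t j" "(t, j) \<noteq> (xt, xi)" if "j < i" for j
    using cmd'[of j t] not_x[of j t] assms that by auto
  show "expr_known s (loads_in A) t i eo" if "expr_known s' (loads_in (A - X)) t i eo"
    using that by (rule expr_known_mono) (use c in \<open>auto simp: loads_in_def\<close>)
  show "expr_known s' (loads_in (A - X)) t i eo" if "expr_known s (loads_in A) t i eo"
    using that by (rule expr_known_mono) (use c in \<open>auto simp: loads_in_def\<close>)
qed

lemma addr_at':
  assumes "(t, i) \<in> inrange P s'"
  shows "addr_at P s' (A - X) t i = addr_at P s A t i"
  using addr'[OF assms] expr_known'[of i t A] cmd'[of i t] assms by (simp add: addr_at_def inrange_def)

lemma val_known_at':
  assumes "(t, i) \<in> inrange P s'"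
  shows "val_known_at s' (A - X) t i \<longleftrightarrow> val_known_at s A t i"
  using expr_known'[of i t A] cmd'[of i t] assms by (simp add: val_known_at_def inrange_def)

lemma propagated':
  assumes "A \<subseteq> set bs"
  shows "propagated s' (A - X) t = propagated s A t - {(xt, xi)}"
proof -
  have c: "cmd_of s' t i = cmd_of s t i" if "ACommit t i \<in> A" "(t, i) \<noteq> (xt, xi)" for t i
  proof -
    have "(t, i) \<in> inrange P s'" unfolding inrange' using that assms commit_iff[of t i] by blast
    then show ?thesis using cmd'[of i t] by (simp add: inrange_def)
  qed
  have "w \<in> propagated s' (A - X) t \<longleftrightarrow> w \<in> propagated s A t - {(xt, xi)}" for w
  proof (cases "w = (xt, xi)")
    case True
    then show ?thesis by (simp add: propagated_def)
  next
    case False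
    obtain t' i' where w: "w = (t', i')" by (cases w)
    have n: "(t', i') \<noteq> (xt, xi)" using False w by simp
    have "w \<in> propagated s' (A - X) t \<longleftrightarrow> AProp t t' i' \<in> A \<or> t' = t \<and> ACommit t' i' \<in> A \<and> is_store (cmd_of s' t' i')"
      using n by (auto simp: propagated_def w)
    also have "\<dots> \<longleftrightarrow> w \<in> propagated s A t - {(xt, xi)}"
      using c[OF _ n] n by (auto simp: propagated_def w)
    finally show ?thesis .
  qed
  then show ?thesis by blast
qed

lemma cands':
  assumes "A \<subseteq> set bs"
  shows "cands P s' (A - X) t a = cands P s A t a - {St xt xi}"
proof -
  have "addr P s' t' i' = addr P s t' i'" if "(t', i') \<in> propagated s A t" "(t', i') \<noteq> (xt, xi)" for t' i'
  proof -
    have "(t', i') \<in> inrange P s"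
      using that(1) assms prop_in(2) commit_iff by (auto simp: propagated_def)
    then show ?thesis using addr' that(2) by (simp add: inrange')
  qed
  then have "St t' i' \<in> cands P s' (A - X) t a \<longleftrightarrow> St t' i' \<in> cands P s A t a - {St xt xi}" for t' i'
    by (auto simp: cands_def propagated'[OF assms])
  moreover have "Init a' \<in> cands P s' (A - X) t a \<longleftrightarrow> Init a' \<in> cands P s A t a - {St xt xi}" for a'
    by (simp add: cands_def)
  ultimately have "z \<in> cands P s' (A - X) t a \<longleftrightarrow> z \<in> cands P s A t a - {St xt xi}" for z
    by (cases z) blast+
  then show ?thesis by blast
qed

lemma overtakes':
  assumes "overtakes P s A t t' i'" "A \<subseteq> set bs" "(t', i') \<in> inrange P s'"
  shows "overtakes P s' (A - X) t t' i'"
proof -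
  have n: "(t', i') \<noteq> (xt, xi)" using assms(3) by (simp add: inrange')
  have c: "co s' (t', i') = co s (t', i')" unfolding sel using n by (rule fun_upd_other)
  obtain a where a: "co s (t', i') \<noteq> None" "addr P s t' i' = Some (Some a)"
    "\<forall>z\<in>cands P s A t a. cokey s z < cokey s (St t' i')"
    using assms(1) unfolding overtakes_def by blast
  have "cokey s' z < cokey s' (St t' i')" if "z \<in> cands P s' (A - X) t a" for z
    using that a(3) cokey'[of z] c unfolding cands'[OF assms(2)] by simp
  then show ?thesis
    using a(1,2) unfolding overtakes_def addr'[OF assms(3)] c by blast
qed

text \<open>Stores to an address reach a thread in the order of increasing keys. Once x has arrived,
  nothing of smaller key can follow, so whatever is below x at the end is present already.\<close>

lemma below_stable:
  assumes "St xt xi \<in> cands P s (set (take k bs)) t xa" "z \<in> below t"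
  shows "z \<in> cands P s (set (take k bs)) t xa"
proof (rule ccontr)
  assume nz: "z \<notin> cands P s (set (take k bs)) t xa"
  have z: "z \<in> cands P s (set bs) t xa" "cokey s z < cokey s (St xt xi)" using assms(2) by (auto simp: below_def)
  then obtain t' i' where zz: "z = St t' i'" using nz by (cases z) (auto simp: cands_def)
  have ad: "addr P s t' i' = Some (Some xa)" using z(1) zz by (auto simp: cands_def)
  consider "AProp t t' i' \<in> set bs" | "t' = t" "ACommit t i' \<in> set bs" "is_store (cmd_of s t i')"
    using z(1) zz by (auto simp: cands_def propagated_def)
  then obtain b where b: "b \<in> set bs" "b = AProp t t' i' \<or> t' = t \<and> b = ACommit t i' \<and> is_store (cmd_of s t i')"
    by cases auto
  then obtain m where m: "m < length bs" "bs ! m = b" by (auto simp: in_set_conv_nth)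
  have en: "enabled P s (set (take m bs)) b" using en_at m by auto
  have "overtakes P s (set (take m bs)) t t' i'" using b(2) en by auto
  then have ov: "\<forall>z'\<in>cands P s (set (take m bs)) t xa. cokey s z' < cokey s z" using ad zz by (auto simp: overtakes_def)
  have "k \<le> m"
  proof (rule ccontr)
    assume "\<not> k \<le> m"
    then have "b \<in> set (take k bs)" using m by (auto simp: in_set_conv_nth intro!: exI[of _ m])
    then have "z \<in> cands P s (set (take k bs)) t xa" using b(2) zz ad by (auto simp: cands_def propagated_def)
    then show False using nz by blast
  qed
  then have "St xt xi \<in> cands P s (set (take m bs)) t xa"
    using assms(1) cands_mono[OF set_take_subset_set_take, of k m P s bs t xa] by blast
  then show False using ov z(2) by force
qed

lemma enabled':
  assumes k: "k < length bs" and b: "bs ! k \<notin> X"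
  shows "enabled P s' (set (take k bs) - X) (bs ! k)"
proof -
  define A where "A = set (take k bs)"
  have A: "A \<subseteq> set bs" using take_subset A_def by simp
  have en: "enabled P s A (bs ! k)" using en_at[OF k] A_def by simp
  have r: "ins_of (bs ! k) \<in> inrange P s'" using action_inrange[of "bs ! k"] k b by (simp add: inrange')
  have "enabled P s' (A - X) (bs ! k)"
  proof (cases "bs ! k")
    case (AFetch t i)
    have i: "t < length P" "i < length (Fs s' t)" using r AFetch by (simp_all add: inrange_def)
    have F: "{j. AFetch t j \<in> A} = {..<i}" using en AFetch by simp
    have "AFetch t j \<in> A - X \<longleftrightarrow> j < i" for j
    proof -
      have "AFetch t j \<in> A \<longleftrightarrow> j < i" using F by auto
      moreover have "j < i \<Longrightarrow> (t, j) \<noteq> (xt, xi)" using not_x[of j t] i(2) by simp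
      ultimately show ?thesis by auto
    qed
    then show ?thesis using AFetch i by auto
  next
    case (ALoad t i)
    have R: "(t, i) \<in> inrange P s'" using r ALoad by simp
    then have i: "t < length P" "i < length (Fs s' t)" by (simp_all add: inrange_def)
    note n = not_x[OF i(2)]
    obtain a z where e: "AFetch t i \<in> A" "ALoad t i \<notin> A" "is_load (cmd_of s t i)"
      "addr_at P s A t i = Some (Some a)" "Ls s t i = Some z"
      and rd: "is_latest P s A t a z \<or> (\<exists>j. z = St t j \<and> early_at P s A t i a j)"
      using en ALoad by auto
    have ai: "addr P s t i = Some (Some a)" using addr_at_Some e(4) by blast
    have "\<exists>z'. Ls s' t i = Some z' \<and> (is_latest P s' (A - X) t a z' \<or> (\<exists>j. z' = St t j \<and> early_at P s' (A - X) t i a j))"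
      using rd
    proof (elim disjE exE conjE)
      assume L: "is_latest P s A t a z"
      show ?thesis
      proof (cases "z = St xt xi")
        case False
        then have "is_latest P s' (A - X) t a z"
          using L cokey' unfolding is_latest_def cands'[OF A] by auto
        then show ?thesis using False e(5) n by (auto simp: sel)
      next
        case True
        note st = read_x_store[OF e(5)[unfolded True]]
        have a: "a = xa" using ai st(2) by simp
        have xc: "St xt xi \<in> cands P s A t xa" using L True a by (simp add: is_latest_def)
        \<comment> \<open>x was the latest candidate and keys are distinct, so every other candidate
          lies strictly below x.\<close>
        have max: "z' \<in> below t" if z': "z' \<in> cands P s A t xa - {St xt xi}" for z'
        proof -
          have le: "cokey s z' \<le> cokey s (St xt xi)" using L z' True a by (auto simp: is_latest_def)
          have "cokey s z' \<noteq> cokey s (St xt xi)"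
          proof (cases z')
            case (Init a')
            then show ?thesis using store_key[OF st(1)] by auto
          next
            case (St t1 i1)
            then have "store_at P s t1 i1 xa" using cands_store z' A by blast
            then show ?thesis using store_key_inj[OF _ st(1)] St z' by auto
          qed
          then show ?thesis using le z' cands_mono[OF A, of P s t xa] by (auto simp: below_def)
        qed
        \<comment> \<open>\<open>pred_store\<close> is chosen from the final candidates, but as x is
          visible here, it has arrived too.\<close>
        have "pred_store t \<in> cands P s A t xa"
          using below_stable xc pred_store(1)[OF st(1)] A_def by blast
        then have "is_latest P s' (A - X) t a (pred_store t)"
          using max pred_store(2)[OF st(1), of _ t] cokey' pred_store_neq[OF st(1)] a
          unfolding is_latest_def cands'[OF A] by auto
        then show ?thesis using True e(5) n by (auto simp: sel)
      qed
    next
      fix j assume z: "z = St t j" and ea: "early_at P s A t i a j"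
      have R': "(t, l) \<in> inrange P s'" if "l < i" for l using R that by (auto simp: inrange_def)
      have j: "j < i" using ea by (simp add: early_at_def)
      \<comment> \<open>Something follows the store in its thread, so it is not x; an early read is
        never redirected.\<close>
      have nj: "(t, j) \<noteq> (xt, xi)" using R'[OF j] by (simp add: inrange')
      have c: "cmd_of s' t l = cmd_of s t l" if "l < i" for l using cmd'[of l t] that i by simp
      have "early_at P s' (A - X) t i a j"
        using ea j nj unfolding early_at_def
        by (auto simp: addr_at'[OF R'] val_known_at'[OF R'] c)
      then show ?thesis using z e(5) n nj by (auto simp: sel)
    qed
    then show ?thesis using ALoad e n i cmd'[OF i(2)] addr_at'[OF R, of A] by auto
  next
    case (ACommit t i)
    have R: "(t, i) \<in> inrange P s'" using r ACommit by simp
    then have i: "t < length P" "i < length (Fs s' t)" by (simp_all add: inrange_def)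
    note n = not_x[OF i(2)]
    have ca: "commit_at P s A t i" using en ACommit by simp
    note C = ca[unfolded commit_at_def]
    have R': "(t, l) \<in> inrange P s'" if "l < i" for l using R that by (auto simp: inrange_def)
    have nl: "(t, l) \<noteq> (xt, xi)" if "l < i" for l using R'[OF that] by (simp add: inrange')
    have c: "cmd_of s' t l = cmd_of s t l" if "l \<le> i" for l using cmd'[of l t] that i by simp
    have lw: "last_writer s' t i = last_writer s t i" using lw'[of i t] i by (auto simp: fun_eq_iff)
    have deps: "addr_deps s' t i = addr_deps s t i" "data_deps s' t i = data_deps s t i" "ctrl_deps s' t i = ctrl_deps s t i"
      unfolding addr_deps_def data_deps_def ctrl_deps_def deps_of_def c[OF order.refl] lw using c by auto
    have "commit_at P s' (A - X) t i"
      unfolding commit_at_def deps c[OF order.refl] addr_at'[OF R] val_known_at'[OF R]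
    proof (intro conjI allI impI ballI)
      show "t < length P" "addr_at P s A t i \<noteq> Some None" "val_known_at s A t i" using C by auto
      show "AFetch t i \<in> A - X" "ACommit t i \<notin> A - X" using C n by auto
      show "ACommit t j \<in> A - X" if "j \<in> addr_deps s t i \<union> data_deps s t i \<union> ctrl_deps s t i" for j
        using C that deps_less[OF that] nl by auto
      show "ACommit t j \<in> A - X"
        if "addr_at P s A t i = Some (Some a)" "j < i" "addr_at P s' (A - X) t j \<in> {Some (Some a), Some None}" for a j
        using C that nl[OF that(2)] addr_at'[OF R'[OF that(2)], of A] by auto
      show "ALoad t i \<in> A - X" if "is_load (cmd_of s t i)" using C that n by auto
      show "\<exists>v. val P s' t i = Some (Some v) \<and> v \<noteq> 0" if "is_assume (cmd_of s t i)"
        using C that val_assume'[OF R that] by simp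
    qed
    moreover have "overtakes P s' (A - X) t t i" if "is_store (cmd_of s t i)"
      using en ACommit that overtakes' A R by simp
    ultimately show ?thesis using ACommit c by simp
  next
    case (AProp t t' i')
    have R: "(t', i') \<in> inrange P s'" using r AProp by simp
    then have i: "t' < length P" "i' < length (Fs s' t')" by (simp_all add: inrange_def)
    note n = not_x[OF i(2)]
    show ?thesis using AProp en n cmd'[OF i(2)] overtakes'[OF _ A R] by simp
  qed
  then show ?thesis by (simp add: A_def)
qed

lemma valid': "valid_from P s' {} (filter (\<lambda>b. b \<notin> X) bs)"
proof -
  have "valid_from P s' {} (filter (\<lambda>b. b \<notin> X) (take k bs))" if "k \<le> length bs" for k
    using that
  proof (induction k)
    case (Suc k)
    then have t: "take (Suc k) bs = take k bs @ [bs ! k]" by (simp add: take_Suc_conv_app_nth)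
    have "set (filter (\<lambda>b. b \<notin> X) (take k bs)) = set (take k bs) - X" by auto
    then show ?case using Suc enabled'[of k] unfolding t by (auto simp: valid_from_snoc)
  qed (simp add: valid_from_def)
  from this[of "length bs"] show ?thesis by simp
qed

lemma target': "target P s'"
proof -
  have w: "wf_fetched P s" using wf by (simp add: wf_state_def)
  have "wf_fetched P s'"
    unfolding wf_fetched_def
  proof (intro conjI allI impI)
    show "Fs s' t = []" if "length P \<le> t" for t
      using w that x by (auto simp: wf_fetched_def sel inrange_def)
    fix t i assume t: "t < length P" "i < length (Fs s' t)"
    then have i: "i < length (Fs s t)" using last by (auto simp: length_Fs' split: if_splits)
    have "i - 1 < length (Fs s' t)" using t(2) by simp
    then show "Fs s' t ! i \<in> snd (P ! t)"
      "fst (Fs s' t ! i) = (if i = 0 then fst (P ! t) else snd (snd (Fs s' t ! (i - 1))))"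
      using w t i by (simp_all add: wf_fetched_def nth_Fs')
  qed
  moreover have "is_store (cmd_of s' t i)" if "co s' (t, i) \<noteq> None" for t i
  proof -
    have n: "(t, i) \<noteq> (xt, xi)" and c: "co s (t, i) \<noteq> None" using that by (auto simp: sel split: if_splits)
    have "i \<in> Cs s t" "is_store (cmd_of s t i)" using c wf wf_keysD(1)[of s t i] by (auto simp: wf_state_def)
    moreover from this have "(t, i) \<in> inrange P s'"
      using n committed_inrange[OF wf, of i t] unfolding inrange' by (simp add: inrange_def)
    ultimately show ?thesis using cmd'[of i t] by (simp add: inrange_def)
  qed
  moreover have "p = q" if "co s' p = Some k" "co s' q = Some k" for p q k
    using that wf wf_keysD(3)[of s p k q] by (auto simp: sel wf_state_def split: if_splits)
  ultimately show ?thesis unfolding target_def by blast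
qed

lemma load':
  assumes "(t, i) \<in> inrange P s'" "is_load (cmd_of s' t i)" "addr P s' t i = Some (Some a)"
  obtains z where "Ls s t i = Some z" "z \<in> cands P s (set bs) t a" "is_load (cmd_of s t i)" "addr P s t i = Some (Some a)"
    "z \<noteq> St xt xi \<Longrightarrow> Ls s' t i = Some z"
    "z = St xt xi \<Longrightarrow> Ls s' t i = Some (pred_store t) \<and> a = xa \<and> store_at P s xt xi xa"
proof -
  have I: "(t, i) \<in> inrange P s" "(t, i) \<noteq> (xt, xi)" using assms(1) by (auto simp: inrange')
  have l: "is_load (cmd_of s t i)" using cmd'[of i t] assms(1,2) by (simp add: inrange_def)
  have ad: "addr P s t i = Some (Some a)" using addr'[OF assms(1)] assms(3) by simp
  obtain z where z: "Ls s t i = Some z" "z \<in> cands P s (set bs) t a" using load_facts[OF I(1) l] ad by auto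
  show thesis
    using that[OF z l ad] z(1) I(2) read_x_store[of t i] ad by (auto simp: sel)
qed

lemma final': "final P s'"
proof -
  have cs: "Cs s' t = {..<length (Fs s' t)}" if "t < length P" for t
    using fin that last by (auto simp: final_def sel)
  \<comment> \<open>Redirection respects lower bounds: if the load read x, a bound other than x lies
    strictly below x, hence not above \<open>pred_store t\<close>.\<close>
  have red: "cokey s' z' \<le> cokey s' (the (Ls s' t i))"
    if i: "(t, i) \<in> inrange P s'" "is_load (cmd_of s' t i)" "addr P s' t i = Some (Some a)"
      and z': "z' \<in> cands P s (set bs) t a" "z' \<noteq> St xt xi" "cokey s z' \<le> cokey s (the (Ls s t i))" for t i a z'
  proof -
    obtain z where z: "Ls s t i = Some z" "z \<noteq> St xt xi \<Longrightarrow> Ls s' t i = Some z"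
      "z = St xt xi \<Longrightarrow> Ls s' t i = Some (pred_store t) \<and> a = xa \<and> store_at P s xt xi xa"
      using load'[OF i] by blast
    show ?thesis
    proof (cases "z = St xt xi")
      case False
      then show ?thesis using z(1,2) z'(3) cokey' z'(2) by simp
    next
      case True
      then have L: "Ls s' t i = Some (pred_store t)" "a = xa" and st: "store_at P s xt xi xa" using z(3) by auto
      have "cokey s z' \<noteq> cokey s (St xt xi)"
      proof (cases z')
        case (Init a')
        then show ?thesis using store_key[OF st] by auto
      next
        case (St t1 i1)
        then have "store_at P s t1 i1 a" using cands_store z' by blast
        then show ?thesis using store_key_inj[OF _ st] St z' by auto
      qed
      then have "z' \<in> below t" using z' z(1) True L(2) by (simp add: below_def)
      then show ?thesis using L(1) pred_store(2)[OF st] cokey' z'(2) pred_store_neq[OF st] by simp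
    qed
  qed
  have ll: "cokey s' (the (Ls s' t i')) \<le> cokey s' (the (Ls s' t i))"
    if h: "t < length P" "i' < i" "i < length (Fs s' t)" "is_load (cmd_of s' t i')" "is_load (cmd_of s' t i)"
      "addr P s' t i' = Some (Some a)" "addr P s' t i = Some (Some a)" for t i i' a
  proof -
    have I: "(t, i') \<in> inrange P s'" "(t, i) \<in> inrange P s'" using h by (auto simp: inrange_def)
    obtain z' where z': "Ls s t i' = Some z'" "z' \<in> cands P s (set bs) t a" "is_load (cmd_of s t i')" "addr P s t i' = Some (Some a)"
      "z' \<noteq> St xt xi \<Longrightarrow> Ls s' t i' = Some z'"
      "z' = St xt xi \<Longrightarrow> Ls s' t i' = Some (pred_store t) \<and> a = xa \<and> store_at P s xt xi xa"
      using load'[OF I(1) h(4,6)] by blast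
    obtain z where z: "Ls s t i = Some z" "is_load (cmd_of s t i)" "addr P s t i = Some (Some a)"
      "z \<noteq> St xt xi \<Longrightarrow> Ls s' t i = Some z"
      "z = St xt xi \<Longrightarrow> Ls s' t i = Some (pred_store t) \<and> a = xa \<and> store_at P s xt xi xa"
      using load'[OF I(2) h(5,7)] by blast
    have Is: "(t, i) \<in> inrange P s" using I(2) unfolding inrange' by blast
    have le: "cokey s z' \<le> cokey s z"
      using final_load_load[OF Is h(2) z'(3) z(2) z'(4) z(3)] z'(1) z(1) by simp
    show ?thesis
    proof (cases "z' = St xt xi")
      case False
      then show ?thesis using red[OF I(2) h(5,7) z'(2)] z'(5) z(1) le by simp
    next
      case True
      then have L': "Ls s' t i' = Some (pred_store t)" and st: "store_at P s xt xi xa" using z'(6) by auto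
      show ?thesis
      proof (cases "z = St xt xi")
        \<comment> \<open>Both loads belong to thread \<open>t\<close> and are redirected to the
          same store.\<close>
        case True
        then show ?thesis using z(5) L' by simp
      next
        case False
        have "cokey s (pred_store t) < cokey s (St xt xi)" using pred_store(1)[OF st] by (simp add: below_def)
        then show ?thesis using z(4)[OF False] L' le True cokey'[OF False] cokey'[OF pred_store_neq[OF st]] by simp
      qed
    qed
  qed
  have sl: "cokey s' (St t i') \<le> cokey s' (the (Ls s' t i))"
    if h: "t < length P" "i' < i" "i < length (Fs s' t)" "is_store (cmd_of s' t i')" "is_load (cmd_of s' t i)"
      "addr P s' t i' = Some (Some a)" "addr P s' t i = Some (Some a)" for t i i' a
  proof -
    have I: "(t, i') \<in> inrange P s'" "(t, i) \<in> inrange P s'" using h by (auto simp: inrange_def)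
    have "store_at P s' t i' a" using I(1) h by (simp add: store_at_def inrange_def)
    then have st: "store_at P s t i' a" "(t, i') \<noteq> (xt, xi)" using store_at' by auto
    obtain z where z: "Ls s t i = Some z" "is_load (cmd_of s t i)" "addr P s t i = Some (Some a)"
      using load'[OF I(2) h(5,7)] by blast
    have Is: "(t, i) \<in> inrange P s" using I(2) unfolding inrange' by blast
    have "cokey s (St t i') \<le> cokey s (the (Ls s t i))"
      using final_store_load[OF Is h(2) st(1) z(2,3)] .
    then show ?thesis using red[OF I(2) h(5,7) own_store_cand[OF st(1)]] st(2) by simp
  qed
  show ?thesis unfolding final_def using cs ll sl by blast
qed

text \<open>Addresses and remaining keys do not change, so coherence among the others survives, and
  a source edge is lost only if it starts at x. A conflict through x persists because
  \<open>pred_store\<close> is coherence-before x, so whatever comes after x in coherence also comes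
  after the store now read.\<close>

lemma hbi': "hbi P s \<inter> (inrange P s - {(xt, xi)}) \<times> (inrange P s - {(xt, xi)}) \<subseteq> hbi P s'"
proof (intro subrelI)
  fix u v assume uv: "(u, v) \<in> hbi P s \<inter> (inrange P s - {(xt, xi)}) \<times> (inrange P s - {(xt, xi)})"
  then have I: "u \<in> inrange P s'" "v \<in> inrange P s'" and ne: "u \<noteq> (xt, xi)" "v \<noteq> (xt, xi)" by (auto simp: inrange')
  have coh: "coh P s' z w" if cw: "coh P s z w" "z \<noteq> St xt xi" "w \<noteq> (xt, xi)" for z w
  proof -
    obtain a where a: "store_at P s (fst w) (snd w) a"
      "z = Init a \<or> (\<exists>t i. z = St t i \<and> store_at P s t i a \<and> cokey s z < cokey s (St (fst w) (snd w)))"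
      using cw(1) unfolding coh_def by blast
    have w: "St (fst w) (snd w) \<noteq> St xt xi" using that(3) by (cases w) auto
    have "store_at P s' (fst w) (snd w) a" using a(1) that(3) by (cases w) (simp add: store_at')
    moreover have "z = Init a \<or> (\<exists>t i. z = St t i \<and> store_at P s' t i a \<and> cokey s' z < cokey s' (St (fst w) (snd w)))"
      using a(2) that(2) unfolding cokey'[OF that(2)] cokey'[OF w] store_at' by blast
    ultimately show ?thesis unfolding coh_def by blast
  qed
  have rd: "reads_from P s' w z" if rw: "reads_from P s w z" "w \<noteq> (xt, xi)" "z \<noteq> St xt xi" for w z
  proof -
    obtain t i where w: "w = (t, i)" by (cases w)
    have I: "w \<in> inrange P s'" using rw(1,2) unfolding inrange' reads_from_def by blast
    have "Ls s t i = Some (z)" "(t, i) \<noteq> (xt, xi)" using rw(1,2) w by (auto simp: reads_from_def)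
    then have "Ls s' t i = Some (z)" using rw unfolding sel by simp
    then show ?thesis using I rw(1) w cmd'[of i t] by (simp add: reads_from_def inrange_def)
  qed
  have rx: "reads_from P s' w (pred_store (fst w))" if rw: "reads_from P s w (St xt xi)" "w \<noteq> (xt, xi)" for w
  proof -
    obtain t i where w: "w = (t, i)" by (cases w)
    have I: "w \<in> inrange P s'" using rw(1,2) unfolding inrange' reads_from_def by blast
    have "Ls s t i = Some (St xt xi)" "(t, i) \<noteq> (xt, xi)" using rw(1,2) w by (auto simp: reads_from_def)
    then have "Ls s' t i = Some (pred_store t)" using rw unfolding sel by simp
    then show ?thesis using I rw(1) w cmd'[of i t] by (simp add: reads_from_def inrange_def)
  qed
  have su: "St (fst u) (snd u) \<noteq> St xt xi" using ne by (cases u) auto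
  consider "fst u = fst v" "snd u < snd v" | "coh P s (St (fst u) (snd u)) v"
    | "reads_from P s v (St (fst u) (snd u))" | z where "reads_from P s u z" "coh P s z v"
    using uv by (auto simp: hbi_def)
  then show "(u, v) \<in> hbi P s'"
  proof cases
    case 1
    then show ?thesis using hbiI(1)[OF I] by blast
  next
    case 2
    show ?thesis by (rule hbiI(2)[OF I coh[OF 2 su ne(2)]])
  next
    case 3
    show ?thesis by (rule hbiI(3)[OF I rd[OF 3 ne(2) su]])
  next
    case 4
    show ?thesis
    proof (cases "z = St xt xi")
      case False
      show ?thesis by (rule hbiI(4)[OF I rd[OF 4(1) ne(1) False] coh[OF 4(2) False ne(2)]])
    next
      case True
      have st: "store_at P s xt xi xa"
        using 4(1) True read_x_store(1)[of "fst u" "snd u"] by (simp add: reads_from_def)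
      obtain a where a: "store_at P s (fst v) (snd v) a" "store_at P s xt xi a"
        "cokey s (St xt xi) < cokey s (St (fst v) (snd v))" using 4(2) True unfolding coh_def by blast
      have "a = xa" using a(2) st by (simp add: store_at_def)
      moreover have "cokey s (pred_store (fst u)) < cokey s (St xt xi)"
        using pred_store(1)[OF st] by (simp add: below_def)
      ultimately have "coh P s (pred_store (fst u)) v"
        using pred_store_cases[OF st, of "fst u"] a(1,3) unfolding coh_def by (metis less_trans)
      then show ?thesis
        by (rule hbiI(4)[OF I rx[OF 4(1)[unfolded True] ne(1)] coh[OF _ pred_store_neq[OF st] ne(2)]])
    qed
  qed
qed

text \<open>The schedule without the actions of x is replayed towards \<open>s'\<close>. The state
  reached agrees with \<open>s'\<close> except perhaps in \<open>prp\<close>, and this suffices for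
  finality and happens-before.\<close>

lemma smaller_computation:
  obtains es u where "power_comp P es u" "inrange P u = inrange P s - {(xt, xi)}"
    "hbi P s \<inter> (inrange P s - {(xt, xi)}) \<times> (inrange P s - {(xt, xi)}) \<subseteq> hbi P u"
proof -
  let ?cs = "filter (\<lambda>b. b \<notin> X) bs"
  obtain u where u: "steps P init_state (events P s' ?cs) u" "rep P s' ({} \<union> set ?cs) u"
    using replay_run[OF valid' wf_init rep_init target'] by blast
  have rep': "rep P s' (set ?cs) u" using u(2) by simp
  have F: "AFetch t i \<in> set ?cs \<longleftrightarrow> i < length (Fs s' t)" for t i
  proof -
    have "AFetch t i \<in> set ?cs \<longleftrightarrow> (t, i) \<in> inrange P s'" using fetch_iff by (auto simp: inrange')
    moreover have "i < length (Fs s' t) \<Longrightarrow> t < length P"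
    proof -
      assume "i < length (Fs s' t)"
      then have "Fs s' t \<noteq> []" by auto
      then show "t < length P" using target' unfolding target_def wf_fetched_def by (meson not_le)
    qed
    ultimately show ?thesis by (auto simp: inrange_def)
  qed
  have C: "Cs s' t = {i. ACommit t i \<in> set ?cs}" for t
    using repD(3)[OF rep, of t] by (auto simp: sel)
  have L: "Ls s' t i = None" if "ALoad t i \<notin> set ?cs" for t i
    using that repD(4)[OF rep, of t i] by (auto simp: sel)
  have K: "co s' (t, i) = None" if "ACommit t i \<notin> set ?cs" for t i
    using that repD(5)[OF rep, of t i] by (auto simp: sel)
  note f = rep_fields[OF rep' F C L K]
  have "power_comp P (events P s' ?cs) u"
    using u(1) final' final_cong[OF f] by (simp add: power_comp_def)
  then show thesis using that hbi_cong[OF f(1-3), of P] hbi' inrange' by metis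
qed

end

context run
begin

text \<open>If every nonempty thread ends with a store, \<open>x\<close> is the po-last store that is committed last: when
  it is committed, all addresses and all assumed conditions are already determined.\<close>

lemma ex_deletion:
  assumes "inrange P s \<noteq> {}"
  obtains xt xi T where "deletion P s bs xt xi T"
proof (cases "\<exists>t<length P. Fs s t \<noteq> [] \<and> \<not> is_store (cmd_of s t (length (Fs s t) - 1))")
  case True
  then obtain t where t: "t < length P" "Fs s t \<noteq> []" "\<not> is_store (cmd_of s t (length (Fs s t) - 1))" by blast
  \<comment> \<open>Nobody reads from an instruction that is not a store, so the prefix may be the
    whole run, after which everything is known.\<close>
  have "deletion P s bs t (length (Fs s t) - 1) (length bs)"
  proof unfold_locales
    show "(t, length (Fs s t) - 1) \<in> inrange P s" "length (Fs s t) = Suc (length (Fs s t) - 1)"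
      using t by (auto simp: inrange_def)
    show "Ls s t' i \<noteq> Some (St t (length (Fs s t) - 1))" for t' i
      using wf t(3) unfolding wf_state_def wf_loads_def readable_def by fastforce
    fix t' i assume I: "(t', i) \<in> inrange P s"
    have "addr P s t' i \<noteq> Some None" using committed[OF I] wf unfolding wf_state_def wf_commits_def by blast
    then show "addr_at P s (set (take (length bs) bs)) t' i \<noteq> Some None"
      "val_known_at s (set (take (length bs) bs)) t' i"
      using addr_at_all[OF I, of "set bs"] by simp_all
  qed
  then show thesis using that by blast
next
  case False
  define L where "L = (\<lambda>t. (t, length (Fs s t) - 1)) ` {t. t < length P \<and> Fs s t \<noteq> []}"
  have Lst: "is_store (cmd_of s t i)" "(t, i) \<in> inrange P s" "length (Fs s t) = Suc i" if "(t, i) \<in> L" for t i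
    using that False by (auto simp: L_def inrange_def)
  have finL: "finite L" by (simp add: L_def)
  have neL: "L \<noteq> {}" using assms by (auto simp: L_def inrange_def)
  let ?p = "\<lambda>(t, i). pos (ACommit t i)"
  have "Max (?p ` L) \<in> ?p ` L" using finL neL by (intro Max_in) auto
  then obtain xt xi where x: "(xt, xi) \<in> L" "pos (ACommit xt xi) = Max (?p ` L)" by auto
  \<comment> \<open>The prefix stops just before the commit of x, so no load in it has found x in
    memory.\<close>
  define T where "T = pos (ACommit xt xi)"
  have max: "pos (ACommit t i) \<le> T" if "(t, i) \<in> L" for t i
    using that finL unfolding T_def x(2) by (intro Max_ge) force+
  have cx: "ACommit xt xi \<in> set bs" using commit_iff Lst(2)[OF x(1)] by simp
  have nT: "ACommit xt xi \<notin> set (take T bs)"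
  proof
    assume "ACommit xt xi \<in> set (take T bs)"
    then obtain m where "m < T" "m < length bs" "bs ! m = ACommit xt xi" by (auto simp: in_set_conv_nth)
    then show False using pos[OF cx] dist nth_eq_iff_index_eq[of bs m T] T_def by simp
  qed
  \<comment> \<open>By maximality the po-last store of every thread is committed no later than x, so
    its commit is enabled after a part of the first \<open>T\<close> actions.\<close>
  have last_commit: "\<exists>l A. A \<subseteq> set (take T bs) \<and> (\<exists>k. A = set (take k bs)) \<and> i \<le> l \<and> commit_at P s A t l \<and> is_store (cmd_of s t l)"
    if I: "(t, i) \<in> inrange P s" for t i
  proof -
    define l where "l = length (Fs s t) - 1"
    have l: "(t, l) \<in> L" "i \<le> l" using I by (auto simp: L_def l_def inrange_def)
    have c: "ACommit t l \<in> set bs" using commit_iff Lst(2)[OF l(1)] by simp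
    have "enabled P s (set (take (pos (ACommit t l)) bs)) (ACommit t l)" using en_at pos[OF c] by metis
    then have ca: "commit_at P s (set (take (pos (ACommit t l)) bs)) t l" by simp
    show ?thesis
      by (rule exI[of _ l], rule exI[of _ "set (take (pos (ACommit t l)) bs)"])
        (intro conjI exI[of _ "pos (ACommit t l)"] HOL.refl ca l(2) Lst(1)[OF l(1)] set_take_subset_set_take max[OF l(1)])
  qed
  have "deletion P s bs xt xi T"
  proof unfold_locales
    show "(xt, xi) \<in> inrange P s" "length (Fs s xt) = Suc xi" using Lst x(1) by auto
    show "Ls s t i \<noteq> Some (St xt xi)" if ld: "ALoad t i \<in> set (take T bs)" for t i
    proof
      assume Lx: "Ls s t i = Some (St xt xi)"
      obtain k where k: "k < length bs" "k < T" "bs ! k = ALoad t i" using ld by (auto simp: in_set_conv_nth)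
      have I: "(t, i) \<in> inrange P s" using load_iff k nth_mem by metis
      obtain a z where "Ls s t i = Some z"
        "is_latest P s (set (take k bs)) t a z \<or> (\<exists>j. z = St t j \<and> early_at P s (set (take k bs)) t i a j)"
        by (rule load_cases[OF k(1,3)])
      then have "is_latest P s (set (take k bs)) t a (St xt xi) \<or>
          (\<exists>j. St xt xi = St t j \<and> early_at P s (set (take k bs)) t i a j)"
        unfolding Lx by auto
      then show False
      proof (elim disjE exE conjE)
        assume "is_latest P s (set (take k bs)) t a (St xt xi)"
        then have "ACommit xt xi \<in> set (take k bs)" unfolding is_latest_def by (blast intro: cands_committed)
        then show False using nT k(2) set_take_subset_set_take[of k T bs] by auto
      next
        \<comment> \<open>An early read would need a load after x in its thread.\<close>
        fix j assume "St xt xi = St t j" "early_at P s (set (take k bs)) t i a j"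
        then have "t = xt" "xi < i" by (auto simp: early_at_def)
        then show False using I Lst(3)[OF x(1)] by (simp add: inrange_def)
      qed
    qed
    show "addr_at P s (set (take T bs)) t i \<noteq> Some None" if I: "(t, i) \<in> inrange P s" for t i
    proof -
      obtain l A k where A: "A \<subseteq> set (take T bs)" "A = set (take k bs)" "i \<le> l" "commit_at P s A t l" "is_store (cmd_of s t l)"
        using last_commit[OF I] by blast
      have "addr_at P s A t i \<noteq> Some None"
      proof (cases "i = l")
        case True
        then show ?thesis using A(4) by (simp add: commit_at_def)
      next
        case False
        then have il: "i < l" using A(3) by simp
        have "\<exists>a. addr P s t l = Some (Some a)"
          using A(4,5) addr_cases[of s t l P] by (auto simp: commit_at_def addr_at_def split: if_splits)
        then obtain a where a: "addr_at P s A t l = Some (Some a)"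
          using A(4) by (auto simp: commit_at_def addr_at_def split: if_splits)
        \<comment> \<open>The commit of the po-last store waits for earlier instructions of unknown
          address to be committed, but a committed instruction has a known address; so no earlier
          address is unknown.\<close>
        have "ACommit t i \<in> A" if "addr_at P s A t i = Some None"
          using A(4) il a that by (simp add: commit_at_def)
        then show ?thesis using commit_at_before(1)[of t i k] A(2) by blast
      qed
      then show ?thesis using addr_at_mono A(1) by blast
    qed
    show "val_known_at s (set (take T bs)) t i" if I: "(t, i) \<in> inrange P s" and as: "is_assume (cmd_of s t i)" for t i
    proof -
      obtain l A k where A: "A \<subseteq> set (take T bs)" "A = set (take k bs)" "i \<le> l" "commit_at P s A t l" "is_store (cmd_of s t l)"
        using last_commit[OF I] by blast
      have "i \<noteq> l" using A(5) as by (cases "cmd_of s t l") auto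
      \<comment> \<open>An earlier assume is a control dependency of the po-last store, hence
        committed before it and of known value.\<close>
      then have "i \<in> ctrl_deps s t l" using A(3) as by (simp add: ctrl_deps_def)
      then have "ACommit t i \<in> A" using A(4) by (auto simp: commit_at_def)
      then show ?thesis using commit_at_before(2)[of t i k] A(1,2) val_known_at_mono by blast
    qed
  qed
  then show thesis using that by blast
qed

end

section \<open>Minimal cyclic computations and the equivalence\<close>

lemma cyclic_inrange:
  assumes "cyclic_hb (trace_of P s)"
  shows "inrange P s \<noteq> {}"
proof
  assume e: "inrange P s = {}"
  have "(x, y) \<notin> hb (trace_of P s)" for x y
  proof
    assume "(x, y) \<in> hb (trace_of P s)"
    then have "(\<exists>t i. (t, i) \<in> inrange P s)"
      unfolding hb_def by (auto simp: trace_of_def Let_def store_at_def inrange_def)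
    then show False using e by blast
  qed
  then show False using assms unfolding cyclic_hb_def by (auto elim: tranclE)
qed

lemma cyclic_normal_form:
  assumes "power_comp P es0 s0" "cyclic_hb (trace_of P s0)"
  shows "\<exists>es s. power_comp P es s \<and> normal_form es (length P + 3) \<and> cyclic_hb (trace_of P s)"
proof -
  define Q where "Q s \<longleftrightarrow> (\<exists>es. power_comp P es s) \<and> cyclic_hb (trace_of P s)" for s
  have "Q s0" using assms by (auto simp: Q_def)
  then obtain s where s: "Q s" "\<And>u. Q u \<Longrightarrow> card (inrange P s) \<le> card (inrange P u)"
    using ex_has_least_nat[of Q s0 "\<lambda>u. card (inrange P u)"] by blast
  then obtain es where pc: "power_comp P es s" and cyc: "cyclic_hb (trace_of P s)" by (auto simp: Q_def)
  obtain bs where "run P s bs" using power_comp_run[OF pc] by blast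
  then interpret run P s bs .
  obtain xt xi T where "deletion P s bs xt xi T" using ex_deletion cyclic_inrange[OF cyc] by blast
  then interpret deletion P s bs xt xi T .
  let ?I = "inrange P s - {(xt, xi)}"
  obtain es1 u where u: "power_comp P es1 u" "inrange P u = ?I" "hbi P s \<inter> ?I \<times> ?I \<subseteq> hbi P u"
    using smaller_computation by blast
  have "card (inrange P u) < card (inrange P s)" unfolding u(2) using x by (intro psubset_card_mono) auto
  then have "\<not> cyclic_hb (trace_of P u)" using s(2)[of u] u(1) by (auto simp: Q_def not_le[symmetric])
  moreover have "wf_state P u" using u(1) steps_wf_state[OF _ wf_init] by (auto simp: power_comp_def)
  ultimately have "acyclic (hbi P s \<inter> ?I \<times> ?I)" using acyclic_hbi acyclic_subset u(3) by blast
  moreover have "j \<le> snd (xt, xi)" if "(fst (xt, xi), j) \<in> inrange P s" for j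
    using that last by (simp add: inrange_def)
  ultimately obtain bs' where bs': "set bs' = set bs" "valid_from P s {} bs'" "normal_form (events P s bs') (length P + 3)"
    using reorder_around[OF x _ _ card_actions_of[OF x]] by blast
  obtain u' where "power_comp P (events P s bs') u'" "trace_of P u' = trace_of P s"
    using replay[OF bs'(2)] bs'(1) by metis
  then show ?thesis using bs'(3) cyc by metis
qed

theorem theorem1:
  fixes P :: "('q, 'd :: {finite, zero}, 'r :: finite) program"
  assumes "\<forall>T \<in> set P. finite (snd T)"
  shows "robust P \<longleftrightarrow>
    \<not> (\<exists>es s. power_comp P es s \<and> normal_form es (length P + 3) \<and>
              cyclic_hb (trace_of P s))"
proof
  assume "robust P"
  then show "\<not> (\<exists>es s. power_comp P es s \<and> normal_form es (length P + 3) \<and> cyclic_hb (trace_of P s))"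
    using sc_acyclic unfolding robust_def by metis
next
  assume nf: "\<not> (\<exists>es s. power_comp P es s \<and> normal_form es (length P + 3) \<and> cyclic_hb (trace_of P s))"
  show "robust P"
    unfolding robust_def
  proof (intro allI impI)
    fix es s assume pc: "power_comp P es s"
    then have "\<not> cyclic_hb (trace_of P s)" using cyclic_normal_form nf by blast
    obtain bs where "run P s bs" using power_comp_run[OF pc] by blast
    then interpret run P s bs .
    show "\<exists>es' s'. sc_comp P es' s' \<and> trace_of P s' = trace_of P s"
      using sc_exists[OF acyclic_hbi[OF wf]] \<open>\<not> cyclic_hb (trace_of P s)\<close> by blast
  qed
qed

end
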